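(* There exist a Cantor set $K\subset\mathbb{R}\setminus\mathbb{Q}$ and a complete $\mathcal{C}^1$ vector field $\xi$ on $\mathbb{R}_+=[0,+\infty)$, vanishing only at $0$, whose flow $f^t$ at time $t$ is not $\mathcal{C}^2$ at $0$ for $t=\frac12$ but is $\mathcal{C}^\infty$ on $\mathbb{R}_+$ for all $t\in\mathbb{Z}\oplus\sum_{\tau\in K}\tau\mathbb{Z}$.
   Context: A Cantor set is a nonempty compact, perfect, totally disconnected subset of $\mathbb{R}$. The expression $\mathbb{Z}\oplus\sum_{\tau\in K}\tau\mathbb{Z}$ denotes the additive subgroup of $\mathbb{R}$ generated by $1$ and the elements of $K$. A map on $\mathbb{R}_+$ is "not $\mathcal{C}^2$ at $0$" if it is not of class $\mathcal{C}^2$ on any interval $[0,\varepsilon)$, $\varepsilon>0$. Being $\mathcal{C}^\infty$ on $\mathbb{R}_+$ includes the endpoint $0$. *)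

theory Defs
  imports "HOL-Analysis.Analysis" "HOL-Computational_Algebra.Group_Closure"
begin

definition cantor_set :: "real set \<Rightarrow> bool" where
  "cantor_set K \<longleftrightarrow> K \<noteq> {} \<and> compact K \<and> (\<forall>x\<in>K. x islimpt K)
     \<and> (\<forall>x\<in>K. connected_component_set K x = {x})"

(* Class C^k relative to S: derivatives are taken within S, hence one-sided at an endpoint
   belonging to S, and nothing is required of f off S.  It is meant for intervals S of positive
   length, where derivatives within S are unique. *)
fun Ck_on :: "nat \<Rightarrow> (real \<Rightarrow> real) \<Rightarrow> real set \<Rightarrow> bool" where
  "Ck_on 0 f S \<longleftrightarrow> continuous_on S f"
| "Ck_on (Suc k) f S \<longleftrightarrow>
     (\<exists>f'. (\<forall>x\<in>S. (f has_real_derivative f' x) (at x within S)) \<and> Ck_on k f' S)"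

definition Cinf_on :: "(real \<Rightarrow> real) \<Rightarrow> real set \<Rightarrow> bool" where
  "Cinf_on f S \<longleftrightarrow> (\<forall>k. Ck_on k f S)"

definition Ck_at_zero :: "nat \<Rightarrow> (real \<Rightarrow> real) \<Rightarrow> bool" where
  "Ck_at_zero k f \<longleftrightarrow> (\<exists>\<epsilon>>0. Ck_on k f {0..<\<epsilon>})"

(* Vector fields on the half-line are functions on the reals of which only the values on {0..}
   matter; integral curves are defined for all times and stay in {0..}. *)
definition integral_curve :: "(real \<Rightarrow> real) \<Rightarrow> (real \<Rightarrow> real) \<Rightarrow> bool" where
  "integral_curve \<xi> \<gamma> \<longleftrightarrow>
     (\<forall>t. \<gamma> t \<in> {0..} \<and> (\<gamma> has_real_derivative \<xi> (\<gamma> t)) (at t))"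

definition complete_vector_field :: "(real \<Rightarrow> real) \<Rightarrow> bool" where
  "complete_vector_field \<xi> \<longleftrightarrow> (\<forall>x\<in>{0..}. \<exists>\<gamma>. integral_curve \<xi> \<gamma> \<and> \<gamma> 0 = x)"

(* For a complete C^1 vector field these conditions determine f t x for all t and all x \<ge> 0. *)
definition is_flow :: "(real \<Rightarrow> real) \<Rightarrow> (real \<Rightarrow> real \<Rightarrow> real) \<Rightarrow> bool" where
  "is_flow \<xi> f \<longleftrightarrow> (\<forall>x\<in>{0..}. integral_curve \<xi> (\<lambda>t. f t x) \<and> f 0 x = x)"

end

theory Submission
  imports Defs
begin

text \<open>
The idea is to take an integral curve of a smooth vector field that is flat at the origin, and to
disturb its parametrisation by small oscillations that many times, but not the time one half,
fail to notice.

Let $w$ be a smooth field that is flat at $0$ and positive to the right of it, with integral curve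
$\<psi>0$ and time coordinate $\<sigma>0$. Replacing $\<psi>0(s)$ by $\<psi>0(s + H(s))$ gives an
integral curve of another field, with time coordinate $\<sigma>$. Its flow at time $t$ moves $x$ along
$w$ for the time $t + H(\<sigma>(x) + t) - H(\<sigma>(x))$. If this phase shift, as a function of $x$, is
flat at $0$, then the flow at time $t$ is smooth up to the boundary
(\<open>Cinf_on_shifted\<close>, \<open>Cinf_on_flow\<close>). The new field itself is of class $C^1$ as soon as
$H''(s) \rightarrow 0$ as $s \rightarrow -\<infinity>$ (\<open>field_C1\<close>).

The function $H$ is a sum of waves $\<epsilon>_n \sin(2\pi q_n s)$, the $n$-th one being active on the
$n$-th of infinitely many zones accumulating at $0$. At both ends of a zone the field $w$ has a speed
fixed in advance, and in the middle it has a dramatically lower speed $v_n$. A wave is switched on and off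
in the fast stretches, where a tiny amplitude makes this harmless for the phase shift. A time within a small
distance $\<delta>_n$ of a multiple of $1/q_n$ for every $n$ sees almost nothing of the
waves between the switching times either, so that its phase shift is flat at $0$
(\<open>phase_shift_small\<close>). But $q_n$ is odd, so that the time one half reverses the sign of each wave.
Its phase shift oscillates with amplitude of order $\<epsilon>_n$ on a distance at most $v_n$ during the
slow stretch; since $v_n$ is small compared with $\<epsilon>_n$, the second derivative of the map at time one
half is unbounded near $0$ (\<open>half_time_not_C2\<close>).

The choices are made zone by zone, in the order $q_n$, $\<epsilon>_n$, $v_n$, $\<delta>_n$, $q_{n+1}$
(\<open>zone_step_exists\<close>, \<open>parameters_exist\<close>). They can be made independently of the rest of
the construction because all estimates are bounds on derivatives that are insensitive to translations
of time (\<open>Ck_bound_along_solution\<close>).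

With $q_n = 3^{m(n)}$ and rapidly growing $m(n)$, the numbers $\sum_n b_n / q_n$ with digits
$b_n \in \{1, 2\}$ are that well approximated. They form a compact perfect set of Liouville numbers,
hence of irrational numbers, and this makes the set totally disconnected. The times for which the flow is
smooth on the half-line together with its inverse form a group, which takes care of
all the times generated by this set and $1$.
\<close>

section \<open>Calculus of functions of class $C^k$\<close>

lemma Ck_on_imp_continuous_on: "Ck_on k f S \<Longrightarrow> continuous_on S f"
  by (cases k) (auto intro: DERIV_continuous_on)

lemma Ck_on_SucE:
  assumes "Ck_on (Suc k) f S"
  obtains f' where "\<And>x. x \<in> S \<Longrightarrow> (f has_real_derivative f' x) (at x within S)" "Ck_on k f' S"
  using assms unfolding Ck_on.simps by blast

lemma Ck_on_SucD: "Ck_on (Suc k) f S \<Longrightarrow> Ck_on k f S"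
proof (induction k arbitrary: f)
  case 0
  then show ?case using Ck_on_imp_continuous_on[of "Suc 0" f S] by simp
next
  case (Suc k)
  then show ?case by (metis Ck_on.simps(2))
qed

lemma Ck_on_cong:
  "Ck_on k f S \<Longrightarrow> (\<And>x. x \<in> S \<Longrightarrow> f x = g x) \<Longrightarrow> Ck_on k g S"
proof (cases k)
  case 0
  assume "Ck_on k f S" "\<And>x. x \<in> S \<Longrightarrow> f x = g x"
  then show ?thesis using 0 by (simp cong: continuous_on_cong)
next
  case (Suc k')
  assume *: "Ck_on k f S" "\<And>x. x \<in> S \<Longrightarrow> f x = g x"
  then obtain f' where f': "\<And>x. x \<in> S \<Longrightarrow> (f has_real_derivative f' x) (at x within S)" "Ck_on k' f' S"
    using Suc Ck_on_SucE by metis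
  have "(g has_real_derivative f' x) (at x within S)" if "x \<in> S" for x
    using has_derivative_transform[of x S g f] f'(1)[OF that] *(2) that
    by (auto simp: has_field_derivative_def)
  then show ?thesis using Suc f'(2) by auto
qed

lemma Ck_on_subset: "Ck_on k f S \<Longrightarrow> T \<subseteq> S \<Longrightarrow> Ck_on k f T"
proof (induction k arbitrary: f)
  case 0
  then show ?case by (auto intro: continuous_on_subset)
next
  case (Suc k)
  then show ?case by (metis Ck_on.simps(2) DERIV_subset subsetD)
qed

lemma Ck_on_const: "Ck_on k (\<lambda>x. c) S"
proof (induction k arbitrary: c)
  case (Suc k)
  have "\<forall>x\<in>S. ((\<lambda>x. c) has_real_derivative 0) (at x within S)" by simp
  then show ?case using Suc[of 0] unfolding Ck_on.simps by (intro exI[of _ "\<lambda>x. 0"]) auto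
qed auto

lemma Ck_on_id: "Ck_on k (\<lambda>x. x) S"
proof (cases k)
  case (Suc k')
  have "\<forall>x\<in>S. ((\<lambda>x. x) has_real_derivative 1) (at x within S)" by simp
  then show ?thesis using Ck_on_const[of k' 1 S] Suc unfolding Suc Ck_on.simps
    by (intro exI[of _ "\<lambda>x. 1"]) auto
qed auto

lemma Ck_on_add: "Ck_on k f S \<Longrightarrow> Ck_on k g S \<Longrightarrow> Ck_on k (\<lambda>x. f x + g x) S"
proof (induction k arbitrary: f g)
  case 0
  then show ?case by (auto intro: continuous_intros)
next
  case (Suc k)
  then obtain f' g' where
    "\<forall>x\<in>S. (f has_real_derivative f' x) (at x within S)" "Ck_on k f' S"
    "\<forall>x\<in>S. (g has_real_derivative g' x) (at x within S)" "Ck_on k g' S" by auto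
  then show ?case using Suc.IH[of f' g'] unfolding Ck_on.simps
    by (intro exI[of _ "\<lambda>x. f' x + g' x"]) (auto intro: derivative_intros)
qed

lemma Ck_on_mult: "Ck_on k f S \<Longrightarrow> Ck_on k g S \<Longrightarrow> Ck_on k (\<lambda>x. f x * g x) S"
proof (induction k arbitrary: f g)
  case 0
  then show ?case by (auto intro: continuous_intros)
next
  case (Suc k)
  obtain f' where f': "\<And>x. x\<in>S \<Longrightarrow> (f has_real_derivative f' x) (at x within S)" "Ck_on k f' S"
    using Ck_on_SucE[OF Suc.prems(1)] by metis
  obtain g' where g': "\<And>x. x\<in>S \<Longrightarrow> (g has_real_derivative g' x) (at x within S)" "Ck_on k g' S"
    using Ck_on_SucE[OF Suc.prems(2)] by metis
  note d = f' g'
  have "Ck_on k (\<lambda>x. f' x * g x + g' x * f x) S"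
    by (intro Ck_on_add Suc.IH d Suc.prems Ck_on_SucD[OF Suc.prems(1)] Ck_on_SucD[OF Suc.prems(2)])
  moreover have "((\<lambda>x. f x * g x) has_real_derivative f' x * g x + g' x * f x) (at x within S)"
    if "x \<in> S" for x by (intro DERIV_mult d that)
  ultimately show ?case unfolding Ck_on.simps
    by (intro exI[of _ "\<lambda>x. f' x * g x + g' x * f x"]) auto
qed

lemma Ck_on_cmult: "Ck_on k f S \<Longrightarrow> Ck_on k (\<lambda>x. c * f x) S"
  by (intro Ck_on_mult Ck_on_const)

lemma Ck_on_minus: "Ck_on k f S \<Longrightarrow> Ck_on k (\<lambda>x. - f x) S"
  using Ck_on_cmult[of k f S "-1"] by simp

lemma Ck_on_diff: "Ck_on k f S \<Longrightarrow> Ck_on k g S \<Longrightarrow> Ck_on k (\<lambda>x. f x - g x) S"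
  using Ck_on_add[of k f S "\<lambda>x. - g x"] Ck_on_minus[of k g S] by simp

lemma Ck_on_comp:
  "Ck_on k f T \<Longrightarrow> Ck_on k g S \<Longrightarrow> g ` S \<subseteq> T \<Longrightarrow> Ck_on k (\<lambda>x. f (g x)) S"
proof (induction k arbitrary: f)
  case 0
  then show ?case by (auto intro: continuous_on_compose2)
next
  case (Suc k)
  obtain f' where f': "\<And>x. x\<in>T \<Longrightarrow> (f has_real_derivative f' x) (at x within T)" "Ck_on k f' T"
    using Ck_on_SucE[OF Suc.prems(1)] by metis
  obtain g' where g': "\<And>x. x\<in>S \<Longrightarrow> (g has_real_derivative g' x) (at x within S)" "Ck_on k g' S"
    using Ck_on_SucE[OF Suc.prems(2)] by metis
  note d = f' g'
  have "Ck_on k (\<lambda>x. f' (g x) * g' x) S"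
    by (rule Ck_on_mult[OF Suc.IH[OF d(2) Ck_on_SucD[OF Suc.prems(2)] Suc.prems(3)] d(4)])
  moreover have "((\<lambda>x. f (g x)) has_real_derivative f' (g x) * g' x) (at x within S)"
    if "x \<in> S" for x
    using DERIV_image_chain[OF DERIV_subset[OF d(1)[of "g x"] Suc.prems(3)] d(3)[OF that]] Suc.prems(3) that
    by (auto simp: o_def)
  ultimately show ?case unfolding Ck_on.simps
    by (intro exI[of _ "\<lambda>x. f' (g x) * g' x"]) auto
qed

lemma Ck_on_inverse:
  "Ck_on k f S \<Longrightarrow> (\<And>x. x \<in> S \<Longrightarrow> f x \<noteq> 0) \<Longrightarrow> Ck_on k (\<lambda>x. inverse (f x)) S"
proof (induction k)
  case 0
  then show ?case by (auto intro: continuous_intros)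
next
  case (Suc k)
  obtain f' where d: "\<And>x. x\<in>S \<Longrightarrow> (f has_real_derivative f' x) (at x within S)" "Ck_on k f' S"
    using Ck_on_SucE[OF Suc.prems(1)] by metis
  have "Ck_on k (\<lambda>x. - (f' x * (inverse (f x) * inverse (f x)))) S"
    by (intro Ck_on_minus Ck_on_mult Suc.IH d Suc.prems Ck_on_SucD[OF Suc.prems(1)])
  moreover have "((\<lambda>x. inverse (f x)) has_real_derivative - (f' x * (inverse (f x) * inverse (f x)))) (at x within S)"
    if "x \<in> S" for x
    using DERIV_inverse_fun[OF d(1)[OF that]] Suc.prems(2)[OF that] by (simp add: power2_eq_square)
  ultimately show ?case unfolding Ck_on.simps
    by (intro exI[of _ "\<lambda>x. - (f' x * (inverse (f x) * inverse (f x)))"]) auto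
qed

lemma Cinf_on_imp_continuous_on: "Cinf_on f S \<Longrightarrow> continuous_on S f"
  unfolding Cinf_on_def using Ck_on_imp_continuous_on by blast

lemma Cinf_on_comp:
  "Cinf_on f T \<Longrightarrow> Cinf_on g S \<Longrightarrow> g ` S \<subseteq> T \<Longrightarrow> Cinf_on (\<lambda>x. f (g x)) S"
  unfolding Cinf_on_def by (blast intro: Ck_on_comp)

lemma Cinf_onI_deriv_open:
  assumes "open S" "\<And>x. x \<in> S \<Longrightarrow> (f has_real_derivative f' x) (at x)" "Cinf_on f' S"
  shows "Cinf_on f S"
  unfolding Cinf_on_def
proof
  fix k
  have "\<forall>x\<in>S. (f has_real_derivative f' x) (at x within S)"
    using assms(2) by (blast intro: DERIV_subset)
  then have "Ck_on (Suc k) f S"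
    using assms(3) unfolding Cinf_on_def Ck_on.simps by blast
  then show "Ck_on k f S" by (rule Ck_on_SucD)
qed

lemma Ck_on_Suc_deriv:
  assumes "open S" "Ck_on (Suc k) f S"
  shows "\<And>x. x \<in> S \<Longrightarrow> (f has_real_derivative deriv f x) (at x)" "Ck_on k (deriv f) S"
proof -
  obtain f' where f': "\<And>x. x\<in>S \<Longrightarrow> (f has_real_derivative f' x) (at x within S)" "Ck_on k f' S"
    using Ck_on_SucE[OF assms(2)] by metis
  have d: "(f has_real_derivative f' x) (at x)" if "x \<in> S" for x
    using f'(1)[OF that] at_within_open[OF that assms(1)] by simp
  show "(f has_real_derivative deriv f x) (at x)" if "x \<in> S" for x
    using d[OF that] DERIV_imp_deriv[OF d[OF that]] by simp
  show "Ck_on k (deriv f) S"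
    by (rule Ck_on_cong[OF f'(2)]) (simp add: DERIV_imp_deriv[OF d])
qed

lemma Cinf_on_deriv:
  assumes "open S" "Cinf_on f S"
  shows "\<And>x. x \<in> S \<Longrightarrow> (f has_real_derivative deriv f x) (at x)" "Cinf_on (deriv f) S"
  using Ck_on_Suc_deriv[OF assms(1)] assms(2) unfolding Cinf_on_def by blast+

lemma Cinf_on_higher_deriv:
  assumes "open S" "Cinf_on f S"
  shows "Cinf_on ((deriv ^^ k) f) S"
  by (induction k) (use assms Cinf_on_deriv(2) in auto)

text \<open>By the mean value theorem the difference quotients at the exceptional point are values of the derivative nearby. This gives differentiability at the origin whenever a formula for the derivative is only available away from it.\<close>

lemma continuous_derivative_imp_DERIV:
  fixes f f' :: "real \<Rightarrow> real"
  assumes cont: "isCont f a" and der: "\<And>x. x \<noteq> a \<Longrightarrow> (f has_real_derivative f' x) (at x)"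
    and lim: "(f' \<longlongrightarrow> l) (at a)"
  shows "(f has_real_derivative l) (at a)"
proof -
  have "((\<lambda>x. (f x - f a) / (x - a)) \<longlongrightarrow> l) (at a)"
  proof (rule tendstoI)
    fix e :: real assume "e > 0"
    then obtain d where d: "d > 0" "\<And>x. x \<noteq> a \<Longrightarrow> dist x a < d \<Longrightarrow> dist (f' x) l < e"
      using lim unfolding tendsto_iff eventually_at by auto
    have cf: "isCont f x" for x
      by (cases "x = a") (use cont der DERIV_isCont in auto)
    have mvt: "\<exists>z. u < z \<and> z < v \<and> f v - f u = (v - u) * f' z"
      if uv: "u < v" and a: "a \<le> u \<or> v \<le> a" for u v
    proof -
      have d: "(f has_real_derivative f' x) (at x)" if "u < x" "x < v" for x
        using der[of x] a that by auto
      have "\<exists>l z. u < z \<and> z < v \<and> (f has_real_derivative l) (at z) \<and> f v - f u = (v - u) * l"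
        by (rule MVT[OF uv]) (use cf d in \<open>auto simp: continuous_at_imp_continuous_on real_differentiable_def\<close>)
      then show ?thesis using d DERIV_unique by metis
    qed
    have "dist ((f x - f a) / (x - a)) l < e" if x: "x \<noteq> a" "dist x a < d" for x
    proof (cases "x < a")
      case True
      obtain z where z: "x < z" "z < a" "(f a - f x) = (a - x) * f' z"
        using mvt[OF True] by auto
      then have "(f x - f a) / (x - a) = f' z" using True by (simp add: field_simps)
      then show ?thesis using d(2)[of z] z x by (auto simp: dist_real_def)
    next
      case False
      then have lt: "a < x" using x by simp
      obtain z where z: "a < z" "z < x" "(f x - f a) = (x - a) * f' z"
        using mvt[OF lt] by auto
      then have "(f x - f a) / (x - a) = f' z" using lt by (simp add: field_simps)
      then show ?thesis using d(2)[of z] z x lt by (auto simp: dist_real_def)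
    qed
    then show "\<forall>\<^sub>F x in at a. dist ((f x - f a) / (x - a)) l < e"
      unfolding eventually_at using d(1) by blast
  qed
  then show ?thesis by (simp add: has_field_derivative_iff)
qed

section \<open>Uniform bounds on derivatives\<close>

text \<open>A quantitative companion of the class $C^k$: one constant bounds all derivatives up to order $k$. Every smallness condition imposed on the parameters of the construction is a statement of this form. The recursion follows the derivative, so that the calculus rules below are proved by induction on $k$.\<close>

fun Ck_bound :: "nat \<Rightarrow> real \<Rightarrow> real set \<Rightarrow> (real \<Rightarrow> real) \<Rightarrow> bool" where
  "Ck_bound 0 B U f \<longleftrightarrow> (\<forall>x\<in>U. \<bar>f x\<bar> \<le> B)"
| "Ck_bound (Suc k) B U f \<longleftrightarrow> (\<forall>x\<in>U. \<bar>f x\<bar> \<le> B) \<and>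
     (\<exists>f'. (\<forall>x\<in>U. (f has_real_derivative f' x) (at x)) \<and> Ck_bound k B U f')"

lemma Ck_bound_abs: "Ck_bound k B U f \<Longrightarrow> x \<in> U \<Longrightarrow> \<bar>f x\<bar> \<le> B"
  by (cases k) auto

declare Ck_bound.simps(2) [simp del]

lemma Ck_bound_SucI:
  "(\<And>x. x \<in> U \<Longrightarrow> \<bar>f x\<bar> \<le> B) \<Longrightarrow> (\<And>x. x \<in> U \<Longrightarrow> (f has_real_derivative f' x) (at x)) \<Longrightarrow>
    Ck_bound k B U f' \<Longrightarrow> Ck_bound (Suc k) B U f"
  unfolding Ck_bound.simps by blast

lemma Ck_bound_mono: "Ck_bound k B U f \<Longrightarrow> B \<le> B' \<Longrightarrow> V \<subseteq> U \<Longrightarrow> Ck_bound k B' V f"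
proof (induction k arbitrary: f)
  case 0 then show ?case by fastforce
next
  case (Suc k)
  then obtain f' where f': "\<forall>x\<in>U. (f has_real_derivative f' x) (at x)" "Ck_bound k B U f'" unfolding Ck_bound.simps by blast
  show ?case
  proof (rule Ck_bound_SucI)
    show "\<bar>f x\<bar> \<le> B'" if "x \<in> V" for x
      using Ck_bound_abs[OF Suc.prems(1), of x] Suc.prems that by auto
    show "Ck_bound k B' V f'" using Suc f' by blast
  qed (use f' Suc.prems in blast)
qed

lemma Ck_bound_SucD: "Ck_bound (Suc k) B U f \<Longrightarrow> Ck_bound k B U f"
proof (induction k arbitrary: f)
  case 0 then show ?case by (auto dest: Ck_bound_abs)
next
  case (Suc k)
  obtain f' where f': "\<forall>x\<in>U. (f has_real_derivative f' x) (at x)" "Ck_bound (Suc k) B U f'"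
    using Suc.prems unfolding Ck_bound.simps(2)[of "Suc k"] by blast
  show ?case
    by (rule Ck_bound_SucI[OF _ _ Suc.IH[OF f'(2)]]) (use f' Ck_bound_abs[OF Suc.prems] in blast)+
qed

lemma Ck_bound_le: "Ck_bound k B U f \<Longrightarrow> j \<le> k \<Longrightarrow> Ck_bound j B U f"
proof (induction k)
  case (Suc k)
  then show ?case by (cases "j = Suc k") (simp_all add: Ck_bound_SucD)
qed simp

lemma Ck_bound_cong:
  assumes "open U" "\<And>x. x \<in> U \<Longrightarrow> f x = g x" "Ck_bound k B U f"
  shows "Ck_bound k B U g"
proof (cases k)
  case 0 then show ?thesis using assms by auto
next
  case (Suc k')
  then obtain f' where f': "\<forall>x\<in>U. (f has_real_derivative f' x) (at x)" "Ck_bound k' B U f'"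
    using assms(3) unfolding Suc Ck_bound.simps by blast
  have "(g has_real_derivative f' x) (at x)" if "x \<in> U" for x
    using has_field_derivative_transform_within_open[of f "f' x" x U g] f'(1) that assms by auto
  moreover have "\<bar>g x\<bar> \<le> B" if "x \<in> U" for x
    using Ck_bound_abs[OF assms(3) that] assms(2)[OF that] by simp
  ultimately show ?thesis unfolding Suc using f'(2) by (intro Ck_bound_SucI[of _ _ _ f'])
qed

lemma Ck_bound_deriv:
  assumes "open U" "Ck_bound (Suc k) B U f"
  shows "Ck_bound k B U (deriv f)"
proof -
  obtain f' where f': "\<forall>x\<in>U. (f has_real_derivative f' x) (at x)" "Ck_bound k B U f'"
    using assms unfolding Ck_bound.simps by blast
  show ?thesis
    by (rule Ck_bound_cong[OF assms(1) _ f'(2)]) (use f'(1) in \<open>auto simp: DERIV_imp_deriv\<close>)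
qed

lemma Ck_bound_higher_deriv:
  "open U \<Longrightarrow> Ck_bound k B U f \<Longrightarrow> j \<le> k \<Longrightarrow> x \<in> U \<Longrightarrow> \<bar>(deriv ^^ j) f x\<bar> \<le> B"
proof (induction j arbitrary: k f)
  case 0
  then show ?case by (auto dest: Ck_bound_abs)
next
  case (Suc j)
  then obtain k' where k: "k = Suc k'" by (cases k) auto
  show ?case using Suc.IH[of k' "deriv f"] Ck_bound_deriv[of U k' B f] Suc.prems k
    by (simp del: funpow.simps add: funpow_Suc_right)
qed

lemma Ck_boundI_higher_deriv:
  assumes "open U" "Cinf_on f U" "\<And>j x. j \<le> k \<Longrightarrow> x \<in> U \<Longrightarrow> \<bar>(deriv ^^ j) f x\<bar> \<le> B"
  shows "Ck_bound k B U f"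
  using assms
proof (induction k arbitrary: f)
  case 0
  then show ?case using "0.prems"(3)[of 0] by auto
next
  case (Suc k)
  have "Ck_bound k B U (deriv f)"
  proof (rule Suc.IH)
    show "\<bar>(deriv ^^ j) (deriv f) x\<bar> \<le> B" if "j \<le> k" "x \<in> U" for j x
      using Suc.prems(3)[of "Suc j" x] that by (simp del: funpow.simps add: funpow_Suc_right)
  qed (use Suc.prems Cinf_on_deriv in auto)
  then show ?case
    using Suc.prems Cinf_on_deriv(1)[of U f] Suc.prems(3)[of 0] by (intro Ck_bound_SucI) auto
qed

lemma Ck_bound_const: "Ck_bound k \<bar>c\<bar> U (\<lambda>x. c)"
proof -
  have z: "Ck_bound k B U (\<lambda>x. 0)" if "B \<ge> 0" for k and B :: real
    using that by (induction k) (auto intro!: Ck_bound_SucI[of _ _ _ "\<lambda>x. 0"])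
  show ?thesis using z[of "\<bar>c\<bar>"] by (cases k) (auto intro!: Ck_bound_SucI[of _ _ _ "\<lambda>x. 0"])
qed

lemma Ck_bound_add:
  "Ck_bound k A U f \<Longrightarrow> Ck_bound k B U g \<Longrightarrow> Ck_bound k (A + B) U (\<lambda>x. f x + g x)"
proof (induction k arbitrary: f g)
  case 0 then show ?case by (fastforce intro: order_trans[OF abs_triangle_ineq])
next
  case (Suc k)
  then obtain f' g' where d: "\<forall>x\<in>U. (f has_real_derivative f' x) (at x)" "Ck_bound k A U f'"
     "\<forall>x\<in>U. (g has_real_derivative g' x) (at x)" "Ck_bound k B U g'" unfolding Ck_bound.simps by blast
  show ?case
  proof (rule Ck_bound_SucI)
    show "Ck_bound k (A + B) U (\<lambda>x. f' x + g' x)" by (intro Suc.IH d)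
    show "\<bar>f x + g x\<bar> \<le> A + B" if "x \<in> U" for x
      using Ck_bound_abs[OF Suc.prems(1) that] Ck_bound_abs[OF Suc.prems(2) that] by linarith
  qed (use d in \<open>auto intro: derivative_intros\<close>)
qed

lemma Ck_bound_mult:
  "Ck_bound k A U f \<Longrightarrow> Ck_bound k B U g \<Longrightarrow> Ck_bound k (2 ^ k * (A * B)) U (\<lambda>x. f x * g x)"
proof (cases "U = {}")
  case True
  have "Ck_bound k C {} h" for C h by (induction k arbitrary: h) (auto simp: Ck_bound.simps)
  then show ?thesis using True by simp
next
  case ne: False
  show "Ck_bound k A U f \<Longrightarrow> Ck_bound k B U g \<Longrightarrow> ?thesis"
  proof (induction k arbitrary: f g)
    case 0 
    have "\<bar>f x\<bar> * \<bar>g x\<bar> \<le> A * B" if "x \<in> U" for x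
      using 0 that by (intro mult_mono) (auto intro: order_trans[OF abs_ge_zero])
    then show ?case by (simp add: abs_mult)
  next
    case (Suc k)
    then obtain f' g' where d: "\<forall>x\<in>U. (f has_real_derivative f' x) (at x)" "Ck_bound k A U f'"
       "\<forall>x\<in>U. (g has_real_derivative g' x) (at x)" "Ck_bound k B U g'" unfolding Ck_bound.simps by blast
    obtain u where u: "u \<in> U" using ne by auto
    have A: "A \<ge> 0" using Ck_bound_abs[OF Suc.prems(1) u] by linarith
    have B: "B \<ge> 0" using Ck_bound_abs[OF Suc.prems(2) u] by linarith
    show ?case
    proof (rule Ck_bound_SucI)
      show "((\<lambda>x. f x * g x) has_real_derivative f' x * g x + f x * g' x) (at x)" if "x \<in> U" for x
        using d that by (auto intro!: derivative_eq_intros)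
      have "Ck_bound k (2 ^ k * (A * B) + 2 ^ k * (A * B)) U (\<lambda>x. f' x * g x + f x * g' x)"
        by (intro Ck_bound_add Suc.IH d Ck_bound_SucD[OF Suc.prems(1)] Ck_bound_SucD[OF Suc.prems(2)])
      then show "Ck_bound k (2 ^ Suc k * (A * B)) U (\<lambda>x. f' x * g x + f x * g' x)"
        by (simp add: algebra_simps)
      have "\<bar>f x * g x\<bar> \<le> A * B" if "x \<in> U" for x
        unfolding abs_mult
        using Ck_bound_abs[OF Suc.prems(1) that] Ck_bound_abs[OF Suc.prems(2) that] A
        by (intro mult_mono) auto
      moreover have "1 * (A * B) \<le> 2 ^ Suc k * (A * B)"
        using A B one_le_power[of "2::real" "Suc k"] by (intro mult_right_mono) auto
      ultimately show "\<bar>f x * g x\<bar> \<le> 2 ^ Suc k * (A * B)" if "x \<in> U" for x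
        using that by fastforce
    qed
  qed
qed

lemma Ck_bound_cmult:
  "Ck_bound k B U f \<Longrightarrow> Ck_bound k (\<bar>c\<bar> * B) U (\<lambda>x. c * f x)"
proof (induction k arbitrary: f)
  case 0 then show ?case by (auto simp: abs_mult intro: mult_left_mono)
next
  case (Suc k)
  then obtain f' where d: "\<forall>x\<in>U. (f has_real_derivative f' x) (at x)" "Ck_bound k B U f'" unfolding Ck_bound.simps by blast
  show ?case
    by (rule Ck_bound_SucI[of _ _ _ "\<lambda>x. c * f' x"])
       (use d Suc Ck_bound_abs[OF Suc.prems(1)] in \<open>auto simp: abs_mult intro!: mult_left_mono DERIV_cmult\<close>)
qed

lemma Ck_bound_diff:
  "Ck_bound k A U f \<Longrightarrow> Ck_bound k B U g \<Longrightarrow> Ck_bound k (A + B) U (\<lambda>x. f x - g x)"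
  using Ck_bound_add[of k A U f B "\<lambda>x. - g x"] Ck_bound_cmult[of k B U g "-1"] by simp

lemma Ck_bound_affine:
  assumes "Ck_bound k B UNIV f" "1 \<le> \<bar>a\<bar>"
  shows "Ck_bound k (\<bar>a\<bar> ^ k * B) U (\<lambda>x. f (a * x + b))"
  using assms(1)
proof (induction k arbitrary: f)
  case 0 then show ?case by auto
next
  case (Suc k)
  then obtain f' where d: "\<And>x. (f has_real_derivative f' x) (at x)" "Ck_bound k B UNIV f'" unfolding Ck_bound.simps by blast
  have B: "B \<ge> 0" using Ck_bound_abs[OF Suc.prems, of 0] by simp
  show ?case
  proof (rule Ck_bound_SucI)
    show "((\<lambda>x. f (a * x + b)) has_real_derivative a * f' (a * x + b)) (at x)" for x
    proof -
      have "((\<lambda>x. a * x + b) has_real_derivative a) (at x)" by (auto intro!: derivative_eq_intros)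
      from DERIV_chain2[OF d(1) this] show ?thesis by (simp only: mult.commute[of a "f' _"])
    qed
    show "Ck_bound k (\<bar>a\<bar> ^ Suc k * B) U (\<lambda>x. a * f' (a * x + b))"
      using Ck_bound_cmult[OF Suc.IH[OF d(2)], of a] by (simp add: mult_ac)
    have "1 * B \<le> \<bar>a\<bar> ^ Suc k * B" using one_le_power[OF assms(2), of "Suc k"] B
      by (intro mult_right_mono) auto
    then show "\<bar>f (a * x + b)\<bar> \<le> \<bar>a\<bar> ^ Suc k * B" for x
      using Ck_bound_abs[OF Suc.prems, of "a * x + b"] by simp
  qed
qed

lemma Ck_bound_shift:
  assumes "Ck_bound k B UNIV f"
  shows "Ck_bound k B U (\<lambda>x. f (x + b))"
  using Ck_bound_affine[OF assms, of 1 U b] by simp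

text \<open>The constant depends only on $k$ and on the bound for $f$, and not on $f$ or the domain; the same holds for the next lemma. This uniformity is what allows parameters to be fixed one zone at a time, before the rest of the vector field is known.\<close>

lemma Ck_bound_inverse:
  assumes "B \<ge> 0"
  shows "\<exists>C. \<forall>U f. Ck_bound k B U f \<longrightarrow> (\<forall>x\<in>U. 1/2 \<le> f x) \<longrightarrow> Ck_bound k C U (\<lambda>x. inverse (f x))"
proof (induction k)
  case 0
  have "\<bar>inverse y\<bar> \<le> 2" if "1/2 \<le> y" for y :: real 
    using that by (simp add: field_simps abs_if)
  then show ?case by (intro exI[of _ 2]) auto
next
  case (Suc k)
  then obtain C where C: "\<And>U f. Ck_bound k B U f \<Longrightarrow> (\<forall>x\<in>U. 1/2 \<le> f x) \<Longrightarrow> Ck_bound k C U (\<lambda>x. inverse (f x))"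
    by blast
  define C' where "C' = max 2 (2 ^ k * (B * (2 ^ k * (C * C))))"
  have "Ck_bound (Suc k) C' U (\<lambda>x. inverse (f x))"
    if f: "Ck_bound (Suc k) B U f" "\<forall>x\<in>U. 1/2 \<le> f x" for U f
  proof -
    obtain f' where d: "\<forall>x\<in>U. (f has_real_derivative f' x) (at x)" "Ck_bound k B U f'" using f unfolding Ck_bound.simps by blast
    show ?thesis
    proof (rule Ck_bound_SucI)
      show "\<bar>inverse (f x)\<bar> \<le> C'" if "x \<in> U" for x
      proof -
        have "1/2 \<le> f x" using f that by auto
        then have "\<bar>inverse (f x)\<bar> \<le> 2" by (simp add: field_simps abs_if)
        then show ?thesis unfolding C'_def by linarith
      qed
      show "((\<lambda>x. inverse (f x)) has_real_derivative (-1) * (f' x * (inverse (f x) * inverse (f x)))) (at x)"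
        if "x \<in> U" for x
      proof -
        have "f x \<noteq> 0" using f(2) that by force
        then show ?thesis using DERIV_inverse_fun[of f "f' x" x] d that by (simp add: power2_eq_square)
      qed
      have "Ck_bound k (\<bar>-1\<bar> * (2 ^ k * (B * (2 ^ k * (C * C))))) U
              (\<lambda>x. (-1) * (f' x * (inverse (f x) * inverse (f x))))"
        by (intro Ck_bound_cmult Ck_bound_mult C d Ck_bound_SucD[OF f(1)] f(2))
      then show "Ck_bound k C' U (\<lambda>x. (-1) * (f' x * (inverse (f x) * inverse (f x))))"
        by (rule Ck_bound_mono) (auto simp: C'_def)
    qed
  qed
  then show ?case by blast
qed

text \<open>The function $\<sigma>$ is meant to be the time coordinate of a vector field, which solves an equation $\<sigma>' = m(\<sigma>)\rho$. A derivative of $J \circ \<sigma>$ is then $((J'm) \circ \<sigma>)\rho$, again of the same kind, so that no information on $\<sigma>$ beyond bounds on $m$ and $\rho$ is needed, and the estimate is linear in the bound for $J$.\<close>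

lemma Ck_bound_along_solution:
  assumes "B \<ge> 0"
  shows "\<exists>C\<ge>0. \<forall>U \<sigma> m \<rho> J b. Ck_bound k B UNIV m \<longrightarrow> Ck_bound k B U \<rho> \<longrightarrow>
     (\<forall>x\<in>U. (\<sigma> has_real_derivative m (\<sigma> x) * \<rho> x) (at x)) \<longrightarrow> Ck_bound k b UNIV J \<longrightarrow>
     Ck_bound k (C * b) U (\<lambda>x. J (\<sigma> x))"
proof (induction k)
  case 0
  then show ?case by (intro exI[of _ 1]) auto
next
  case (Suc k)
  then obtain C where C: "C \<ge> 0" "\<And>U \<sigma> m \<rho> J b. Ck_bound k B UNIV m \<Longrightarrow> Ck_bound k B U \<rho> \<Longrightarrow>
     (\<forall>x\<in>U. (\<sigma> has_real_derivative m (\<sigma> x) * \<rho> x) (at x)) \<Longrightarrow> Ck_bound k b UNIV J \<Longrightarrow>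
     Ck_bound k (C * b) U (\<lambda>x. J (\<sigma> x))" by metis
  define E where "E = 2 ^ k * (C * (2 ^ k * B) * B)"
  have E: "E \<ge> 0" using assms C by (simp add: E_def)
  have "Ck_bound (Suc k) ((1 + E) * b) U (\<lambda>x. J (\<sigma> x))"
    if m: "Ck_bound (Suc k) B UNIV m" and \<rho>: "Ck_bound (Suc k) B U \<rho>"
      and \<sigma>: "\<forall>x\<in>U. (\<sigma> has_real_derivative m (\<sigma> x) * \<rho> x) (at x)" and J: "Ck_bound (Suc k) b UNIV J"
    for U \<sigma> m \<rho> J b
  proof -
    obtain J' where d: "\<And>x. (J has_real_derivative J' x) (at x)" "Ck_bound k b UNIV J'"
      using J unfolding Ck_bound.simps by blast
    have b: "b \<ge> 0" using Ck_bound_abs[OF J, of 0] by simp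
    show ?thesis
    proof (rule Ck_bound_SucI)
      have "b \<le> (1 + E) * b" using E b by (simp add: algebra_simps)
      then show "\<bar>J (\<sigma> x)\<bar> \<le> (1 + E) * b" for x
        using Ck_bound_abs[OF J, of "\<sigma> x"] by simp
      show "((\<lambda>x. J (\<sigma> x)) has_real_derivative (J' (\<sigma> x) * m (\<sigma> x)) * \<rho> x) (at x)" if "x \<in> U" for x
        using DERIV_chain2[OF d(1), of \<sigma>] \<sigma> that by (simp add: mult.assoc)
      have "Ck_bound k (2 ^ k * (b * B)) UNIV (\<lambda>s. J' s * m s)"
        by (intro Ck_bound_mult d Ck_bound_SucD[OF m])
      then have "Ck_bound k (C * (2 ^ k * (b * B))) U (\<lambda>x. J' (\<sigma> x) * m (\<sigma> x))"
        using C(2)[OF Ck_bound_SucD[OF m] Ck_bound_SucD[OF \<rho>] \<sigma>] by blast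
      then have "Ck_bound k (2 ^ k * (C * (2 ^ k * (b * B)) * B)) U (\<lambda>x. J' (\<sigma> x) * m (\<sigma> x) * \<rho> x)"
        by (intro Ck_bound_mult Ck_bound_SucD[OF \<rho>])
      then show "Ck_bound k ((1 + E) * b) U (\<lambda>x. J' (\<sigma> x) * m (\<sigma> x) * \<rho> x)"
        by (rule Ck_bound_mono) (use b in \<open>auto simp: E_def algebra_simps\<close>)
    qed
  qed
  moreover have "0 \<le> 1 + E" using E by simp
  ultimately show ?case by blast
qed

text \<open>Two translates of a function by nearly equal amounts are close in $C^k$: the mean value theorem costs one derivative.\<close>

lemma Ck_bound_translate_diff:
  assumes "Ck_bound (Suc k) B UNIV f"
  shows "Ck_bound k (\<bar>a - b\<bar> * B) U (\<lambda>s. f (s + a) - f (s + b))"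
  using assms
proof (induction k arbitrary: f)
  have lip: "\<bar>f (s + a) - f (s + b)\<bar> \<le> \<bar>a - b\<bar> * B"
    if f': "\<And>x. (f has_real_derivative f' x) (at x)" "\<And>x. \<bar>f' x\<bar> \<le> B" for f f' :: "real \<Rightarrow> real" and s
  proof -
    have "norm (f (s + a) - f (s + b)) \<le> B * norm ((s + a) - (s + b))"
      by (rule field_differentiable_bound[of UNIV f f']) (simp_all add: f')
    then show ?thesis by (simp add: mult.commute)
  qed
  {
    case 0
    then obtain f' where d: "\<And>x. (f has_real_derivative f' x) (at x)" "\<And>x. \<bar>f' x\<bar> \<le> B" unfolding Ck_bound.simps by blast
    show ?case using lip[OF d] by simp
  next
    case (Suc k)
    then obtain f' where d: "\<And>x. (f has_real_derivative f' x) (at x)" "Ck_bound (Suc k) B UNIV f'"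
      by (subst (asm) Ck_bound.simps) blast
    show ?case
    proof (rule Ck_bound_SucI)
      show "\<bar>f (s + a) - f (s + b)\<bar> \<le> \<bar>a - b\<bar> * B" for s
        by (rule lip[OF d(1)]) (use Ck_bound_abs[OF d(2)] in blast)
      show "((\<lambda>s. f (s + a) - f (s + b)) has_real_derivative f' (s + a) - f' (s + b)) (at s)" for s
        using d(1)[of "s + a"] d(1)[of "s + b"] by (intro DERIV_diff) (simp_all only: DERIV_shift)
      show "Ck_bound k (\<bar>a - b\<bar> * B) U (\<lambda>s. f' (s + a) - f' (s + b))"
        by (rule Suc.IH[OF d(2)])
    qed
  }
qed

section \<open>Flat extensions, smooth series and a smooth step\<close>

text \<open>Smoothness at the origin is obtained everywhere below in this way: a function that is smooth to the right of the origin, and all of whose derivatives tend to zero there, extends by zero to a smooth function. The lemma applies to all derivatives at once because its hypotheses pass from $f$ to its derivative.\<close>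

lemma Cinf_on_flat_extension:
  fixes f :: "real \<Rightarrow> real"
  assumes "Cinf_on f {0<..}" "\<And>x. x \<le> 0 \<Longrightarrow> f x = 0"
    and "\<And>k. ((deriv ^^ k) f \<longlongrightarrow> 0) (at_right 0)"
  shows "Cinf_on f UNIV" "\<And>x. x \<le> 0 \<Longrightarrow> deriv f x = 0"
proof -
  have *: "(f has_real_derivative deriv f x) (at x) \<and> (x \<le> 0 \<longrightarrow> deriv f x = 0)"
    if f: "Cinf_on f {0<..}" "\<And>x. x \<le> 0 \<Longrightarrow> f x = 0" "\<And>k. ((deriv ^^ k) f \<longlongrightarrow> 0) (at_right 0)"
    for f :: "real \<Rightarrow> real" and x
  proof -
    have neg: "(f has_real_derivative 0) (at x)" if "x < 0" for x
      by (rule has_field_derivative_transform_within_open[of "\<lambda>x. 0" 0 x "{..<0}"]) (use that f in auto)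
    have pos: "(f has_real_derivative deriv f x) (at x)" if "x > 0" for x
      using Cinf_on_deriv(1)[OF _ f(1)] that by simp
    define f' where "f' x = (if x \<le> 0 then 0 else deriv f x)" for x
    have l0: "eventually (\<lambda>x. 0 = h x) (at_left 0)" if "\<And>x. x \<le> 0 \<Longrightarrow> h x = 0" for h :: "real \<Rightarrow> real"
      using that by (auto simp: eventually_at_left_field intro: exI[of _ "-1"])
    have r0: "eventually (\<lambda>x. h x = (if x \<le> 0 then 0 else h x)) (at_right 0)" for h :: "real \<Rightarrow> real"
      by (auto simp: eventually_at_right_field intro: exI[of _ "1"])
    have "(f \<longlongrightarrow> 0) (at_left 0)" 
      by (rule iffD1[OF tendsto_cong[OF l0] tendsto_const]) (rule f(2))
    then have "(f \<longlongrightarrow> 0) (at 0)" using f(3)[of 0] by (simp add: filterlim_split_at)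
    then have cont: "isCont f 0" using f(2)[of 0] by (simp add: isCont_def)
    have "(f' \<longlongrightarrow> 0) (at_left 0)" 
      by (rule iffD1[OF tendsto_cong[OF l0] tendsto_const]) (simp add: f'_def)
    moreover have "(f' \<longlongrightarrow> 0) (at_right 0)"
      using tendsto_cong[OF r0[of "deriv f"]] f(3)[of 1] by (simp add: f'_def[abs_def])
    ultimately have lim: "(f' \<longlongrightarrow> 0) (at 0)" by (simp add: filterlim_split_at)
    have "(f has_real_derivative f' x) (at x)" if "x \<noteq> 0" for x
      using neg pos that by (auto simp: f'_def)
    then have zero: "(f has_real_derivative 0) (at 0)"
      using continuous_derivative_imp_DERIV[OF cont _ lim] by blast
    have D: "(f has_real_derivative f' x) (at x)"
      using neg pos zero by (cases "x = 0") (auto simp: f'_def)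
    have "deriv f x = f' x" by (rule DERIV_imp_deriv[OF D])
    then show ?thesis using D by (metis f'_def)
  qed
  have "Ck_on k f UNIV"
    if f: "Cinf_on f {0<..}" "\<And>x. x \<le> 0 \<Longrightarrow> f x = 0" "\<And>k. ((deriv ^^ k) f \<longlongrightarrow> 0) (at_right 0)"
    for k and f :: "real \<Rightarrow> real"
    using that
  proof (induction k arbitrary: f)
    case 0
    have "isCont f x" for x using *[OF 0, of x] DERIV_isCont by blast
    then show ?case by (simp add: continuous_at_imp_continuous_on)
  next
    case (Suc k)
    have "Ck_on k (deriv f) UNIV"
    proof (rule Suc.IH)
      show "((deriv ^^ j) (deriv f) \<longlongrightarrow> 0) (at_right 0)" for j
        using Suc.prems(3)[of "Suc j"] by (simp del: funpow.simps add: funpow_Suc_right)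
    qed (use *[OF Suc.prems] Cinf_on_deriv(2)[OF _ Suc.prems(1)] in auto)
    moreover have "\<forall>x\<in>UNIV. (f has_real_derivative deriv f x) (at x)" using *[OF Suc.prems] by blast
    ultimately show ?case unfolding Ck_on.simps by blast
  qed
  then show "Cinf_on f UNIV" using assms unfolding Cinf_on_def by blast
  show "deriv f x = 0" if "x \<le> 0" for x using *[OF assms, of x] that by blast
qed

text \<open>The Weierstrass test, applied to the series of $k$-th derivatives for each $k$.\<close>

lemma Cinf_on_series:
  fixes f :: "nat \<Rightarrow> real \<Rightarrow> real"
  assumes f: "\<And>n. Cinf_on (f n) UNIV"
    and M: "\<And>k. \<exists>M. summable M \<and> (\<forall>n x. \<bar>(deriv ^^ k) (f n) x\<bar> \<le> M n)"
  shows "Cinf_on (\<lambda>x. \<Sum>n. f n x) UNIV"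
proof -
  have d: "((deriv ^^ k) (f n) has_real_derivative (deriv ^^ Suc k) (f n) x) (at x)" for k n x
    using Cinf_on_deriv(1)[OF _ Cinf_on_higher_deriv[OF _ f]] by simp
  have der: "((\<lambda>x. \<Sum>n. (deriv ^^ k) (f n) x) has_real_derivative (\<Sum>n. (deriv ^^ Suc k) (f n) x)) (at x)" for k x
  proof (rule has_field_derivative_series'(2)[of UNIV])
    show "((deriv ^^ k) (f n) has_real_derivative (deriv ^^ Suc k) (f n) x) (at x within UNIV)" for n x
      using d by simp
    obtain M where M1: "summable M" "\<And>n x. \<bar>(deriv ^^ Suc k) (f n) x\<bar> \<le> M n" using M by metis
    show "uniformly_convergent_on UNIV (\<lambda>n x. \<Sum>i<n. (deriv ^^ Suc k) (f i) x)"
      by (rule Weierstrass_m_test'[OF _ M1(1)]) (use M1(2) in auto)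
    obtain M where M0: "summable M" "\<And>n x. \<bar>(deriv ^^ k) (f n) x\<bar> \<le> M n" using M by metis
    show "summable (\<lambda>n. (deriv ^^ k) (f n) 0)"
      by (rule summable_comparison_test'[OF M0(1)]) (use M0(2) in auto)
  qed auto
  have "Ck_on j (\<lambda>x. \<Sum>n. (deriv ^^ k) (f n) x) UNIV" for j k
  proof (induction j arbitrary: k)
    case 0
    have "isCont (\<lambda>x. \<Sum>n. (deriv ^^ k) (f n) x) x" for x using der DERIV_isCont by blast
    then show ?case by (simp add: continuous_at_imp_continuous_on)
  next
    case (Suc j)
    show ?case unfolding Ck_on.simps using der Suc[of "Suc k"]
      by (intro exI[of _ "\<lambda>x. \<Sum>n. (deriv ^^ Suc k) (f n) x"]) blast
  qed
  from this[of _ 0] show ?thesis by (simp add: Cinf_on_def)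
qed

definition exp_flat :: "real \<Rightarrow> real" where
  "exp_flat x = (if x \<le> 0 then 0 else exp (- inverse x))"

lemma poly_exp_flat_tendsto:
  "((\<lambda>x. poly p (inverse x) * exp (- inverse x)) \<longlongrightarrow> (0::real)) (at_right 0)"
proof -
  have "((\<lambda>y. poly p y * exp (- y)) \<longlongrightarrow> (0::real)) at_top"
  proof (induction p)
    case 0 then show ?case by simp
  next
    case (pCons a p)
    have "((\<lambda>y. poly p y * (y * exp (- y))) \<longlongrightarrow> (0::real)) at_top"
    proof -
      have "((\<lambda>y. \<Sum>i\<le>degree p. coeff p i * (y ^ Suc i / exp y)) \<longlongrightarrow> (\<Sum>i\<le>degree p. coeff p i * 0)) at_top"
        by (intro tendsto_intros tendsto_power_div_exp_0)
      moreover have "(\<Sum>i\<le>degree p. coeff p i * (y ^ Suc i / exp y)) = poly p y * (y * exp (- y))" for y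
        by (simp add: poly_altdef sum_distrib_left exp_minus divide_inverse mult_ac)
      ultimately show ?thesis by simp
    qed
    moreover have "((\<lambda>y. a * exp (- y)) \<longlongrightarrow> a * (0::real)) at_top"
      using tendsto_power_div_exp_0[of 0] by (intro tendsto_intros) (simp add: exp_minus field_simps)
    ultimately show ?case using tendsto_add[of "\<lambda>y. a * exp (- y)" "a * 0" at_top "\<lambda>y. poly p y * (y * exp (- y))" 0]
      by (simp add: algebra_simps)
  qed
  from filterlim_compose[OF this filterlim_inverse_at_top_right] show ?thesis by simp
qed

text \<open>All derivatives have the form $p(1/x) e^{-1/x}$ with a polynomial $p$; differentiation sends $p$ to $X^2(p - p')$.\<close>

lemma Cinf_on_exp_flat: "Cinf_on exp_flat UNIV"
proof (rule Cinf_on_flat_extension)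
  define q where "q p = [:0,0,1:] * (p - pderiv p)" for p :: "real poly"
  define e where "e p x = poly p (inverse x) * exp (- inverse x)" for p and x :: real
  have de: "(e p has_real_derivative e (q p) x) (at x)" if "x > 0" for p x
    unfolding e_def q_def using that
    by (auto intro!: derivative_eq_intros DERIV_chain2[OF poly_DERIV] simp: power2_eq_square algebra_simps)
  have es: "Ck_on k (e p) {0<..}" for k p
  proof (induction k arbitrary: p)
    case 0
    show ?case unfolding Ck_on.simps
      by (rule DERIV_continuous_on[of _ _ "e (q p)"]) (use de in \<open>auto intro: DERIV_subset\<close>)
  next
    case (Suc k)
    have "\<forall>x\<in>{0<..}. (e p has_real_derivative e (q p) x) (at x within {0<..})"
      using de by (auto intro: DERIV_subset)
    then show ?case using Suc[of "q p"] unfolding Ck_on.simps by blast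
  qed
  have eq: "exp_flat x = e 1 x" if "x > 0" for x using that by (simp add: exp_flat_def e_def)
  show "Cinf_on exp_flat {0<..}" unfolding Cinf_on_def
    using Ck_on_cong[OF es[of _ 1], of exp_flat] eq by auto
  have hd: "(deriv ^^ k) exp_flat x = e ((q ^^ k) 1) x" if "x > 0" for k x
    using that
  proof (induction k arbitrary: x)
    case 0 then show ?case using eq by simp
  next
    case (Suc k)
    have "((deriv ^^ k) exp_flat has_real_derivative e (q ((q ^^ k) 1)) x) (at x)"
      by (rule has_field_derivative_transform_within_open[OF de, where S="{0<..}"]) (use Suc in auto)
    then show ?case by (simp add: DERIV_imp_deriv)
  qed
  show "((deriv ^^ k) exp_flat \<longlongrightarrow> 0) (at_right 0)" for k
  proof -
    have ev: "eventually (\<lambda>x. e ((q ^^ k) 1) x = (deriv ^^ k) exp_flat x) (at_right 0)"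
      unfolding eventually_at_right_field using hd by (intro exI[of _ 1]) simp
    have "((\<lambda>x. e ((q ^^ k) 1) x) \<longlongrightarrow> 0) (at_right 0)"
      using poly_exp_flat_tendsto[of "(q ^^ k) 1"] by (simp only: e_def)
    then show ?thesis by (rule Lim_transform_eventually[OF _ ev])
  qed
qed (simp add: exp_flat_def)

definition smooth_step :: "real \<Rightarrow> real" where
  "smooth_step x = exp_flat x * inverse (exp_flat x + exp_flat (1 - x))"

lemma exp_flat_nonneg: "exp_flat x \<ge> 0" and exp_flat_pos: "x > 0 \<Longrightarrow> exp_flat x > 0"
  by (auto simp: exp_flat_def)

lemma exp_flat_sum_pos: "exp_flat x + exp_flat (1 - x) > 0"
proof (cases "x > 0")
  case True
  then show ?thesis by (intro add_pos_nonneg exp_flat_nonneg exp_flat_pos)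
next
  case False
  then show ?thesis by (intro add_nonneg_pos exp_flat_nonneg exp_flat_pos) simp
qed

lemma smooth_step_simps:
  "x \<le> 0 \<Longrightarrow> smooth_step x = 0" "x \<ge> 1 \<Longrightarrow> smooth_step x = 1" "x > 0 \<Longrightarrow> smooth_step x > 0"
  "smooth_step x \<ge> 0" "smooth_step x \<le> 1"
proof -
  show "x > 0 \<Longrightarrow> smooth_step x > 0" unfolding smooth_step_def using exp_flat_sum_pos[of x] exp_flat_pos[of x] by simp
  show "smooth_step x \<le> 1" unfolding smooth_step_def
    using exp_flat_sum_pos[of x] exp_flat_nonneg[of "1 - x"] by (simp add: field_simps)
  show "x \<ge> 1 \<Longrightarrow> smooth_step x = 1" 
    using exp_flat_pos[of x] by (simp add: smooth_step_def exp_flat_def)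
qed (auto simp: smooth_step_def exp_flat_def)

lemma Cinf_on_smooth_step: "Cinf_on smooth_step UNIV"
proof -
  have 1: "Ck_on k exp_flat UNIV" for k using Cinf_on_exp_flat by (simp add: Cinf_on_def)
  have 2: "Ck_on k (\<lambda>x. exp_flat (1 - x)) UNIV" for k
    by (rule Ck_on_comp[OF 1 Ck_on_diff[OF Ck_on_const Ck_on_id]]) simp
  show ?thesis unfolding Cinf_on_def
  proof
    fix k
    have ne: "exp_flat x + exp_flat (1 - x) \<noteq> 0" for x using exp_flat_sum_pos[of x] by linarith
    show "Ck_on k smooth_step UNIV"
      unfolding smooth_step_def[abs_def] by (rule Ck_on_mult[OF 1 Ck_on_inverse[OF Ck_on_add[OF 1 2] ne]])
  qed
qed

lemma Ck_bound_compact: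
  assumes "Cinf_on f W" "open W" "compact C" "C \<subseteq> W" "U \<subseteq> C" "open U"
  shows "\<exists>B\<ge>0. Ck_bound k B U f"
proof -
  have "\<exists>B. \<forall>x\<in>C. \<bar>(deriv ^^ j) f x\<bar> \<le> B" for j
  proof -
    have "continuous_on C ((deriv ^^ j) f)"
      using Cinf_on_imp_continuous_on[OF Cinf_on_higher_deriv[OF assms(2,1)]] assms(4) continuous_on_subset by blast
    then have "bounded ((deriv ^^ j) f ` C)" using assms(3) compact_continuous_image compact_imp_bounded by blast
    then show ?thesis unfolding bounded_iff by auto
  qed
  then obtain B where B: "\<And>j x. x \<in> C \<Longrightarrow> \<bar>(deriv ^^ j) f x\<bar> \<le> B j" by metis
  define D where "D = (\<Sum>j\<le>k. \<bar>B j\<bar>)"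
  have "\<bar>(deriv ^^ j) f x\<bar> \<le> D" if "j \<le> k" "x \<in> U" for j x
  proof -
    have "\<bar>B j\<bar> \<le> D" unfolding D_def using that by (intro member_le_sum) auto
    then show ?thesis using B[of x j] that assms(5) by force
  qed
  moreover have "Cinf_on f U" using assms(1,4,5) unfolding Cinf_on_def by (blast intro: Ck_on_subset)
  moreover have "D \<ge> 0" by (simp add: D_def sum_nonneg)
  ultimately show ?thesis using Ck_boundI_higher_deriv[OF assms(6)] by blast
qed

text \<open>Outside a compact interval the step is constant, so compactness gives global bounds on its derivatives.\<close>

lemma Ck_bound_smooth_step: "\<exists>B. Ck_bound k B UNIV smooth_step"
proof -
  obtain B where B: "B \<ge> 0" "Ck_bound k B {-1<..<2} smooth_step"
    using Ck_bound_compact[OF Cinf_on_smooth_step, of "{-1..2}" "{-1<..<2}" k]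
    using greaterThanLessThan_subseteq_atLeastAtMost_iff[of "-1" 2 "-1" "2::real"] by auto
  have cst: "Ck_bound k \<bar>c\<bar> V smooth_step" if "open V" "\<And>x. x \<in> V \<Longrightarrow> smooth_step x = c" for V c
    by (rule Ck_bound_cong[OF that(1) _ Ck_bound_const]) (simp add: that)
  have l: "Ck_bound k \<bar>0\<bar> {..<0} smooth_step" and r: "Ck_bound k \<bar>1\<bar> {1<..} smooth_step"
    by (rule cst; simp add: smooth_step_simps)+
  have "\<bar>(deriv ^^ j) smooth_step x\<bar> \<le> B + 1" if "j \<le> k" for j x
  proof -
    consider "x \<in> {-1<..<2}" | "x \<in> {..<0}" | "x \<in> {1<..}" by (cases "x \<le> -1"; cases "x \<ge> 2") auto
    then show ?thesis
      using Ck_bound_higher_deriv[OF _ B(2) that, of x] Ck_bound_higher_deriv[OF _ l that, of x]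
        Ck_bound_higher_deriv[OF _ r that, of x] B(1) by cases auto
  qed
  then show ?thesis using Ck_boundI_higher_deriv[OF _ Cinf_on_smooth_step] by blast
qed

section \<open>Flows of smooth fields that are flat at the origin\<close>

lemma increasing_diffeo_inverse:
  fixes g g' :: "real \<Rightarrow> real"
  assumes S: "open S" "convex S"
    and d: "\<And>x. x \<in> S \<Longrightarrow> (g has_real_derivative g' x) (at x)" "\<And>x. x \<in> S \<Longrightarrow> g' x > 0"
    and surj: "\<And>s. \<exists>x\<in>S. g x = s"
  obtains h where "\<And>s. h s \<in> S" "\<And>s. g (h s) = s" "\<And>x. x \<in> S \<Longrightarrow> h (g x) = x"
    "\<And>s. (h has_real_derivative inverse (g' (h s))) (at s)"
proof -
  have mono: "g x < g y" if "x \<in> S" "y \<in> S" "x < y" for x y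
  proof -
    have "z \<in> S" if "x \<le> z" "z \<le> y" for z
      using S(2) that \<open>x \<in> S\<close> \<open>y \<in> S\<close> is_interval_convex_1 mem_is_interval_1_I by metis
    then have "\<exists>l. (g has_real_derivative l) (at z) \<and> 0 < l" if "x \<le> z" "z \<le> y" for z
      using d[of z] that by blast
    then show ?thesis by (rule DERIV_pos_imp_increasing[OF that(3)])
  qed
  have inj: "x = y" if "x \<in> S" "y \<in> S" "g x = g y" for x y
    using mono[of x y] mono[of y x] that by (cases x y rule: linorder_cases) auto
  obtain h where h: "\<And>s. h s \<in> S" "\<And>s. g (h s) = s" using surj by metis
  have hg: "h (g x) = x" if "x \<in> S" for x using inj[OF h(1) that h(2)] .
  have cont: "isCont h s" for s
  proof -
    obtain e where e: "e > 0" "cball (h s) e \<subseteq> S"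
      using S(1) h(1) open_contains_cball by blast
    have zS: "z \<in> S" if "\<bar>z - h s\<bar> \<le> e" for z
      using that e(2) by (auto simp: dist_real_def subset_iff abs_minus_commute)
    have "isCont h (g (h s))"
      by (rule isCont_inverse_function[OF e(1) hg[OF zS] DERIV_isCont[OF d(1)[OF zS]]])
    then show ?thesis by (simp add: h)
  qed
  have D: "(h has_real_derivative inverse (g' (h s))) (at s)" for s
    by (rule DERIV_inverse_function[of g _ h s "s - 1" "s + 1"])
       (use h d(1)[OF h(1)] d(2)[OF h(1), of s] cont in auto)
  show ?thesis by (rule that[OF h hg D])
qed

text \<open>The parameter $r$ ranges over the unit interval; differentiation is only in $x$, but all derivatives are required to be jointly continuous in $(r,x)$. This is exactly what is needed in order to differentiate under an integral over the parameter.\<close>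

fun Ck_param :: "nat \<Rightarrow> (real \<Rightarrow> real \<Rightarrow> real) \<Rightarrow> bool" where
  "Ck_param 0 G \<longleftrightarrow> continuous_on ({0..1} \<times> UNIV) (\<lambda>p. G (fst p) (snd p))"
| "Ck_param (Suc k) G \<longleftrightarrow> continuous_on ({0..1} \<times> UNIV) (\<lambda>p. G (fst p) (snd p)) \<and>
    (\<exists>G'. (\<forall>r\<in>{0..1}. \<forall>x. (G r has_real_derivative G' r x) (at x)) \<and> Ck_param k G')"

lemma Ck_param_continuous: "Ck_param k G \<Longrightarrow> continuous_on ({0..1} \<times> UNIV) (\<lambda>p. G (fst p) (snd p))"
  by (cases k) auto

declare Ck_param.simps(2) [simp del]

lemma Ck_param_SucI:
  "continuous_on ({0..1} \<times> UNIV) (\<lambda>p. G (fst p) (snd p)) \<Longrightarrow>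
   (\<And>r x. r \<in> {0..1} \<Longrightarrow> (G r has_real_derivative G' r x) (at x)) \<Longrightarrow> Ck_param k G' \<Longrightarrow> Ck_param (Suc k) G"
  unfolding Ck_param.simps by blast

lemma Ck_param_SucE:
  assumes "Ck_param (Suc k) G"
  obtains G' where "\<And>r x. r \<in> {0..1} \<Longrightarrow> (G r has_real_derivative G' r x) (at x)" "Ck_param k G'"
  using assms unfolding Ck_param.simps by blast

lemma Ck_param_SucD: "Ck_param (Suc k) G \<Longrightarrow> Ck_param k G"
proof (induction k arbitrary: G)
  case 0
  then show ?case using Ck_param_continuous by simp
next
  case (Suc k)
  obtain G' where G': "\<And>r x. r \<in> {0..1} \<Longrightarrow> (G r has_real_derivative G' r x) (at x)" "Ck_param (Suc k) G'"
    using Ck_param_SucE[OF Suc.prems] by metis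
  show ?case
    by (rule Ck_param_SucI[OF Ck_param_continuous[OF Suc.prems] G'(1) Suc.IH[OF G'(2)]])
qed

lemma Ck_param_add: "Ck_param k F \<Longrightarrow> Ck_param k G \<Longrightarrow> Ck_param k (\<lambda>r x. F r x + G r x)"
proof (induction k arbitrary: F G)
  case 0
  then show ?case by (auto intro: continuous_intros)
next
  case (Suc k)
  obtain F' where F': "\<And>r x. r \<in> {0..1} \<Longrightarrow> (F r has_real_derivative F' r x) (at x)" "Ck_param k F'"
    using Ck_param_SucE[OF Suc.prems(1)] by metis
  obtain G' where G': "\<And>r x. r \<in> {0..1} \<Longrightarrow> (G r has_real_derivative G' r x) (at x)" "Ck_param k G'"
    using Ck_param_SucE[OF Suc.prems(2)] by metis
  show ?case
  proof (rule Ck_param_SucI)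
    show "((\<lambda>x. F r x + G r x) has_real_derivative F' r x + G' r x) (at x)" if "r \<in> {0..1}" for r x
      by (intro DERIV_add F' G' that)
  qed (intro Suc.IH F' G' continuous_on_add Suc.prems[THEN Ck_param_continuous])+
qed

lemma Ck_param_mult: "Ck_param k F \<Longrightarrow> Ck_param k G \<Longrightarrow> Ck_param k (\<lambda>r x. F r x * G r x)"
proof (induction k arbitrary: F G)
  case 0
  then show ?case by (auto intro: continuous_intros)
next
  case (Suc k)
  obtain F' where F': "\<And>r x. r \<in> {0..1} \<Longrightarrow> (F r has_real_derivative F' r x) (at x)" "Ck_param k F'"
    using Ck_param_SucE[OF Suc.prems(1)] by metis
  obtain G' where G': "\<And>r x. r \<in> {0..1} \<Longrightarrow> (G r has_real_derivative G' r x) (at x)" "Ck_param k G'"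
    using Ck_param_SucE[OF Suc.prems(2)] by metis
  note IH = Suc.IH[OF F'(2) Ck_param_SucD[OF Suc.prems(2)]] Suc.IH[OF G'(2) Ck_param_SucD[OF Suc.prems(1)]]
  show ?case
  proof (rule Ck_param_SucI)
    show "((\<lambda>x. F r x * G r x) has_real_derivative F' r x * G r x + G' r x * F r x) (at x)"
      if "r \<in> {0..1}" for r x
      by (intro DERIV_mult F' G' that)
    show "Ck_param k (\<lambda>r x. F' r x * G r x + G' r x * F r x)"
      by (rule Ck_param_add[OF IH])
  qed (intro continuous_on_mult Suc.prems[THEN Ck_param_continuous])
qed

lemma Ck_param_comp:
  assumes "Cinf_on h UNIV"
  shows "Ck_param k G \<Longrightarrow> Ck_param k (\<lambda>r x. h (G r x))"
  using assms
proof (induction k arbitrary: h)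
  case 0
  have "continuous_on UNIV h" using 0 Cinf_on_imp_continuous_on by blast
  then show ?case using 0 continuous_on_compose2[of UNIV h "{0..1} \<times> UNIV" "\<lambda>p. G (fst p) (snd p)"] by simp
next
  case (Suc k)
  obtain G' where G': "\<And>r x. r \<in> {0..1} \<Longrightarrow> (G r has_real_derivative G' r x) (at x)" "Ck_param k G'"
    using Ck_param_SucE[OF Suc.prems(1)] by metis
  have h': "\<And>x. (h has_real_derivative deriv h x) (at x)" "Cinf_on (deriv h) UNIV"
    using Cinf_on_deriv[OF open_UNIV Suc.prems(2)] by auto
  have "continuous_on UNIV h" using Suc Cinf_on_imp_continuous_on by blast
  then have 1: "continuous_on ({0..1} \<times> UNIV) (\<lambda>p. h (G (fst p) (snd p)))"
    by (rule continuous_on_compose2[OF _ Ck_param_continuous[OF Suc.prems(1)]]) simp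
  show ?case
    by (rule Ck_param_SucI[OF 1 DERIV_chain2[OF h'(1) G'(1)]])
       (auto intro!: Ck_param_mult G' Suc.IH[OF Ck_param_SucD[OF Suc.prems(1)] h'(2)])
qed

lemma Ck_param_fst: "Ck_param k (\<lambda>r x. r)"
proof -
  have z: "Ck_param k (\<lambda>r x. 0)" for k
    by (induction k) (auto intro!: Ck_param_SucI[of _ "\<lambda>r x. 0"] continuous_intros)
  show ?thesis
    by (cases k) (auto intro!: Ck_param_SucI[of _ "\<lambda>r x. 0"] z continuous_intros)
qed

lemma Ck_param_snd: "Cinf_on f UNIV \<Longrightarrow> Ck_param k (\<lambda>r x. f x)"
proof (induction k arbitrary: f)
  case 0
  then show ?case
    using continuous_on_compose2[OF Cinf_on_imp_continuous_on[OF 0] continuous_on_snd[OF continuous_on_id]] by simp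
next
  case (Suc k)
  show ?case
    by (rule Ck_param_SucI[OF _ Cinf_on_deriv(1)[OF open_UNIV Suc.prems] Suc.IH[OF Cinf_on_deriv(2)[OF open_UNIV Suc.prems]]])
       (use continuous_on_compose2[OF Cinf_on_imp_continuous_on[OF Suc.prems] continuous_on_snd[OF continuous_on_id]] in auto)
qed

text \<open>The parameter enters the integrand through $rq$ because, in the application, the integral over $q$ is a rescaled time integral from $0$ to $r$.\<close>

lemma Ck_param_integral:
  "Ck_param k G \<Longrightarrow> Ck_param k (\<lambda>r x. integral {0..1} (\<lambda>q. G (r * q) x))"
proof (induction k arbitrary: G)
  have cont: "continuous_on ({0..1} \<times> UNIV) (\<lambda>p. integral {0..1} (\<lambda>q. G (fst p * q) (snd p)))"
    if "continuous_on ({0..1} \<times> UNIV) (\<lambda>p. G (fst p) (snd p))" for G :: "real \<Rightarrow> real \<Rightarrow> real"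
  proof -
    have "continuous_on (({0..1} \<times> UNIV) \<times> cbox 0 1) (\<lambda>z. G (fst (fst z) * snd z) (snd (fst z)))"
      by (rule continuous_on_compose2[OF that, of _ "\<lambda>z. (fst (fst z) * snd z, snd (fst z))", simplified])
         (auto intro!: continuous_intros mult_le_one)
    then have "continuous_on (({0..1} \<times> UNIV) \<times> cbox 0 1) (\<lambda>(p,q). G (fst p * q) (snd p))"
      by (simp add: case_prod_unfold)
    from integral_continuous_on_param[OF this] show ?thesis by simp
  qed
  {
    case 0
    then show ?case using cont by simp
  next
    case (Suc k)
    obtain G' where G': "\<And>r x. r \<in> {0..1} \<Longrightarrow> (G r has_real_derivative G' r x) (at x)" "Ck_param k G'"
      using Ck_param_SucE[OF Suc.prems(1)] by metis
    show ?case
    proof (rule Ck_param_SucI[OF cont[OF Ck_param_continuous[OF Suc.prems]] _ Suc.IH[OF G'(2)]])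
      fix r x :: real assume r: "r \<in> {0..1}"
      have rq: "r * q \<in> {0..1}" if "q \<in> cbox 0 1" for q using r that by (auto intro: mult_le_one)
      have "((\<lambda>x. integral (cbox 0 1) (\<lambda>q. G (r * q) x)) has_real_derivative
             integral (cbox 0 1) (\<lambda>q. G' (r * q) x)) (at x within UNIV)"
      proof (rule leibniz_rule_field_derivative)
        show "((\<lambda>x. G (r * q) x) has_real_derivative G' (r * q) x) (at x within UNIV)" if "q \<in> cbox 0 1" for x q
          using G'(1)[OF rq[OF that]] by simp
        show "(\<lambda>q. G (r * q) x) integrable_on cbox 0 1" for x
        proof (rule integrable_continuous)
          show "continuous_on (cbox 0 1) (\<lambda>q. G (r * q) x)"
            by (rule continuous_on_compose2[OF Ck_param_continuous[OF Suc.prems], of _ "\<lambda>q. (r * q, x)", simplified])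
               (use rq in \<open>auto intro!: continuous_intros\<close>)
        qed
        have "continuous_on (UNIV \<times> cbox 0 1) (\<lambda>z. G' (r * snd z) (fst z))"
          by (rule continuous_on_compose2[OF Ck_param_continuous[OF G'(2)], of _ "\<lambda>z. (r * snd z, fst z)", simplified])
             (use rq in \<open>auto intro!: continuous_intros\<close>)
        then show "continuous_on (UNIV \<times> cbox 0 1) (\<lambda>(x, q). G' (r * q) x)"
          by (simp add: case_prod_unfold)
      qed auto
      then show "((\<lambda>x. integral {0..1} (\<lambda>q. G (r * q) x)) has_real_derivative
             integral {0..1} (\<lambda>q. G' (r * q) x)) (at x)" by simp
    qed
  }
qed

lemma Ck_param_imp_Ck_on: "Ck_param k G \<Longrightarrow> r \<in> {0..1} \<Longrightarrow> Ck_on k (G r) UNIV"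
proof (induction k arbitrary: G)
  case 0
  have "continuous_on UNIV (\<lambda>x. G r x)"
    by (rule continuous_on_compose2[OF Ck_param_continuous[OF 0(1)], of _ "\<lambda>x. (r, x)", simplified])
       (use 0 in \<open>auto intro!: continuous_intros\<close>)
  then show ?case by simp
next
  case (Suc k)
  obtain G' where G': "\<And>r x. r \<in> {0..1} \<Longrightarrow> (G r has_real_derivative G' r x) (at x)" "Ck_param k G'"
    using Ck_param_SucE[OF Suc.prems(1)] by metis
  have "\<forall>x\<in>UNIV. (G r has_real_derivative G' r x) (at x)" using G'(1)[OF Suc.prems(2)] by blast
  moreover have "Ck_on k (G' r) UNIV" by (rule Suc.IH[OF G'(2) Suc.prems(2)])
  ultimately show ?case unfolding Ck_on.simps by blast
qed

text \<open>The field $w$ vanishes exactly on the nonpositive half-line. On the positive half-line $\<sigma>0$ is a primitive of $1/w$, that is, the time coordinate of $w$, and the inverse map $\<psi>0$ is an integral curve through all positive points. The flow of $w$ is $x \mapsto \<psi>0(\<sigma>0(x) + t)$.\<close>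

locale flat_field =
  fixes w \<sigma>0 \<psi>0 :: "real \<Rightarrow> real"
  assumes smooth: "Cinf_on w UNIV"
    and zero: "\<And>x. x \<le> 0 \<Longrightarrow> w x = 0"
    and pos: "\<And>x. x > 0 \<Longrightarrow> w x > 0"
    and \<sigma>0_DERIV: "\<And>x. x > 0 \<Longrightarrow> (\<sigma>0 has_real_derivative inverse (w x)) (at x)"
    and \<psi>0_pos: "\<And>s. \<psi>0 s > 0"
    and \<sigma>0_\<psi>0: "\<And>s. \<sigma>0 (\<psi>0 s) = s"
    and \<psi>0_\<sigma>0: "\<And>x. x > 0 \<Longrightarrow> \<psi>0 (\<sigma>0 x) = x"
    and \<psi>0_DERIV: "\<And>s. (\<psi>0 has_real_derivative w (\<psi>0 s)) (at s)"
begin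

lemma \<psi>0_strict_mono: "s < t \<Longrightarrow> \<psi>0 s < \<psi>0 t"
proof (erule DERIV_pos_imp_increasing)
  show "\<exists>y. (\<psi>0 has_real_derivative y) (at x) \<and> 0 < y" for x
    using \<psi>0_DERIV[of x] pos[OF \<psi>0_pos[of x]] by blast
qed

lemma \<psi>0_less_iff: "\<psi>0 s < \<psi>0 t \<longleftrightarrow> s < t"
  using \<psi>0_strict_mono by (metis linorder_neqE_linordered_idom order_less_asym order_less_irrefl)

lemma isCont_\<psi>0: "isCont \<psi>0 s"
  by (rule DERIV_isCont[OF \<psi>0_DERIV])

lemma w_DERIV: "(w has_real_derivative deriv w x) (at x)"
  using Cinf_on_deriv(1)[OF open_UNIV smooth] by simp

lemma w_nonneg: "w x \<ge> 0"
  using pos[of x] zero[of x] by (cases "x > 0") auto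

lemma deriv_w_zero: "x \<le> 0 \<Longrightarrow> deriv w x = 0"
  by (rule DERIV_local_min[OF w_DERIV zero_less_one]) (simp add: zero w_nonneg)

lemma Cinf_on_\<sigma>0: "Cinf_on \<sigma>0 {0<..}"
proof (rule Cinf_onI_deriv_open)
  have "Ck_on k (\<lambda>x. inverse (w x)) {0<..}" for k
  proof (rule Ck_on_inverse)
    show "Ck_on k w {0<..}" using smooth Ck_on_subset unfolding Cinf_on_def by blast
    show "w x \<noteq> 0" if "x \<in> {0<..}" for x using pos[of x] that by simp
  qed
  then show "Cinf_on (\<lambda>x. inverse (w x)) {0<..}" by (simp add: Cinf_on_def)
qed (use \<sigma>0_DERIV in auto)

text \<open>The point $x$ is moved along the flow of $w$ for a time $r\<tau>(x)$ that depends on the point. The case $r = 1$ is the one of interest; the intermediate values of $r$ are needed because the derivative of the final map involves an integral over them.\<close>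

definition shifted :: "(real \<Rightarrow> real) \<Rightarrow> real \<Rightarrow> real \<Rightarrow> real" where
  "shifted \<tau> r x = (if x > 0 then \<psi>0 (\<sigma>0 x + r * \<tau> x) else x)"

text \<open>The only delicate points are those with $x = 0$. There $r\<tau>$ is bounded by some $M$, so that $x < \<psi>0(\<sigma>0(e) - M)$ forces the image to stay below $e$.\<close>

lemma continuous_on_shifted:
  assumes "continuous_on UNIV \<tau>"
  shows "continuous_on ({0..1} \<times> UNIV) (\<lambda>p. shifted \<tau> (fst p) (snd p))"
proof -
  have "continuous (at (r, x) within {0..1} \<times> UNIV) (\<lambda>p. shifted \<tau> (fst p) (snd p))" if r: "r \<in> {0..1}" for r x
  proof (cases "x > 0")
    case True
    have c\<sigma>: "continuous_on {0<..} \<sigma>0" using Cinf_on_imp_continuous_on[OF Cinf_on_\<sigma>0] .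
    have "continuous_on (UNIV \<times> {0<..}) (\<lambda>p. \<psi>0 (\<sigma>0 (snd p) + fst p * \<tau> (snd p)))"
      by (intro continuous_on_compose2[OF continuous_at_imp_continuous_on, of UNIV \<psi>0] isCont_\<psi>0 ballI
            continuous_intros continuous_on_compose2[OF c\<sigma>] continuous_on_compose2[OF assms]) auto
    then have "continuous_on (UNIV \<times> {0<..}) (\<lambda>p. shifted \<tau> (fst p) (snd p))"
      by (rule continuous_on_eq) (auto simp: shifted_def)
    moreover have "open (UNIV \<times> {0::real<..})" "(r, x) \<in> UNIV \<times> {0<..}"
      using True by (auto intro: open_Times)
    ultimately have "continuous (at (r, x)) (\<lambda>p. shifted \<tau> (fst p) (snd p))"
      using continuous_on_eq_continuous_at by blast
    then show ?thesis by (rule continuous_at_imp_continuous_at_within)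
  next
    case False
    show ?thesis
    proof (cases "x < 0")
      case True
      have "continuous_on (UNIV \<times> {..<0}) (\<lambda>p. shifted \<tau> (fst p) (snd p))"
        by (rule continuous_on_eq[OF continuous_on_snd[OF continuous_on_id]]) (auto simp: shifted_def)
      moreover have "open (UNIV \<times> {..<0::real})" "(r, x) \<in> UNIV \<times> {..<0}"
        using True by (auto intro: open_Times)
      ultimately have "continuous (at (r, x)) (\<lambda>p. shifted \<tau> (fst p) (snd p))"
        using continuous_on_eq_continuous_at by blast
      then show ?thesis by (rule continuous_at_imp_continuous_at_within)
    next
      case False
      then have x: "x = 0" using \<open>\<not> x > 0\<close> by simp
      have "compact (\<tau> ` {-1..1})" using assms by (intro compact_continuous_image) (auto intro: continuous_on_subset)
      from compact_imp_bounded[OF this] obtain M where M': "\<forall>z\<in>\<tau> ` {-1..1}. norm z \<le> M"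
        unfolding bounded_iff by blast
      have M: "\<bar>\<tau> y\<bar> \<le> M" if "\<bar>y\<bar> \<le> 1" for y
        using M' that by (auto simp: abs_le_iff)
      have M0: "M \<ge> 0" using M[of 0] by simp
      show ?thesis unfolding continuous_within x
      proof (rule tendstoI)
        fix e :: real assume e: "e > 0"
        define d where "d = min 1 (min e (\<psi>0 (\<sigma>0 e - M)))"
        have d: "d > 0" using e \<psi>0_pos by (simp add: d_def)
        have b: "\<bar>shifted \<tau> q y\<bar> < e" if q: "q \<in> {0..1}" and y: "\<bar>y\<bar> < d" for q y
        proof (cases "y > 0")
          case True
          have "y < \<psi>0 (\<sigma>0 e - M)" using y True by (simp add: d_def)
          then have "\<sigma>0 y < \<sigma>0 e - M" using \<psi>0_less_iff[of "\<sigma>0 y"] \<psi>0_\<sigma>0[OF True] by simp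
          moreover have "q * \<tau> y \<le> M"
          proof -
            have "\<bar>q * \<tau> y\<bar> \<le> 1 * M" unfolding abs_mult
              using q M[of y] y by (intro mult_mono) (auto simp: d_def)
            then show ?thesis by simp
          qed
          ultimately have "\<psi>0 (\<sigma>0 y + q * \<tau> y) < \<psi>0 (\<sigma>0 e)" by (intro \<psi>0_strict_mono) simp
          then show ?thesis using True \<psi>0_pos[of "\<sigma>0 y + q * \<tau> y"] \<psi>0_\<sigma>0[OF e] by (simp add: shifted_def)
        next
          case False
          then show ?thesis using y by (simp add: shifted_def d_def)
        qed
        have "dist (shifted \<tau> (fst p) (snd p)) (shifted \<tau> (fst (r, 0)) (snd (r, 0))) < e"
          if "p \<in> {0..1} \<times> UNIV" "dist p (r, 0) < d" for p
        proof -
          have "\<bar>snd p\<bar> < d" using dist_snd_le[of p "(r, 0)"] that(2) by (simp add: dist_real_def)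
          then show ?thesis using b[of "fst p" "snd p"] that(1) by (auto simp: shifted_def[of \<tau> r 0])
        qed
        then show "\<forall>\<^sub>F p in at (r, 0) within {0..1} \<times> UNIV.
            dist (shifted \<tau> (fst p) (snd p)) (shifted \<tau> (fst (r, 0)) (snd (r, 0))) < e"
          unfolding eventually_at using d by blast
      qed
    qed
  qed
  then show ?thesis unfolding continuous_on_eq_continuous_within by auto
qed

text \<open>For $x > 0$ the derivative of the moved point $y$ is $w(y)(1/w(x) + r\<tau>'(x))$. The quotient $w(y)/w(x)$ is singular at the origin, but it equals the exponential of the integral of $w'$ along the orbit segment from $x$ to $y$, and this form makes sense at the origin too.\<close>

definition shifted_deriv :: "(real \<Rightarrow> real) \<Rightarrow> real \<Rightarrow> real \<Rightarrow> real" where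
  "shifted_deriv \<tau> r x = w (shifted \<tau> r x) * (r * deriv \<tau> x) +
     exp (r * integral {0..1} (\<lambda>q. \<tau> x * deriv w (shifted \<tau> (r * q) x)))"

lemma Cinf_on_exp: "Cinf_on (exp :: real \<Rightarrow> real) UNIV"
proof -
  have "Ck_on k (exp :: real \<Rightarrow> real) UNIV" for k
  proof (induction k)
    case (Suc k)
    have "\<forall>x\<in>UNIV. (exp has_real_derivative exp x) (at x)" by simp
    then show ?case using Suc unfolding Ck_on.simps by blast
  qed (auto intro: continuous_intros)
  then show ?thesis by (simp add: Cinf_on_def)
qed

lemma Ck_param_shifted_deriv:
  assumes "Cinf_on \<tau> UNIV" "Ck_param k (shifted \<tau>)"
  shows "Ck_param k (shifted_deriv \<tau>)"
  unfolding shifted_deriv_def[abs_def]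
  by (rule Ck_param_add[OF
        Ck_param_mult[OF Ck_param_comp[OF smooth assms(2)] Ck_param_mult[OF Ck_param_fst Ck_param_snd[OF Cinf_on_deriv(2)[OF open_UNIV assms(1)]]]]
        Ck_param_comp[OF Cinf_on_exp Ck_param_mult[OF Ck_param_fst Ck_param_integral[OF
          Ck_param_mult[OF Ck_param_snd[OF assms(1)] Ck_param_comp[OF Cinf_on_deriv(2)[OF open_UNIV smooth] assms(2)]]]]]])

text \<open>At points to the right of the origin this is the chain rule and the fundamental theorem of calculus for $\ln w$ along the orbit. The right-hand side is continuous, which yields the derivative at the origin.\<close>

lemma shifted_DERIV:
  assumes \<tau>: "Cinf_on \<tau> UNIV" and r: "r \<in> {0..1}"
  shows "(shifted \<tau> r has_real_derivative shifted_deriv \<tau> r x) (at x)"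
proof -
  have d\<tau>: "(\<tau> has_real_derivative deriv \<tau> x) (at x)" for x
    using Cinf_on_deriv(1)[OF open_UNIV \<tau>] by simp
  have pos_case: "(shifted \<tau> r has_real_derivative shifted_deriv \<tau> r x) (at x)" if x: "x > 0" for x
  proof -
    \<comment> \<open>The orbit segment from $x$ to the moved point, run through in unit time.\<close>
    define y where "y q = \<psi>0 (\<sigma>0 x + q * (r * \<tau> x))" for q
    have y: "y q > 0" for q using \<psi>0_pos by (simp add: y_def)
    have dy: "(y has_real_derivative w (y q) * (r * \<tau> x)) (at q)" for q
    proof -
      have "((\<lambda>q. \<sigma>0 x + q * (r * \<tau> x)) has_real_derivative r * \<tau> x) (at q)"
        by (auto intro!: derivative_eq_intros)
      from DERIV_chain2[OF \<psi>0_DERIV this] show ?thesis by (simp add: y_def[abs_def])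
    qed
    have "((\<lambda>q. ln (w (y q))) has_real_derivative deriv w (y q) * (r * \<tau> x)) (at q)" for q
    proof -
      have "((\<lambda>q. w (y q)) has_real_derivative deriv w (y q) * (w (y q) * (r * \<tau> x))) (at q)"
        by (rule DERIV_chain2[OF w_DERIV dy])
      from DERIV_chain2[OF DERIV_ln[OF pos[OF y]] this] show ?thesis
        using pos[OF y, of q] by (simp add: field_simps)
    qed
    then have "((\<lambda>q. ln (w (y q))) has_vector_derivative deriv w (y q) * (r * \<tau> x)) (at q within {0..1})" for q
      using has_real_derivative_iff_has_vector_derivative has_vector_derivative_at_within by blast
    then have "((\<lambda>q. deriv w (y q) * (r * \<tau> x)) has_integral ln (w (y 1)) - ln (w (y 0))) {0..1}"
      by (intro fundamental_theorem_of_calculus) auto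
    moreover have "(\<lambda>q. deriv w (y q) * (r * \<tau> x)) = (\<lambda>q. r * (\<tau> x * deriv w (shifted \<tau> (r * q) x)))"
      using x by (auto simp: shifted_def y_def mult_ac)
    ultimately have hi: "((\<lambda>q. r * (\<tau> x * deriv w (shifted \<tau> (r * q) x))) has_integral ln (w (y 1)) - ln (w (y 0))) {0..1}"
      by (simp only:)
    have "r * integral {0..1} (\<lambda>q. \<tau> x * deriv w (shifted \<tau> (r * q) x)) = ln (w (y 1)) - ln (w (y 0))"
      using integral_unique[OF hi] by (simp only: integral_mult_right)
    then have "exp (r * integral {0..1} (\<lambda>q. \<tau> x * deriv w (shifted \<tau> (r * q) x))) = w (y 1) / w (y 0)"
      using pos[OF y] by (simp add: exp_diff)
    then have eq: "shifted_deriv \<tau> r x = w (\<psi>0 (\<sigma>0 x + r * \<tau> x)) * (inverse (w x) + r * deriv \<tau> x)"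
      using x \<psi>0_\<sigma>0[OF x] by (simp add: shifted_deriv_def y_def shifted_def field_simps)
    have "((\<lambda>x. \<psi>0 (\<sigma>0 x + r * \<tau> x)) has_real_derivative
            w (\<psi>0 (\<sigma>0 x + r * \<tau> x)) * (inverse (w x) + r * deriv \<tau> x)) (at x)"
      by (intro DERIV_chain2[OF \<psi>0_DERIV] DERIV_add \<sigma>0_DERIV[OF x] DERIV_cmult d\<tau>)
    then show ?thesis unfolding eq[symmetric]
      by (rule has_field_derivative_transform_within_open[where S = "{0<..}"]) (use x in \<open>auto simp: shifted_def\<close>)
  qed
  have nonpos: "shifted_deriv \<tau> r x = 1" if "x \<le> 0" for x
    using that by (simp add: shifted_deriv_def shifted_def zero deriv_w_zero)
  have neg_case: "(shifted \<tau> r has_real_derivative shifted_deriv \<tau> r x) (at x)" if x: "x < 0" for x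
    unfolding nonpos[OF less_imp_le[OF x]]
    by (rule has_field_derivative_transform_within_open[OF DERIV_ident, where S = "{..<0}"])
       (use x in \<open>auto simp: shifted_def\<close>)
  have c\<tau>: "continuous_on UNIV \<tau>" using Cinf_on_imp_continuous_on[OF \<tau>] .
  have P0: "Ck_param 0 (shifted \<tau>)" using continuous_on_shifted[OF c\<tau>] by simp
  have "Ck_on 0 (shifted \<tau> r) UNIV" by (rule Ck_param_imp_Ck_on[OF P0 r])
  moreover have "Ck_on 0 (shifted_deriv \<tau> r) UNIV"
    by (rule Ck_param_imp_Ck_on[OF Ck_param_shifted_deriv[OF \<tau> P0] r])
  ultimately have c: "isCont (shifted \<tau> r) 0" "isCont (shifted_deriv \<tau> r) 0"
    by (simp_all add: continuous_on_eq_continuous_at)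
  have nz: "(shifted \<tau> r has_real_derivative shifted_deriv \<tau> r x) (at x)" if "x \<noteq> 0" for x
    using pos_case[of x] neg_case[of x] that by linarith
  have "(shifted_deriv \<tau> r \<longlongrightarrow> shifted_deriv \<tau> r 0) (at 0)" using c(2) by (simp only: isCont_def)
  from continuous_derivative_imp_DERIV[OF c(1) nz this] show ?thesis using nz[of x] by (cases "x = 0") simp_all
qed

text \<open>Bootstrapping: the formula for the derivative is built from the family itself by smooth operations and an integral over the parameter, so that each order of differentiability of the family gives the next one.\<close>

lemma Cinf_on_shifted:
  assumes \<tau>: "Cinf_on \<tau> UNIV"
  shows "Cinf_on (shifted \<tau> 1) UNIV"
proof -
  have c: "continuous_on ({0..1} \<times> UNIV) (\<lambda>p. shifted \<tau> (fst p) (snd p))"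
    by (rule continuous_on_shifted[OF Cinf_on_imp_continuous_on[OF \<tau>]])
  have "Ck_param k (shifted \<tau>)" for k
  proof (induction k)
    case 0 then show ?case using c by simp
  next
    case (Suc k)
    show ?case by (rule Ck_param_SucI[OF c shifted_DERIV[OF \<tau>] Ck_param_shifted_deriv[OF \<tau> Suc]])
  qed
  then show ?thesis unfolding Cinf_on_def using Ck_param_imp_Ck_on[of _ "shifted \<tau>" 1] by simp
qed

end

text \<open>Near the origin $w(x) \le Lx$, so that the primitive of $1/w$ tends to $-\<infinity>$ at least as fast as $\ln(x)/L$; at infinity $w$ is bounded, so that the primitive tends to $\<infinity>$. Hence it is a bijection onto the line.\<close>

lemma flat_field_exists:
  assumes smooth: "Cinf_on w UNIV" and zero: "\<And>x. x \<le> 0 \<Longrightarrow> w x = 0"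
    and pos: "\<And>x. x > 0 \<Longrightarrow> w x > 0" and bdd: "\<And>x. w x \<le> C"
  shows "\<exists>\<sigma>0 \<psi>0. flat_field w \<sigma>0 \<psi>0"
proof -
  have dw: "(w has_real_derivative deriv w x) (at x)" for x
    using Cinf_on_deriv(1)[OF open_UNIV smooth] by simp
  have C: "C > 0" using pos[of 1] bdd[of 1] by simp
  have "isCont (\<lambda>x. inverse (w x)) x" if "x > 0" for x
    using DERIV_isCont[OF dw] pos[OF that] by (intro continuous_intros) auto
  then have "\<exists>F. \<forall>x::real. (0::ereal) < x \<longrightarrow> x < \<infinity> \<longrightarrow> (F has_vector_derivative inverse (w x)) (at x)"
    by (intro einterval_antiderivative) auto
  then obtain F where F: "\<And>x. x > 0 \<Longrightarrow> (F has_real_derivative inverse (w x)) (at x)"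
    by (auto simp: has_real_derivative_iff_has_vector_derivative)
  have "continuous_on {0..1} (deriv w)"
    using Cinf_on_imp_continuous_on[OF Cinf_on_deriv(2)[OF open_UNIV smooth]] continuous_on_subset by blast
  then have "bounded (deriv w ` {0..1})" by (intro compact_imp_bounded compact_continuous_image) auto
  then obtain M where M: "\<forall>z\<in>deriv w ` {0..1}. norm z \<le> M" unfolding bounded_iff by blast
  define L where "L = max M 1"
  have L: "L > 0" "\<And>x. 0 \<le> x \<Longrightarrow> x \<le> 1 \<Longrightarrow> \<bar>deriv w x\<bar> \<le> L"
    using M by (auto simp: L_def intro: max.coboundedI1)
  have wL: "w x \<le> L * x" if x: "0 < x" "x \<le> 1" for x
  proof -
    obtain z where z: "0 < z" "z < x" "w x - w 0 = (x - 0) * deriv w z"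
      using MVT2[OF x(1), of w "deriv w"] dw by blast
    have "deriv w z \<le> L" using L(2)[of z] z x by simp
    then have "x * deriv w z \<le> x * L" using x by (intro mult_left_mono) auto
    then show ?thesis using z zero[of 0] by (simp add: mult.commute)
  qed
  have low: "F x \<le> F 1 + ln x / L" if x: "0 < x" "x \<le> 1" for x
  proof -
    have "F x - ln x / L \<le> F 1 - ln 1 / L"
    proof (rule DERIV_nonneg_imp_nondecreasing[OF x(2)])
      fix z assume z: "x \<le> z" "z \<le> 1"
      then have z0: "z > 0" using x by simp
      have "((\<lambda>x. F x - ln x / L) has_real_derivative inverse (w z) - inverse z / L) (at z)"
        using z0 L(1) by (auto intro!: derivative_eq_intros F simp: field_simps)
      moreover have "inverse (w z) - inverse z / L \<ge> 0"
      proof -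
        have "inverse (L * z) \<le> inverse (w z)" by (rule le_imp_inverse_le[OF wL[OF z0 z(2)] pos[OF z0]])
        then show ?thesis by (simp add: divide_inverse mult.commute)
      qed
      ultimately show "\<exists>y. ((\<lambda>x. F x - ln x / L) has_real_derivative y) (at z) \<and> 0 \<le> y" by blast
    qed
    then show ?thesis by simp
  qed
  have up: "F 1 + (x - 1) / C \<le> F x" if x: "1 \<le> x" for x
  proof -
    have "F 1 - 1 / C \<le> F x - x / C"
    proof (rule DERIV_nonneg_imp_nondecreasing[OF x])
      fix z assume z: "1 \<le> z" "z \<le> x"
      then have z0: "z > 0" by simp
      have "((\<lambda>x. F x - x / C) has_real_derivative inverse (w z) - 1 / C) (at z)"
        using z0 C by (auto intro!: derivative_eq_intros F)
      moreover have "inverse (w z) - 1 / C \<ge> 0"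
        using le_imp_inverse_le[OF bdd[of z] pos[OF z0]] by (simp add: divide_inverse)
      ultimately show "\<exists>y. ((\<lambda>x. F x - x / C) has_real_derivative y) (at z) \<and> 0 \<le> y" by blast
    qed
    then show ?thesis by (simp add: diff_divide_distrib)
  qed
  have surj: "\<exists>x\<in>{0<..}. F x = s" for s
  proof -
    define x1 where "x1 = min 1 (exp (L * (s - F 1)))"
    define x2 where "x2 = 1 + C * max 0 (s - F 1)"
    have x1: "0 < x1" "x1 \<le> 1" by (auto simp: x1_def)
    have x2: "1 \<le> x2" using C by (simp add: x2_def)
    have "ln x1 \<le> ln (exp (L * (s - F 1)))" using x1 by (subst ln_le_cancel_iff) (auto simp: x1_def)
    then have "ln x1 / L \<le> s - F 1" using L(1) by (simp add: field_simps)
    then have "F x1 \<le> s" using low[OF x1] by simp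
    moreover have "s \<le> F x2" using up[OF x2] C by (simp add: x2_def)
    moreover have "continuous_on {x1..x2} F"
      using F x1 by (intro continuous_at_imp_continuous_on ballI DERIV_isCont[OF F]) auto
    ultimately obtain x where "x1 \<le> x" "x \<le> x2" "F x = s"
      using IVT'[of F x1 s x2] x1 x2 by auto
    then show ?thesis using x1 by auto
  qed
  obtain h where h: "\<And>s. h s \<in> {0<..}" "\<And>s. F (h s) = s" "\<And>x. x \<in> {0<..} \<Longrightarrow> h (F x) = x"
    "\<And>s. (h has_real_derivative inverse (inverse (w (h s)))) (at s)"
    by (rule increasing_diffeo_inverse[of "{0<..}" F "\<lambda>x. inverse (w x)"])
       (use F pos surj in \<open>auto simp: convex_real_interval\<close>)
  have "flat_field w F h"
    by unfold_locales (use smooth zero pos F h in auto)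
  then show ?thesis by blast
qed

section \<open>Reparametrised flows\<close>

text \<open>The integral curve $\<psi>0$ is reparametrised by the diffeomorphism $s \mapsto s + H(s)$, whose inverse is $\<kappa>$. The reparametrised curve is the integral curve of a new field, which is smooth away from the origin but may be much rougher than $w$ at the origin. The bound on $H'$ keeps the new speed comparable to that of $w$.\<close>

locale perturbed_flow = flat_field w \<sigma>0 \<psi>0 for w \<sigma>0 \<psi>0 :: "real \<Rightarrow> real" +
  fixes H \<kappa> :: "real \<Rightarrow> real"
  assumes H_smooth: "Cinf_on H UNIV"
    and H_deriv_bound: "\<And>s. \<bar>deriv H s\<bar> \<le> 1 / 2"
    and \<kappa>_right: "\<And>s. \<kappa> s + H (\<kappa> s) = s"
    and \<kappa>_left: "\<And>s. \<kappa> (s + H s) = s"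
    and \<kappa>_DERIV: "\<And>s. (\<kappa> has_real_derivative inverse (1 + deriv H (\<kappa> s))) (at s)"

lemma (in flat_field) perturbed_flow_exists:
  assumes "Cinf_on H UNIV" "\<And>s. \<bar>deriv H s\<bar> \<le> 1 / 2" "\<And>s. \<bar>H s\<bar> \<le> 1"
  shows "\<exists>\<kappa>. perturbed_flow w \<sigma>0 \<psi>0 H \<kappa>"
proof -
  have dH: "(H has_real_derivative deriv H s) (at s)" for s
    using Cinf_on_deriv(1)[OF open_UNIV assms(1)] by simp
  have d: "((\<lambda>s. s + H s) has_real_derivative 1 + deriv H s) (at s)" for s
    by (intro DERIV_add DERIV_ident dH)
  have p: "1 + deriv H s > 0" for s using assms(2)[of s] by linarith
  have surj: "\<exists>x\<in>UNIV. x + H x = s" for s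
  proof -
    have "continuous_on {s - 1..s + 1} (\<lambda>s. s + H s)"
      by (intro continuous_at_imp_continuous_on ballI DERIV_isCont[OF d])
    moreover have "(s - 1) + H (s - 1) \<le> s" "s \<le> (s + 1) + H (s + 1)"
      using assms(3)[of "s - 1"] assms(3)[of "s + 1"] by linarith+
    ultimately show ?thesis using IVT'[of "\<lambda>s. s + H s" "s - 1" s "s + 1"] by auto
  qed
  obtain h where h: "\<And>s. h s \<in> UNIV" "\<And>s. h s + H (h s) = s" "\<And>x. x \<in> UNIV \<Longrightarrow> h (x + H x) = x"
    "\<And>s. (h has_real_derivative inverse (1 + deriv H (h s))) (at s)"
    by (rule increasing_diffeo_inverse[OF open_UNIV convex_UNIV d p surj]) (rule that)
  have "perturbed_flow w \<sigma>0 \<psi>0 H h"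
    using assms h(2) h(3)[OF UNIV_I] h(4) by unfold_locales
  then show ?thesis by blast
qed

context perturbed_flow
begin

lemma H_DERIV: "(H has_real_derivative deriv H s) (at s)"
  using Cinf_on_deriv(1)[OF open_UNIV H_smooth] by simp

lemma H_DERIV2: "(deriv H has_real_derivative deriv (deriv H) s) (at s)"
  using Cinf_on_deriv(1)[OF open_UNIV Cinf_on_deriv(2)[OF open_UNIV H_smooth]] by simp

lemma speed_pos: "1 + deriv H s > 0" "1 + deriv H s \<ge> 1 / 2" "1 + deriv H s \<le> 3 / 2"
  using H_deriv_bound[of s] by linarith+

definition clock :: "real \<Rightarrow> real" where "clock x = \<kappa> (\<sigma>0 x)"
definition orbit :: "real \<Rightarrow> real" where "orbit s = \<psi>0 (s + H s)"
definition flow :: "real \<Rightarrow> real \<Rightarrow> real" where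
  "flow t x = (if x > 0 then orbit (clock x + t) else x)"
definition field :: "real \<Rightarrow> real" where "field x = w x * (1 + deriv H (clock x))"

lemma orbit_pos: "orbit s > 0" by (simp add: orbit_def \<psi>0_pos)
lemma clock_orbit: "clock (orbit s) = s" by (simp add: orbit_def clock_def \<sigma>0_\<psi>0 \<kappa>_left)
lemma orbit_clock: "x > 0 \<Longrightarrow> orbit (clock x) = x" by (simp add: orbit_def clock_def \<kappa>_right \<psi>0_\<sigma>0)
lemma clock_plus_H: "clock x + H (clock x) = \<sigma>0 x" by (simp add: clock_def \<kappa>_right)

lemma orbit_DERIV: "(orbit has_real_derivative field (orbit s)) (at s)"
proof -
  have "((\<lambda>s. s + H s) has_real_derivative 1 + deriv H s) (at s)"
    by (intro DERIV_add DERIV_ident H_DERIV)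
  from DERIV_chain2[OF \<psi>0_DERIV this] show ?thesis
    unfolding field_def clock_orbit by (simp add: orbit_def[abs_def])
qed

lemma clock_DERIV: 
  "x > 0 \<Longrightarrow> (clock has_real_derivative inverse (1 + deriv H (clock x)) * inverse (w x)) (at x)"
  using DERIV_chain2[OF \<kappa>_DERIV \<sigma>0_DERIV, of x] by (simp add: clock_def[abs_def])

lemma field_pos: "x > 0 \<Longrightarrow> field x > 0"
  using pos speed_pos(1) by (simp add: field_def)

lemma orbit_strict_mono: "s < t \<Longrightarrow> orbit s < orbit t"
proof (erule DERIV_pos_imp_increasing)
  show "\<exists>y. (orbit has_real_derivative y) (at x) \<and> 0 < y" for x
    using orbit_DERIV[of x] field_pos[OF orbit_pos[of x]] by blast
qed

lemma orbit_less_iff: "orbit s < orbit t \<longleftrightarrow> s < t"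
  using orbit_strict_mono by (metis linorder_neqE_linordered_idom order_less_asym order_less_irrefl)

lemma clock_less_iff: "x > 0 \<Longrightarrow> clock x < s \<longleftrightarrow> x < orbit s"
  using orbit_less_iff[of "clock x" s] orbit_clock by simp

lemma less_clock_iff: "x > 0 \<Longrightarrow> s < clock x \<longleftrightarrow> orbit s < x"
  using orbit_less_iff[of s "clock x"] orbit_clock by simp

lemma clock_at_bot: "filterlim clock at_bot (at_right 0)"
  unfolding filterlim_at_bot
proof
  fix Z
  show "eventually (\<lambda>x. clock x \<le> Z) (at_right 0)"
    unfolding eventually_at_right_field
    using orbit_pos[of Z] clock_less_iff[of _ Z] by (intro exI[of _ "orbit Z"]) (auto intro: less_imp_le)
qed

lemma Cinf_on_\<kappa>: "Cinf_on \<kappa> UNIV"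
proof -
  have "Ck_on k \<kappa> UNIV" for k
  proof (induction k)
    case 0
    show ?case using DERIV_isCont[OF \<kappa>_DERIV] by (simp add: continuous_at_imp_continuous_on)
  next
    case (Suc k)
    have dH: "Ck_on k (deriv H) UNIV"
      using Cinf_on_deriv(2)[OF open_UNIV H_smooth] by (simp add: Cinf_on_def)
    have ne: "1 + deriv H (\<kappa> s) \<noteq> 0" for s using speed_pos(1)[of "\<kappa> s"] by linarith
    have "Ck_on k (\<lambda>s. inverse (1 + deriv H (\<kappa> s))) UNIV"
      by (rule Ck_on_inverse[OF Ck_on_add[OF Ck_on_const Ck_on_comp[OF dH Suc]] ne]) simp
    moreover have "\<forall>x\<in>UNIV. (\<kappa> has_real_derivative inverse (1 + deriv H (\<kappa> x))) (at x)"
      using \<kappa>_DERIV by blast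
    ultimately show ?case unfolding Ck_on.simps by (intro exI[of _ "\<lambda>s. inverse (1 + deriv H (\<kappa> s))"]) blast
  qed
  then show ?thesis by (simp add: Cinf_on_def)
qed

lemma Cinf_on_clock: "Cinf_on clock {0<..}"
  unfolding clock_def[abs_def] by (rule Cinf_on_comp[OF Cinf_on_\<kappa> Cinf_on_\<sigma>0]) simp

lemma is_flow_flow: "is_flow field flow"
  unfolding is_flow_def integral_curve_def
proof (intro ballI conjI allI)
  fix x t :: real assume "x \<in> {0..}"
  then have x: "x \<ge> 0" by simp
  show "flow t x \<in> {0..}" using x orbit_pos by (auto simp: flow_def less_imp_le)
  show "flow 0 x = x" by (simp add: flow_def orbit_clock)
  show "((\<lambda>t. flow t x) has_real_derivative field (flow t x)) (at t)"
  proof (cases "x > 0")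
    case True
    have "((\<lambda>t. clock x + t) has_real_derivative 1) (at t)" by (auto intro!: derivative_eq_intros)
    from DERIV_chain2[OF orbit_DERIV this] show ?thesis using True by (simp add: flow_def)
  next
    case False
    then show ?thesis using x by (simp add: flow_def field_def zero)
  qed
qed

lemma complete_field: "complete_vector_field field"
  using is_flow_flow unfolding complete_vector_field_def is_flow_def by blast

lemma field_eq_0_iff: "x \<ge> 0 \<Longrightarrow> field x = 0 \<longleftrightarrow> x = 0"
  using field_pos[of x] zero[of x] by (cases "x = 0") (auto simp: field_def)

lemma flow_add: "flow (s + t) x = flow s (flow t x)"
  by (auto simp: flow_def orbit_pos clock_orbit add_ac)

lemma flow_pos: "x > 0 \<Longrightarrow> flow t x > 0" by (simp add: flow_def orbit_pos)
lemma flow_nonneg: "x \<ge> 0 \<Longrightarrow> flow t x \<ge> 0" using flow_pos[of x t] by (cases "x = 0") (auto simp: flow_def)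

text \<open>With $\<sigma>$ denoting the new time coordinate, the field is $w(1 + H'(\<sigma>))$ and its derivative is $w'(1 + H'(\<sigma>)) + H''(\<sigma>)/(1 + H'(\<sigma>))$. The factor $w$ cancels against $\<sigma>'$, so that only the decay of $H''$ matters, no matter how slow the field is.\<close>

lemma field_C1:
  assumes "(deriv (deriv H) \<longlongrightarrow> 0) at_bot"
  shows "Ck_on 1 field {0..}"
proof -
  define v where "v x = (if x > 0 then deriv w x * (1 + deriv H (clock x)) + deriv (deriv H) (clock x) * inverse (1 + deriv H (clock x)) else 0)" for x
  have dpos: "(field has_real_derivative v x) (at x)" if x: "x > 0" for x
  proof -
    have "((\<lambda>x. deriv H (clock x)) has_real_derivative
        deriv (deriv H) (clock x) * (inverse (1 + deriv H (clock x)) * inverse (w x))) (at x)"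
      by (rule DERIV_chain2[OF H_DERIV2 clock_DERIV[OF x]])
    then have "((\<lambda>x. w x * (1 + deriv H (clock x))) has_real_derivative deriv w x * (1 + deriv H (clock x)) +
        (0 + deriv (deriv H) (clock x) * (inverse (1 + deriv H (clock x)) * inverse (w x))) * w x) (at x)"
      by (intro DERIV_mult w_DERIV DERIV_add DERIV_const)
    moreover have "deriv w x * (1 + deriv H (clock x)) +
        (0 + deriv (deriv H) (clock x) * (inverse (1 + deriv H (clock x)) * inverse (w x))) * w x = v x"
      using x pos[OF x] by (simp add: v_def)
    ultimately show ?thesis by (simp add: field_def[abs_def])
  qed
  have dneg: "(field has_real_derivative v x) (at x)" if x: "x < 0" for x
    using has_field_derivative_transform_within_open[of "\<lambda>x. 0" 0 x "{..<0}" field] x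
    by (simp add: field_def zero v_def)
  have ccl: "isCont clock x" if "x > 0" for x using clock_DERIV[OF that] by (rule DERIV_isCont)
  have cw': "isCont (deriv w) x" for x
    using Cinf_on_imp_continuous_on[OF Cinf_on_deriv(2)[OF open_UNIV smooth]] by (simp add: continuous_on_eq_continuous_at)
  have c2: "isCont (deriv (deriv H)) x" for x
    using Cinf_on_imp_continuous_on[OF Cinf_on_higher_deriv[OF open_UNIV H_smooth, of 2]]
    by (simp add: continuous_on_eq_continuous_at numeral_2_eq_2)
  have vpos: "isCont v x" if x: "x > 0" for x
  proof -
    have "1 + deriv H (clock x) \<noteq> 0" using speed_pos(1)[of "clock x"] by linarith
    then have "isCont (\<lambda>x. deriv w x * (1 + deriv H (clock x)) + deriv (deriv H) (clock x) * inverse (1 + deriv H (clock x))) x"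
      by (intro continuous_intros cw' isCont_o2[OF ccl[OF x] DERIV_isCont[OF H_DERIV2]] isCont_o2[OF ccl[OF x] c2])
    moreover have "eventually (\<lambda>y. v y = deriv w y * (1 + deriv H (clock y)) + deriv (deriv H) (clock y) * inverse (1 + deriv H (clock y))) (nhds x)"
      using eventually_nhds_in_open[of "{0<..}" x] x by (auto elim!: eventually_mono simp: v_def)
    ultimately show ?thesis by (simp add: isCont_cong)
  qed
  have vneg: "isCont v x" if x: "x < 0" for x
  proof -
    have "eventually (\<lambda>y. v y = 0) (nhds x)"
      using eventually_nhds_in_open[of "{..<0}" x] x by (auto elim!: eventually_mono simp: v_def)
    then show ?thesis by (simp add: isCont_cong)
  qed
  have vr: "(v \<longlongrightarrow> 0) (at_right 0)"
  proof (rule tendsto_0_le[where K = 1])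
    have "(deriv w \<longlongrightarrow> 0) (at 0)" using cw'[of 0] deriv_w_zero[of 0] by (simp add: isCont_def)
    then have 1: "(deriv w \<longlongrightarrow> 0) (at_right 0)" by (simp add: filterlim_at_split)
    have 2: "((\<lambda>x. deriv (deriv H) (clock x)) \<longlongrightarrow> 0) (at_right 0)"
      by (rule filterlim_compose[OF assms clock_at_bot])
    have "((\<lambda>x. \<bar>deriv w x\<bar> * (3/2) + \<bar>deriv (deriv H) (clock x)\<bar> * 2) \<longlongrightarrow> \<bar>0\<bar> * (3/2) + \<bar>0\<bar> * 2) (at_right 0)"
      by (intro tendsto_intros 1 2)
    then show "((\<lambda>x. \<bar>deriv w x\<bar> * (3/2) + \<bar>deriv (deriv H) (clock x)\<bar> * 2) \<longlongrightarrow> 0) (at_right 0)" by simp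
    have "norm (v x) \<le> norm (\<bar>deriv w x\<bar> * (3/2) + \<bar>deriv (deriv H) (clock x)\<bar> * 2) * 1" if "x > 0" for x
    proof -
      note sp = speed_pos[of "clock x"]
      have "inverse (1 + deriv H (clock x)) \<le> inverse (1/2)" using sp by (intro le_imp_inverse_le) auto
      moreover have "\<bar>v x\<bar> \<le> \<bar>deriv w x\<bar> * (1 + deriv H (clock x)) + \<bar>deriv (deriv H) (clock x)\<bar> * inverse (1 + deriv H (clock x))"
        using that sp abs_triangle_ineq[of "deriv w x * (1 + deriv H (clock x))" "deriv (deriv H) (clock x) * inverse (1 + deriv H (clock x))"]
        by (simp add: v_def abs_mult)
      moreover have "\<bar>deriv w x\<bar> * (1 + deriv H (clock x)) \<le> \<bar>deriv w x\<bar> * (3/2)"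
        using sp by (intro mult_left_mono) auto
      ultimately have "\<bar>v x\<bar> \<le> \<bar>deriv w x\<bar> * (3/2) + \<bar>deriv (deriv H) (clock x)\<bar> * 2"
        using mult_left_mono[of "inverse (1 + deriv H (clock x))" 2 "\<bar>deriv (deriv H) (clock x)\<bar>"] by simp
      then show ?thesis by simp
    qed
    then show "eventually (\<lambda>x. norm (v x) \<le> norm (\<bar>deriv w x\<bar> * (3/2) + \<bar>deriv (deriv H) (clock x)\<bar> * 2) * 1) (at_right 0)"
      unfolding eventually_at_right_field by (intro exI[of _ 1]) simp
  qed
  have vl: "(v \<longlongrightarrow> 0) (at_left 0)"
  proof (rule Lim_transform_eventually[OF tendsto_const[of 0]])
    show "eventually (\<lambda>x. 0 = v x) (at_left 0)"
      unfolding eventually_at_left_field by (intro exI[of _ "-1"]) (simp add: v_def)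
  qed
  have v0: "(v \<longlongrightarrow> 0) (at 0)" using vr vl by (simp add: filterlim_split_at)
  have dnz: "(field has_real_derivative v x) (at x)" if "x \<noteq> 0" for x
    using dpos dneg that by (cases "x > 0") auto
  have f0: "isCont field 0"
  proof -
    have "(field \<longlongrightarrow> 0) (at 0)"
    proof (rule tendsto_0_le[where K = "3/2"])
      show "(w \<longlongrightarrow> 0) (at 0)" using DERIV_isCont[OF w_DERIV, of 0] zero[of 0] by (simp add: isCont_def)
      have "norm (field x) \<le> norm (w x) * (3/2)" for x
        unfolding field_def norm_mult using speed_pos[of "clock x"] by (intro mult_left_mono) auto
      then show "eventually (\<lambda>x. norm (field x) \<le> norm (w x) * (3/2)) (at 0)" by simp
    qed
    then show ?thesis using zero[of 0] by (simp add: isCont_def field_def)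
  qed
  have "(field has_real_derivative 0) (at 0)"
    by (rule continuous_derivative_imp_DERIV[OF f0 dnz v0])
  then have d: "(field has_real_derivative v x) (at x)" for x
    using dnz[of x] by (cases "x = 0") (simp_all add: v_def)
  have "isCont v 0" using v0 by (simp add: isCont_def v_def)
  then have "isCont v x" for x
    using vpos[of x] vneg[of x] by (cases x "0::real" rule: linorder_cases) simp_all
  then have "continuous_on UNIV v" by (simp add: continuous_at_imp_continuous_on)
  then have "Ck_on 1 field UNIV"
    unfolding One_nat_def Ck_on.simps using d by (intro exI[of _ v]) simp
  then show ?thesis by (rule Ck_on_subset) simp
qed

text \<open>The time for which $w$ has to be followed in order to reach the same point as the new field in time $t$ is $t$ plus this quantity.\<close>

definition phase_shift :: "real \<Rightarrow> real \<Rightarrow> real" where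
  "phase_shift t x = (if x > 0 then H (clock x + t) - H (clock x) else 0)"

lemma Cinf_on_phase_shift_pos: "Cinf_on (phase_shift t) {0<..}"
proof -
  have c: "Ck_on k clock {0<..}" and h: "Ck_on k H UNIV" for k
    using Cinf_on_clock H_smooth by (simp_all add: Cinf_on_def)
  have "Ck_on k (\<lambda>x. H (clock x + t) - H (clock x)) {0<..}" for k
    by (rule Ck_on_diff[OF Ck_on_comp[OF h Ck_on_add[OF c Ck_on_const]] Ck_on_comp[OF h c]]) auto
  then show ?thesis unfolding Cinf_on_def
    using Ck_on_cong[of _ "\<lambda>x. H (clock x + t) - H (clock x)" "{0<..}" "phase_shift t"] by (simp add: phase_shift_def)
qed

text \<open>The flow of the new field is obtained by moving each point along $w$ for a time that depends on the point, so it is smooth as soon as the phase shift is flat at the origin.\<close>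

lemma Cinf_on_flow:
  assumes "\<And>k. ((deriv ^^ k) (phase_shift t) \<longlongrightarrow> 0) (at_right 0)"
  shows "Cinf_on (flow t) UNIV"
proof -
  have D: "Cinf_on (phase_shift t) UNIV"
    by (rule Cinf_on_flat_extension(1)[OF Cinf_on_phase_shift_pos _ assms]) (simp add: phase_shift_def)
  have "Cinf_on (\<lambda>x. t + phase_shift t x) UNIV"
    using D Ck_on_add[OF Ck_on_const] by (simp add: Cinf_on_def)
  then have "Cinf_on (shifted (\<lambda>x. t + phase_shift t x) 1) UNIV" by (rule Cinf_on_shifted)
  moreover have "shifted (\<lambda>x. t + phase_shift t x) 1 = flow t"
  proof
    fix x show "shifted (\<lambda>x. t + phase_shift t x) 1 x = flow t x"
      by (simp add: shifted_def flow_def phase_shift_def orbit_def clock_plus_H[symmetric] add_ac)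
  qed
  ultimately show ?thesis by simp
qed

end

section \<open>The base field\<close>

definition bump :: "real \<Rightarrow> real" where
  "bump y = smooth_step (4 * y - 2) * smooth_step (4 - y)"

text \<open>Between $4^{-j}$ and $2 \cdot 4^{-j}$ the field is constant, equal to $c_j$; the first summand makes it constant near infinity. The speeds $c_j$ may be chosen almost freely, which is what makes the dips of the speed possible.\<close>

definition base_field :: "(nat \<Rightarrow> real) \<Rightarrow> real \<Rightarrow> real" where
  "base_field c x = c 0 * (1 - smooth_step (4 - x)) + (\<Sum>j. c j * bump (4 ^ j * x))"

text \<open>Speeds below this bound decay faster than any power of $4^{-j}$, which makes the series defining the field and all its derivatives converge. In addition each stretch of constant speed then lasts at least $16$ units of time.\<close>

definition cap :: "nat \<Rightarrow> real" where "cap j = 1 / 4 ^ (j\<^sup>2 + 2)"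

definition admissible :: "(nat \<Rightarrow> real) \<Rightarrow> bool" where
  "admissible c \<longleftrightarrow> (\<forall>j. 0 < c j \<and> c j \<le> cap j)"

lemma cap_pos: "cap j > 0" by (simp add: cap_def)

lemma bump_simps: "y \<le> 1/2 \<Longrightarrow> bump y = 0" "4 \<le> y \<Longrightarrow> bump y = 0"
  "1 \<le> y \<Longrightarrow> y \<le> 3 \<Longrightarrow> bump y = 1" "bump y \<ge> 0" "1/2 < y \<Longrightarrow> y < 4 \<Longrightarrow> bump y > 0" "bump y \<le> 1"
  unfolding bump_def by (auto simp: smooth_step_simps intro!: mult_nonneg_nonneg mult_pos_pos mult_le_one)

lemma Ck_bound_smooth_step_affine:
  assumes "1 \<le> \<bar>a\<bar>" shows "\<exists>B. \<forall>b. Ck_bound k B UNIV (\<lambda>x. smooth_step (a * x + b))"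
  using Ck_bound_smooth_step[of k] Ck_bound_affine[OF _ assms] by blast

lemma Ck_bound_bump: "\<exists>B. Ck_bound k B UNIV bump"
proof -
  obtain A B where A: "\<forall>b. Ck_bound k A UNIV (\<lambda>x. smooth_step (4 * x + b))"
    and B: "\<forall>b. Ck_bound k B UNIV (\<lambda>x. smooth_step ((-1) * x + b))"
    using Ck_bound_smooth_step_affine[of 4 k] Ck_bound_smooth_step_affine[of "-1" k] by auto
  have "Ck_bound k (2 ^ k * (A * B)) UNIV (\<lambda>x. smooth_step (4 * x + (-2)) * smooth_step ((-1) * x + 4))"
    by (intro Ck_bound_mult A[rule_format] B[rule_format])
  then have "Ck_bound k (2 ^ k * (A * B)) UNIV bump"
    by (simp add: bump_def[abs_def])
  then show ?thesis by blast
qed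

lemma Cinf_on_affine: "Cinf_on f UNIV \<Longrightarrow> Cinf_on (\<lambda>x. f (a * x + b)) UNIV"
  unfolding Cinf_on_def
proof
  fix k assume "\<forall>k. Ck_on k f UNIV"
  then show "Ck_on k (\<lambda>x. f (a * x + b)) UNIV"
    by (intro Ck_on_comp[of k f UNIV "\<lambda>x. a * x + b"] Ck_on_add Ck_on_cmult Ck_on_id Ck_on_const) auto
qed

lemma Cinf_on_bump: "Cinf_on bump UNIV"
proof -
  have "Ck_on k (\<lambda>x. smooth_step (4 * x + (-2)) * smooth_step ((-1) * x + 4)) UNIV" for k
    using Cinf_on_affine[OF Cinf_on_smooth_step, of 4 "-2"] Cinf_on_affine[OF Cinf_on_smooth_step, of "-1" 4]
    by (intro Ck_on_mult) (simp_all add: Cinf_on_def)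
  then show ?thesis by (simp add: bump_def[abs_def] Cinf_on_def)
qed

lemma summable_cap_power: "summable (\<lambda>j. cap j * 4 ^ (j * k) * B)"
proof (rule summable_comparison_test_ev)
  have "norm (cap j * 4 ^ (j * k) * B) \<le> \<bar>B\<bar> * (1 / 4) ^ j" if "j \<ge> Suc k" for j
  proof -
    have "j * k + j \<le> j\<^sup>2 + 2"
    proof -
      have "j * Suc k \<le> j * j" using that by (intro mult_le_mono2)
      then show ?thesis by (simp add: power2_eq_square)
    qed
    then have "(4::real) ^ (j * k + j) \<le> 4 ^ (j\<^sup>2 + 2)" by (intro power_increasing) auto
    then have "cap j * 4 ^ (j * k) \<le> (1 / 4) ^ j"
      by (simp add: cap_def power_add field_simps power_one_over)
    then show ?thesis using mult_right_mono[of "cap j * 4 ^ (j * k)" "(1/4) ^ j" "\<bar>B\<bar>"] cap_pos[of j]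
      by (simp add: abs_mult mult.commute)
  qed
  then show "\<forall>\<^sub>F j in sequentially. norm (cap j * 4 ^ (j * k) * B) \<le> \<bar>B\<bar> * (1 / 4) ^ j"
    using eventually_sequentially by blast
  show "summable (\<lambda>j. \<bar>B\<bar> * (1 / 4) ^ j)" by (intro summable_mult summable_geometric) simp
qed

text \<open>The intervals $[4^{-j}, 2 \cdot 4^{-j}]$ meet the support of no other bump; this is what creates the stretches of constant speed.\<close>

lemma outside_scale:
  fixes x :: real
  assumes x: "1 / 4 ^ j \<le> x" "x \<le> 2 / 4 ^ i" and k: "k < i \<or> j < k"
  shows "4 ^ k * x \<le> 1/2 \<or> 4 \<le> 4 ^ k * x"
proof -
  have "(0::real) < 1 / 4 ^ j" by simp
  then have x0: "x > 0" using x(1) by linarith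
  have u: "4 ^ i * x \<le> 2" and l: "1 \<le> 4 ^ j * x"
    using x by (simp_all add: pos_le_divide_eq pos_divide_le_eq mult.commute)
  show ?thesis
    using k
  proof
    assume "k < i"
    then have "(4::real) ^ Suc k \<le> 4 ^ i" by (intro power_increasing) auto
    then have "4 ^ Suc k * x \<le> 4 ^ i * x" using x0 by (intro mult_right_mono) auto
    then show ?thesis using u by simp
  next
    assume "j < k"
    then have "(4::real) ^ Suc j \<le> 4 ^ k" by (intro power_increasing) auto
    then have "4 ^ Suc j * x \<le> 4 ^ k * x" using x0 by (intro mult_right_mono) auto
    then show ?thesis using l by simp
  qed
qed

context
  fixes c assumes adm: "admissible c"
begin

lemma c_pos: "c j > 0" and c_le: "c j \<le> cap j" using adm by (auto simp: admissible_def)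

lemma summable_c: "summable c"
proof (rule summable_comparison_test'[OF summable_cap_power[of 0 1]])
  show "norm (c n) \<le> cap n * 4 ^ (n * 0) * 1" for n using c_pos[of n] c_le[of n] by simp
qed

lemma summable_bumps: "summable (\<lambda>j. c j * bump (4 ^ j * x))"
proof (rule summable_comparison_test'[OF summable_c])
  show "norm (c n * bump (4 ^ n * x)) \<le> c n" for n
    using c_pos[of n] bump_simps(4,6)[of "4 ^ n * x"] by (simp add: abs_mult mult_left_le)
qed

lemma Cinf_on_base_field: "Cinf_on (base_field c) UNIV"
proof -
  have "Cinf_on (\<lambda>x. \<Sum>j. c j * bump (4 ^ j * x)) UNIV"
  proof (rule Cinf_on_series)
    show sm: "Cinf_on (\<lambda>x. c j * bump (4 ^ j * x)) UNIV" for j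
      using Cinf_on_affine[OF Cinf_on_bump, of "4 ^ j" 0] Ck_on_cmult by (simp add: Cinf_on_def)
    fix k
    obtain B where B: "Ck_bound k B UNIV bump" using Ck_bound_bump by blast
    have B0: "B \<ge> 0" using Ck_bound_abs[OF B, of 0] by simp
    have "\<bar>(deriv ^^ k) (\<lambda>x. c j * bump (4 ^ j * x)) x\<bar> \<le> cap j * 4 ^ (j * k) * B" for j x
    proof -
      have "Ck_bound k (\<bar>4 ^ j\<bar> ^ k * B) UNIV (\<lambda>x. bump (4 ^ j * x + 0))"
        by (rule Ck_bound_affine[OF B]) simp
      from Ck_bound_cmult[OF this, of "c j"]
      have "Ck_bound k (c j * (4 ^ (j * k) * B)) UNIV (\<lambda>x. c j * bump (4 ^ j * x))"
        using c_pos[of j] by (simp add: power_mult)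
      from Ck_bound_higher_deriv[OF open_UNIV this order_refl, of x]
      have "\<bar>(deriv ^^ k) (\<lambda>x. c j * bump (4 ^ j * x)) x\<bar> \<le> c j * (4 ^ (j * k) * B)" by simp
      also have "\<dots> \<le> cap j * (4 ^ (j * k) * B)" using c_le B0 by (intro mult_right_mono) auto
      finally show ?thesis by (simp add: mult.assoc)
    qed
    then show "\<exists>M. summable M \<and> (\<forall>n x. \<bar>(deriv ^^ k) (\<lambda>x. c n * bump (4 ^ n * x)) x\<bar> \<le> M n)"
      using summable_cap_power[of k B] by blast
  qed
  moreover have "Cinf_on (\<lambda>x. smooth_step ((-1) * x + 4)) UNIV" by (rule Cinf_on_affine[OF Cinf_on_smooth_step])
  then have "Ck_on k (\<lambda>x. c 0 * (1 - smooth_step ((-1) * x + 4))) UNIV" for k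
    unfolding Cinf_on_def by (intro Ck_on_cmult Ck_on_diff Ck_on_const) simp
  ultimately show ?thesis
    unfolding base_field_def[abs_def] Cinf_on_def using Ck_on_add by simp
qed

lemma base_field_nonpos: "x \<le> 0 \<Longrightarrow> base_field c x = 0"
proof -
  assume x: "x \<le> 0"
  have "bump (4 ^ j * x) = 0" for j using mult_nonneg_nonpos[of "4 ^ j" x] x by (intro bump_simps) simp
  then show ?thesis using x by (simp add: base_field_def smooth_step_simps)
qed

lemma base_field_pos: "x > 0 \<Longrightarrow> base_field c x > 0"
proof -
  assume x: "x > 0"
  have n: "c j * bump (4 ^ j * x) \<ge> 0" for j using c_pos[of j] bump_simps(4) by simp
  have n0: "c 0 * (1 - smooth_step (4 - x)) \<ge> 0" using c_pos[of 0] smooth_step_simps(5) by simp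
  show ?thesis
  proof (cases "x < 4")
    case False
    then have "c 0 * (1 - smooth_step (4 - x)) > 0" using c_pos[of 0] by (simp add: smooth_step_simps)
    then show ?thesis unfolding base_field_def using suminf_nonneg[OF summable_bumps n] by (rule add_pos_nonneg)
  next
    case True
    have ex: "\<exists>j. 4 ^ j * x > 1/2"
      using real_arch_pow[of 4 "1 / (2 * x)"] x by (auto simp: field_simps)
    define j where "j = (LEAST j. 4 ^ j * x > 1/2)"
    have j: "4 ^ j * x > 1/2" unfolding j_def using ex by (rule LeastI_ex)
    have "4 ^ j * x < 4"
    proof (cases j)
      case 0 then show ?thesis using True by simp
    next
      case (Suc i)
      have "\<not> 4 ^ i * x > 1/2" using not_less_Least[of i "\<lambda>j. 4 ^ j * x > 1/2"] Suc by (simp add: j_def)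
      then show ?thesis using Suc by simp
    qed
    then have "c j * bump (4 ^ j * x) > 0" using j c_pos[of j] by (simp add: bump_simps)
    then have "(\<Sum>j. c j * bump (4 ^ j * x)) > 0" using suminf_pos2[OF summable_bumps n] by blast
    then show ?thesis unfolding base_field_def using n0 by (rule add_nonneg_pos[rotated])
  qed
qed

lemma base_field_bounded: "base_field c x \<le> c 0 + suminf c"
proof -
  have "(\<Sum>j. c j * bump (4 ^ j * x)) \<le> suminf c"
    using c_pos bump_simps(6) by (intro suminf_le summable_bumps summable_c mult_left_le) (auto intro: less_imp_le)
  moreover have "c 0 * (1 - smooth_step (4 - x)) \<le> c 0"
    using c_pos[of 0] smooth_step_simps(4)[of "4 - x"] by (simp add: mult_left_le)
  ultimately show ?thesis by (simp add: base_field_def)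
qed

lemma base_field_local:
  assumes "x \<le> 3" "finite J" "\<And>j. j \<notin> J \<Longrightarrow> 4 ^ j * x \<le> 1/2 \<or> 4 \<le> 4 ^ j * x"
  shows "base_field c x = (\<Sum>j\<in>J. c j * bump (4 ^ j * x))"
proof -
  have "(\<Sum>j. c j * bump (4 ^ j * x)) = (\<Sum>j\<in>J. c j * bump (4 ^ j * x))"
    using assms(2,3) bump_simps(1,2) by (intro suminf_finite) auto
  then show ?thesis using assms(1) by (simp add: base_field_def smooth_step_simps)
qed

lemma base_field_plateau:
  assumes "1 / 4 ^ j \<le> x" "x \<le> 2 / 4 ^ j"
  shows "base_field c x = c j"
proof -
  have x3: "x \<le> 3"
  proof -
    have "2 / 4 ^ j \<le> (2::real)" by (simp add: field_simps)
    then show ?thesis using assms by linarith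
  qed
  have "base_field c x = (\<Sum>k\<in>{j}. c k * bump (4 ^ k * x))"
    by (rule base_field_local[OF x3]) (use outside_scale[OF assms] in \<open>simp_all add: neq_iff\<close>)
  moreover have "bump (4 ^ j * x) = 1" using assms by (intro bump_simps) (auto simp: field_simps)
  ultimately show ?thesis by simp
qed

end

definition zone :: "nat \<Rightarrow> real set" where "zone n = {1 / 4 ^ (2 * n + 2)<..<2 / 4 ^ (2 * n)}"

text \<open>The base field between the two fast stretches with indices $2n$ and $2n+2$. It depends only on the speed $v$ of the slow stretch in between, because the fast speeds are fixed in advance.\<close>

definition zone_field :: "nat \<Rightarrow> real \<Rightarrow> real \<Rightarrow> real" where
  "zone_field n v x = cap (2 * n) * bump (4 ^ (2 * n) * x) + v * bump (4 ^ (2 * n + 1) * x)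
     + cap (2 * n + 2) * bump (4 ^ (2 * n + 2) * x)"

lemma base_field_zone:
  assumes "admissible c" "c (2 * n) = cap (2 * n)" "c (2 * n + 2) = cap (2 * n + 2)" "x \<in> zone n"
  shows "base_field c x = zone_field n (c (2 * n + 1)) x"
proof -
  have x: "1 / 4 ^ (2 * n + 2) \<le> x" "x \<le> 2 / 4 ^ (2 * n)" using assms(4) by (auto simp: zone_def)
  have x3: "x \<le> 3"
  proof -
    have "2 / 4 ^ (2 * n) \<le> (2::real)" by (simp add: field_simps)
    then show ?thesis using x by linarith
  qed
  have "base_field c x = (\<Sum>k\<in>{2 * n, 2 * n + 1, 2 * n + 2}. c k * bump (4 ^ k * x))"
  proof (rule base_field_local[OF assms(1) x3])
    show "4 ^ k * x \<le> 1/2 \<or> 4 \<le> 4 ^ k * x" if "k \<notin> {2 * n, 2 * n + 1, 2 * n + 2}" for k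
      using that by (intro outside_scale[OF x]) auto
  qed simp
  then show ?thesis using assms(2,3) by (simp add: zone_field_def)
qed

lemma zone_field_pos:
  assumes "v > 0" "1 / 4 ^ (2 * n + 2) \<le> x" "x \<le> 2 / 4 ^ (2 * n)"
  shows "zone_field n v x > 0"
proof -
  define y where "y = 4 ^ (2 * n) * x"
  have y: "1 \<le> 16 * y" "y \<le> 2" using assms(2,3) by (simp_all add: y_def field_simps)
  have eq: "zone_field n v x = cap (2 * n) * bump y + v * bump (4 * y) + cap (2 * n + 2) * bump (16 * y)"
    by (simp add: zone_field_def y_def mult_ac)
  have n: "cap (2 * n) * bump y \<ge> 0" "v * bump (4 * y) \<ge> 0" "cap (2 * n + 2) * bump (16 * y) \<ge> 0"
    using bump_simps(4) cap_pos[of "2 * n"] cap_pos[of "2 * n + 2"] assms(1) by (auto intro!: mult_nonneg_nonneg)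
  consider "y > 1/2" | "1/8 < y" "y \<le> 1/2" | "y \<le> 1/8" by linarith
  then show ?thesis
  proof cases
    case 1
    then have "cap (2 * n) * bump y > 0" using y cap_pos[of "2 * n"] bump_simps(5)[of y] by simp
    then show ?thesis using n eq by linarith
  next
    case 2
    then have "v * bump (4 * y) > 0" using y assms(1) bump_simps(5)[of "4 * y"] by simp
    then show ?thesis using n eq by linarith
  next
    case 3
    then have "cap (2 * n + 2) * bump (16 * y) > 0" using y cap_pos[of "2 * n + 2"] bump_simps(5)[of "16 * y"] by simp
    then show ?thesis using n eq by linarith
  qed
qed

lemma Cinf_on_zone_field: "Cinf_on (zone_field n v) UNIV"
proof -
  have b: "Ck_on k (\<lambda>x. a * bump (d * x)) UNIV" for k a d
    using Cinf_on_affine[OF Cinf_on_bump, of d 0] by (intro Ck_on_cmult) (simp add: Cinf_on_def)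
  show ?thesis unfolding zone_field_def[abs_def] Cinf_on_def by (intro allI Ck_on_add b)
qed

lemma zone_field_inverse_bound:
  assumes "v > 0"
  shows "\<exists>R\<ge>0. Ck_bound k R (zone n) (\<lambda>x. inverse (zone_field n v x))"
proof -
  define W where "W = {x. zone_field n v x > 0}"
  have "continuous_on UNIV (zone_field n v)" by (rule Cinf_on_imp_continuous_on[OF Cinf_on_zone_field])
  then have W: "open W" unfolding W_def by (intro open_Collect_less continuous_on_const)
  have "Cinf_on (\<lambda>x. inverse (zone_field n v x)) W" unfolding Cinf_on_def
  proof
    fix k
    have "Ck_on k (zone_field n v) W" using Cinf_on_zone_field Ck_on_subset unfolding Cinf_on_def by blast
    then show "Ck_on k (\<lambda>x. inverse (zone_field n v x)) W" by (rule Ck_on_inverse) (simp add: W_def)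
  qed
  then show ?thesis
  proof (rule Ck_bound_compact[OF _ W])
    show "{1 / 4 ^ (2 * n + 2)..2 / 4 ^ (2 * n)} \<subseteq> W"
      using zone_field_pos[OF assms] by (auto simp: W_def)
    show "zone n \<subseteq> {1 / 4 ^ (2 * n + 2)..2 / 4 ^ (2 * n)}" by (auto simp: zone_def)
    show "open (zone n)" by (simp add: zone_def)
  qed simp
qed

section \<open>Oscillations and the choice of parameters\<close>

text \<open>An oscillation of frequency $q$ and amplitude $\<epsilon>$, switched on during the time interval $[a, a+1]$ and switched off during $[b-1, b]$.\<close>

definition wave :: "real \<Rightarrow> nat \<Rightarrow> real \<Rightarrow> real \<Rightarrow> real \<Rightarrow> real" where
  "wave \<epsilon> q a b s = \<epsilon> * (smooth_step (s - a) * smooth_step (b - s) * sin (2 * pi * real q * s))"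

lemma Ck_bound_sin_cos: "Ck_bound k 1 UNIV (sin :: real \<Rightarrow> real)" "Ck_bound k 1 UNIV (cos :: real \<Rightarrow> real)"
proof -
  have "Ck_bound k 1 UNIV (sin :: real \<Rightarrow> real) \<and> Ck_bound k 1 UNIV (cos :: real \<Rightarrow> real)" for k
  proof (induction k)
    case (Suc k)
    have m: "Ck_bound k 1 UNIV (\<lambda>x::real. - sin x)"
      using Ck_bound_cmult[of k 1 UNIV sin "-1"] Suc by simp
    have "Ck_bound (Suc k) 1 UNIV (sin :: real \<Rightarrow> real)"
      by (rule Ck_bound_SucI[of _ _ _ cos]) (use Suc DERIV_sin in simp_all)
    moreover have "Ck_bound (Suc k) 1 UNIV (cos :: real \<Rightarrow> real)"
      by (rule Ck_bound_SucI[of _ _ _ "\<lambda>x. - sin x"]) (use m DERIV_cos in simp_all)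
    ultimately show ?case ..
  qed simp
  then show "Ck_bound k 1 UNIV (sin :: real \<Rightarrow> real)" "Ck_bound k 1 UNIV (cos :: real \<Rightarrow> real)" by blast+
qed

lemma wave_bound:
  assumes "q \<ge> 1"
  shows "\<exists>M\<ge>0. \<forall>\<epsilon> a b. Ck_bound k (\<bar>\<epsilon>\<bar> * M) UNIV (wave \<epsilon> q a b)"
proof -
  obtain A B where A: "\<forall>b. Ck_bound k A UNIV (\<lambda>x. smooth_step (1 * x + b))"
    and B: "\<forall>b. Ck_bound k B UNIV (\<lambda>x. smooth_step ((-1) * x + b))"
    using Ck_bound_smooth_step_affine[of 1 k] Ck_bound_smooth_step_affine[of "-1" k] by auto
  have q: "1 \<le> \<bar>2 * pi * real q\<bar>"
  proof -
    have "1 * 1 \<le> (2 * pi) * real q" using assms pi_gt3 by (intro mult_mono) auto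
    then show ?thesis by simp
  qed
  define P where "P = \<bar>2 * pi * real q\<bar> ^ k * 1"
  have P: "Ck_bound k P UNIV (\<lambda>s. sin (2 * pi * real q * s + 0))"
    unfolding P_def by (rule Ck_bound_affine[OF Ck_bound_sin_cos(1) q])
  define M where "M = 2 ^ k * (2 ^ k * (A * B) * P)"
  have w: "Ck_bound k (\<bar>\<epsilon>\<bar> * M) UNIV (wave \<epsilon> q a b)" for \<epsilon> a b
  proof -
    have "Ck_bound k (\<bar>\<epsilon>\<bar> * M) UNIV (\<lambda>s. \<epsilon> * (smooth_step (1 * s + (- a)) * smooth_step ((-1) * s + b) * sin (2 * pi * real q * s + 0)))"
      unfolding M_def by (intro Ck_bound_cmult Ck_bound_mult A[rule_format] B[rule_format] P)
    then show ?thesis by (simp add: wave_def[abs_def])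
  qed
  moreover have "M \<ge> 0" using Ck_bound_abs[OF w[of 1 0 0], of 0] by simp
  ultimately show ?thesis by blast
qed

lemma Cinf_on_wave: "Cinf_on (wave \<epsilon> q a b) UNIV"
proof -
  have "Ck_on k sin (UNIV :: real set) \<and> Ck_on k cos (UNIV :: real set)" for k
  proof (induction k)
    case (Suc k)
    have 1: "\<forall>x\<in>UNIV. (sin has_real_derivative cos x) (at x within UNIV)" using DERIV_sin by simp
    have 2: "\<forall>x\<in>UNIV. (cos has_real_derivative - sin x) (at x within UNIV)" using DERIV_cos by simp
    have "Ck_on (Suc k) sin (UNIV :: real set)" unfolding Ck_on.simps using 1 Suc by blast
    moreover have "Ck_on (Suc k) cos (UNIV :: real set)" unfolding Ck_on.simps
      using 2 Ck_on_minus[of k sin UNIV] Suc by (intro exI[of _ "\<lambda>x. - sin x"]) simp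
    ultimately show ?case ..
  qed (auto intro: continuous_intros)
  then have "Cinf_on (sin :: real \<Rightarrow> real) UNIV" by (simp add: Cinf_on_def)
  then have 3: "Ck_on k (\<lambda>s. sin (2 * pi * real q * s)) UNIV" for k
    using Cinf_on_affine[of sin "2 * pi * real q" 0] by (simp add: Cinf_on_def)
  have 1: "Ck_on k (\<lambda>s. smooth_step (s - a)) UNIV" for k
    using Cinf_on_affine[OF Cinf_on_smooth_step, of 1 "-a"] by (simp add: Cinf_on_def)
  have 2: "Ck_on k (\<lambda>s. smooth_step (b - s)) UNIV" for k
    using Cinf_on_affine[OF Cinf_on_smooth_step, of "-1" b] by (simp add: Cinf_on_def)
  show ?thesis unfolding wave_def[abs_def] Cinf_on_def
    by (intro allI Ck_on_cmult Ck_on_mult 1 2 3)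
qed

text \<open>What the choices for the $n$-th zone have to achieve for the frequency $q$. The wave is small in $C^{n+2}$. The last but one clause concerns the switching times, which fall into fast stretches: there any phase shift is small because the amplitude is. The last clause concerns the whole zone, including the slow stretch: there a phase shift is small if the time is very close to one after which the wave repeats itself. The inequality between $v$ and $\<epsilon>$ makes the time-one-half map rough. All clauses are uniform in the switching times, and hence refer to this zone only.\<close>

definition zone_step :: "nat \<Rightarrow> nat \<Rightarrow> real \<Rightarrow> real \<Rightarrow> real \<Rightarrow> bool" where
  "zone_step n q \<epsilon> v \<delta> \<longleftrightarrow> 0 < \<epsilon> \<and> 4 * real q * \<epsilon> \<le> 1 \<and> 0 < v \<and> v \<le> cap (2 * n + 1) \<and>
     (real n + 1) * v \<le> \<epsilon> \<and> 0 < \<delta> \<and> \<delta> \<le> 1 \<and>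
     (\<forall>a b. Ck_bound (n + 2) ((1/2) ^ (n + 1)) UNIV (wave \<epsilon> q a b)) \<and>
     (\<forall>a b U \<sigma> j t. j \<in> {2 * n, 2 * n + 2} \<longrightarrow>
        (\<forall>x\<in>U. (\<sigma> has_real_derivative
            inverse (1 + deriv (wave \<epsilon> q a b) (\<sigma> x)) * inverse (cap j)) (at x)) \<longrightarrow>
        Ck_bound n ((1/2) ^ n) U (\<lambda>x. wave \<epsilon> q a b (\<sigma> x + t) - wave \<epsilon> q a b (\<sigma> x))) \<and>
     (\<forall>a b U \<sigma> t r. U \<subseteq> zone n \<longrightarrow> \<bar>t - r\<bar> \<le> \<delta> \<longrightarrow>
        (\<forall>x\<in>U. (\<sigma> has_real_derivative
            inverse (1 + deriv (wave \<epsilon> q a b) (\<sigma> x)) * inverse (zone_field n v x)) (at x)) \<longrightarrow>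
        Ck_bound n ((1/2) ^ n) U (\<lambda>x. wave \<epsilon> q a b (\<sigma> x + t) - wave \<epsilon> q a b (\<sigma> x + r)))"

text \<open>The order of the choices is essential: the amplitude $\<epsilon>$ depends on $q$ and on the fast speeds, the slow speed $v$ on $\<epsilon>$, and the tolerance $\<delta>$ on all of these. The frequency of the next zone can afterwards be taken so large that it suits $\<delta>$.\<close>

lemma zone_step_exists:
  assumes q: "q \<ge> 1"
  shows "\<exists>\<epsilon> v \<delta>. zone_step n q \<epsilon> v \<delta>"
proof -
  obtain M where M: "M \<ge> 0" "\<And>\<epsilon> a b. Ck_bound (n + 2) (\<bar>\<epsilon>\<bar> * M) UNIV (wave \<epsilon> q a b)"
    using wave_bound[OF q] by metis
  obtain Bm where Bm: "\<And>U f. Ck_bound n 2 U f \<Longrightarrow> (\<forall>x\<in>U. 1/2 \<le> f x) \<Longrightarrow> Ck_bound n Bm U (\<lambda>x. inverse (f x))"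
    using Ck_bound_inverse[of 2 n] by auto
  define B1 where "B1 = \<bar>Bm\<bar> + \<bar>inverse (cap (2 * n))\<bar> + \<bar>inverse (cap (2 * n + 2))\<bar>"
  have B1: "B1 \<ge> 0" "Bm \<le> B1" "\<bar>inverse (cap (2 * n))\<bar> \<le> B1" "\<bar>inverse (cap (2 * n + 2))\<bar> \<le> B1"
    unfolding B1_def by linarith+
  obtain C1 where C1: "C1 \<ge> 0" "\<And>U \<sigma> m \<rho> J b. Ck_bound n B1 UNIV m \<Longrightarrow> Ck_bound n B1 U \<rho> \<Longrightarrow>
     (\<forall>x\<in>U. (\<sigma> has_real_derivative m (\<sigma> x) * \<rho> x) (at x)) \<Longrightarrow> Ck_bound n b UNIV J \<Longrightarrow>
     Ck_bound n (C1 * b) U (\<lambda>x. J (\<sigma> x))"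
    using Ck_bound_along_solution[OF B1(1), of n] by metis
  \<comment> \<open>The factor $4q$ keeps the displacement by the wave below a quarter of a period, $1 + M$ makes it small in $C^{n+2}$, and $1 + C_1$ makes its effect on the fast stretches small.\<close>
  define \<epsilon> where "\<epsilon> = (1/2) ^ (n + 1) / (4 * real q * (1 + M) * (1 + C1))"
  have den: "4 * real q * (1 + M) * (1 + C1) \<ge> 4" 
  proof -
    have "1 * 1 * 1 \<le> real q * (1 + M) * (1 + C1)" using q M C1 by (intro mult_mono) auto
    then show ?thesis by simp
  qed
  then have d0: "4 * real q * (1 + M) * (1 + C1) > 0" by linarith
  then have d0': "4 * real q * (1 + M) * (1 + C1) \<noteq> 0" by linarith
  have \<epsilon>0: "\<epsilon> > 0" unfolding \<epsilon>_def by (intro divide_pos_pos d0) simp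
  have prod: "\<epsilon> * (4 * real q * (1 + M) * (1 + C1)) = (1/2) ^ (n + 1)"
    using \<epsilon>_def by (simp only: nonzero_eq_divide_eq[OF d0'])
  have le1: "(1/2::real) ^ (n + 1) \<le> 1" by (rule power_le_one) auto
  have \<epsilon>q: "4 * real q * \<epsilon> \<le> 1"
  proof -
    have "4 * real q * \<epsilon> * 1 \<le> 4 * real q * \<epsilon> * ((1 + M) * (1 + C1))"
      using \<epsilon>0 q M C1 mult_mono[of 1 "1 + M" 1 "1 + C1"] by (intro mult_left_mono) auto
    also have "\<dots> = \<epsilon> * (4 * real q * (1 + M) * (1 + C1))" by (simp only: mult_ac)
    also have "\<dots> \<le> 1" using prod le1 by (simp only:)
    finally show ?thesis by simp
  qed
  have \<epsilon>M: "\<epsilon> * M \<le> (1/2) ^ (n + 1) / 4 / (1 + C1)"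
  proof -
    have "\<epsilon> * M * (1 + C1) * 4 \<le> \<epsilon> * (1 + M) * (1 + C1) * 4 * real q"
    proof -
      have "\<epsilon> * M * (1 + C1) * 4 * 1 \<le> \<epsilon> * (1 + M) * (1 + C1) * 4 * real q"
        using \<epsilon>0 q M C1 by (intro mult_mono) auto
      then show ?thesis by simp
    qed
    also have "\<dots> = \<epsilon> * (4 * real q * (1 + M) * (1 + C1))" by (simp only: mult_ac)
    also have "\<dots> = (1/2) ^ (n + 1)" by (rule prod)
    finally have "\<epsilon> * M * (1 + C1) * 4 \<le> (1/2) ^ (n + 1)" .
    then have "\<epsilon> * M * (1 + C1) \<le> (1/2) ^ (n + 1) / 4" by simp
    moreover have "0 < 1 + C1" using C1(1) by linarith
    ultimately show ?thesis by (simp only: pos_le_divide_eq)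
  qed
  have \<epsilon>M1: "\<epsilon> * M \<le> (1/2) ^ (n + 1)"
  proof -
    have "(1/2::real) ^ (n + 1) / 4 / (1 + C1) \<le> (1/2) ^ (n + 1) / 1 / 1"
      using C1 by (intro frac_le) auto
    then show ?thesis using \<epsilon>M by (simp only: div_by_1)
  qed
  have \<epsilon>C: "C1 * (\<epsilon> * M + \<epsilon> * M) \<le> (1/2) ^ n"
  proof -
    have "C1 * (\<epsilon> * M + \<epsilon> * M) \<le> (1 + C1) * (\<epsilon> * M + \<epsilon> * M)"
      using C1 \<epsilon>0 M by (intro mult_right_mono) auto
    also have "\<dots> \<le> (1 + C1) * ((1/2) ^ (n + 1) / 4 / (1 + C1) + (1/2) ^ (n + 1) / 4 / (1 + C1))"
      using \<epsilon>M C1 by (intro mult_left_mono add_mono) auto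
    also have "\<dots> = (1/2) ^ n / 4"
    proof -
      have "1 + C1 \<noteq> 0" using C1(1) by linarith
      then have "(1 + C1) * (y / (1 + C1)) = y" for y by (rule nonzero_mult_div_cancel_left[of "1 + C1", folded times_divide_eq_right])
      then have "(1 + C1) * (x / 4 / (1 + C1) + x / 4 / (1 + C1)) = x / 4 + x / 4" for x :: real
        by (simp only: distrib_left)
      from this[of "(1/2) ^ (n + 1)"] show ?thesis by (rule trans) simp
    qed
    also have "\<dots> \<le> (1/2) ^ n" by simp
    finally show ?thesis .
  qed
  define v where "v = min (cap (2 * n + 1)) (\<epsilon> / (real n + 1))"
  have v: "v > 0" "v \<le> cap (2 * n + 1)" using \<epsilon>0 cap_pos by (auto simp: v_def)
  have nv: "(real n + 1) * v \<le> \<epsilon>"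
  proof -
    have "(real n + 1) * v \<le> (real n + 1) * (\<epsilon> / (real n + 1))" by (intro mult_left_mono) (auto simp: v_def)
    then show ?thesis by simp
  qed
  obtain R where R: "R \<ge> 0" "Ck_bound n R (zone n) (\<lambda>x. inverse (zone_field n v x))"
    using zone_field_inverse_bound[OF v(1)] by metis
  define B2 where "B2 = \<bar>Bm\<bar> + R"
  have B2: "B2 \<ge> 0" using R by (simp add: B2_def)
  obtain C2 where C2: "C2 \<ge> 0" "\<And>U \<sigma> m \<rho> J b. Ck_bound n B2 UNIV m \<Longrightarrow> Ck_bound n B2 U \<rho> \<Longrightarrow>
     (\<forall>x\<in>U. (\<sigma> has_real_derivative m (\<sigma> x) * \<rho> x) (at x)) \<Longrightarrow> Ck_bound n b UNIV J \<Longrightarrow>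
     Ck_bound n (C2 * b) U (\<lambda>x. J (\<sigma> x))"
    using Ck_bound_along_solution[OF B2, of n] by metis
  define \<delta> where "\<delta> = (1/2) ^ n / (1 + C2)"
  have \<delta>: "\<delta> > 0" "\<delta> \<le> 1" "C2 * \<delta> \<le> (1/2) ^ n"
  proof -
    show "\<delta> > 0" using C2 by (simp add: \<delta>_def)
    have "(1/2::real) ^ n \<le> 1" by (simp add: power_le_one)
    then show "\<delta> \<le> 1" using C2 by (simp add: \<delta>_def divide_le_eq)
    have "C2 * \<delta> \<le> (1 + C2) * \<delta>" using \<open>\<delta> > 0\<close> by simp
    also have "\<dots> = (1/2) ^ n" using C2 by (simp add: \<delta>_def)
    finally show "C2 * \<delta> \<le> (1/2) ^ n" .
  qed
  have h: "Ck_bound (n + 2) (\<epsilon> * M) UNIV (wave \<epsilon> q a b)" for a b using M(2)[of \<epsilon>] \<epsilon>0 by simp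
  have h2: "Ck_bound (n + 2) ((1/2) ^ (n + 1)) UNIV (wave \<epsilon> q a b)" for a b
    by (rule Ck_bound_mono[OF h \<epsilon>M1]) simp
  have m: "Ck_bound n Bm UNIV (\<lambda>s. inverse (1 + deriv (wave \<epsilon> q a b) s))" for a b
  proof (rule Bm)
    have "Ck_bound (Suc (n + 1)) ((1/2) ^ (n + 1)) UNIV (wave \<epsilon> q a b)" using h2 by simp
    then have "Ck_bound (n + 1) ((1/2) ^ (n + 1)) UNIV (deriv (wave \<epsilon> q a b))"
      by (rule Ck_bound_deriv[OF open_UNIV])
    then have d: "Ck_bound n ((1/2) ^ (n + 1)) UNIV (deriv (wave \<epsilon> q a b))"
      by (rule Ck_bound_le) simp
    have l2: "(1/2::real) ^ (n + 1) \<le> 1/2" using power_le_one[of "1/2::real" n] by simp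
    have "Ck_bound n (\<bar>1\<bar> + (1/2) ^ (n + 1)) UNIV (\<lambda>s. 1 + deriv (wave \<epsilon> q a b) s)"
      by (intro Ck_bound_add Ck_bound_const d)
    then show "Ck_bound n 2 UNIV (\<lambda>s. 1 + deriv (wave \<epsilon> q a b) s)"
      by (rule Ck_bound_mono) (use l2 in auto)
    have "1/2 \<le> 1 + deriv (wave \<epsilon> q a b) s" for s
      using Ck_bound_abs[OF d, of s] l2 by auto
    then show "\<forall>s\<in>UNIV. 1/2 \<le> 1 + deriv (wave \<epsilon> q a b) s" by simp
  qed
  have m1: "Ck_bound n B1 UNIV (\<lambda>s. inverse (1 + deriv (wave \<epsilon> q a b) s))" for a b
    by (rule Ck_bound_mono[OF m B1(2)]) simp
  have m2: "Ck_bound n B2 UNIV (\<lambda>s. inverse (1 + deriv (wave \<epsilon> q a b) s))" for a b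
    by (rule Ck_bound_mono[OF m]) (use R in \<open>auto simp: B2_def\<close>)
  have c1: "Ck_bound n ((1/2) ^ n) U (\<lambda>x. wave \<epsilon> q a b (\<sigma> x + t) - wave \<epsilon> q a b (\<sigma> x))"
    if j: "j \<in> {2 * n, 2 * n + 2}" and \<sigma>: "\<forall>x\<in>U. (\<sigma> has_real_derivative
            inverse (1 + deriv (wave \<epsilon> q a b) (\<sigma> x)) * inverse (cap j)) (at x)"
    for a b U \<sigma> j t
  proof -
    have \<rho>: "Ck_bound n B1 U (\<lambda>x. inverse (cap j))"
    proof (rule Ck_bound_mono[OF Ck_bound_const _ subset_refl])
      show "\<bar>inverse (cap j)\<bar> \<le> B1" using j B1(3,4) by blast
    qed
    have hn: "Ck_bound n (\<epsilon> * M) UNIV (wave \<epsilon> q a b)" by (rule Ck_bound_le[OF h]) simp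
    have "Ck_bound n (\<epsilon> * M + \<epsilon> * M) UNIV (\<lambda>s. wave \<epsilon> q a b (s + t) - wave \<epsilon> q a b s)"
      by (intro Ck_bound_diff Ck_bound_shift hn)
    from C1(2)[OF m1 \<rho> \<sigma> this] show ?thesis by (rule Ck_bound_mono[OF _ \<epsilon>C subset_refl])
  qed
  have c2: "Ck_bound n ((1/2) ^ n) U (\<lambda>x. wave \<epsilon> q a b (\<sigma> x + t) - wave \<epsilon> q a b (\<sigma> x + r))"
    if U: "U \<subseteq> zone n" and tr: "\<bar>t - r\<bar> \<le> \<delta>" and \<sigma>: "\<forall>x\<in>U. (\<sigma> has_real_derivative
            inverse (1 + deriv (wave \<epsilon> q a b) (\<sigma> x)) * inverse (zone_field n v x)) (at x)"
    for a b U \<sigma> t r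
  proof -
    have \<rho>: "Ck_bound n B2 U (\<lambda>x. inverse (zone_field n v x))"
      by (rule Ck_bound_mono[OF R(2) _ U]) (simp add: B2_def)
    have hn: "Ck_bound (Suc n) ((1/2) ^ (n + 1)) UNIV (wave \<epsilon> q a b)" by (rule Ck_bound_le[OF h2]) simp
    have "\<bar>t - r\<bar> * (1/2) ^ (n + 1) \<le> \<delta> * 1"
      using tr le1 by (intro mult_mono) auto
    then have "Ck_bound n \<delta> UNIV (\<lambda>s. wave \<epsilon> q a b (s + t) - wave \<epsilon> q a b (s + r))"
      by (intro Ck_bound_mono[OF Ck_bound_translate_diff[OF hn]]) auto
    from C2(2)[OF m2 \<rho> \<sigma> this] show ?thesis by (rule Ck_bound_mono[OF _ \<delta>(3) subset_refl])
  qed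
  have "zone_step n q \<epsilon> v \<delta>"
    unfolding zone_step_def
    by (intro conjI allI impI)
       (rule \<epsilon>0 \<epsilon>q v nv \<delta>(1,2) h2 | (rule c1; assumption) | (rule c2; assumption))+
  then show ?thesis by blast
qed

text \<open>The frequencies are powers of three, hence odd, and $3 \cdot 3^{-m(n+1)}$, which bounds the tails of the ternary expansions considered below, is at most the tolerance of the $n$-th zone.\<close>

lemma parameters_exist:
  obtains m :: "nat \<Rightarrow> nat" and \<epsilon> \<delta> c :: "nat \<Rightarrow> real"
  where "m 0 \<ge> 1" "\<And>n. m (Suc n) > m n + n" "\<And>n. 3 / 3 ^ m (Suc n) \<le> \<delta> n" "admissible c"
    "\<And>n. c (2 * n) = cap (2 * n)" "\<And>n. zone_step n (3 ^ m n) (\<epsilon> n) (c (2 * n + 1)) (\<delta> n)"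
proof -
  have "\<exists>E V D. zone_step n (3 ^ k) E V D" for n k by (rule zone_step_exists) simp
  then obtain E V D where step: "\<And>n k. zone_step n (3 ^ k) (E n k) (V n k) (D n k)" by metis
  have "\<exists>m. \<forall>n. 1 \<le> m n \<and> (m n + n < m (Suc n) \<and> 3 / 3 ^ m (Suc n) \<le> D n (m n))"
  proof (rule dependent_nat_choice)
    show "\<exists>x::nat. 1 \<le> x" by blast
    fix x n :: nat assume "1 \<le> x"
    have "D n x > 0" using step[of n x] by (simp add: zone_step_def)
    then obtain k where "(1/3) ^ k < D n x / 3" using real_arch_pow_inv[of "D n x / 3" "1/3"] by auto
    moreover have "(1/3::real) ^ (k + x + n + 1) \<le> (1/3) ^ k" by (intro power_decreasing) auto
    moreover have "3 / 3 ^ N = 3 * (1/3::real) ^ N" for N by (simp add: power_one_over)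
    ultimately have "3 / 3 ^ (k + x + n + 1) \<le> D n x" by (simp only:)
    then show "\<exists>y. 1 \<le> y \<and> (x + n < y \<and> 3 / 3 ^ y \<le> D n x)"
      by (intro exI[of _ "k + x + n + 1"]) simp
  qed
  then obtain m where m: "\<And>n. 1 \<le> m n" "\<And>n. m n + n < m (Suc n)" "\<And>n. 3 / 3 ^ m (Suc n) \<le> D n (m n)"
    by blast
  define c where "c j = (if even j then cap j else V (j div 2) (m (j div 2)))" for j
  have c1: "c (2 * n + 1) = V n (m n)" for n by (simp add: c_def)
  have "0 < c j \<and> c j \<le> cap j" for j
  proof (cases "even j")
    case True then show ?thesis using cap_pos by (simp add: c_def)
  next
    case False
    then obtain n where "j = 2 * n + 1" by (rule oddE)
    then show ?thesis using step[of n "m n"] c1[of n] by (simp add: zone_step_def)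
  qed
  then have adm: "admissible c" by (simp add: admissible_def)
  have c0: "c (2 * n) = cap (2 * n)" for n by (simp add: c_def)
  have st: "zone_step n (3 ^ m n) (E n (m n)) (c (2 * n + 1)) (D n (m n))" for n
    unfolding c1 by (rule step)
  show ?thesis by (rule that[OF m(1) m(2) m(3) adm c0 st])
qed

section \<open>The perturbed vector field\<close>

lemma zone_stepD:
  assumes "zone_step n q \<epsilon> v \<delta>"
  shows "0 < \<epsilon>" "4 * real q * \<epsilon> \<le> 1" "(real n + 1) * v \<le> \<epsilon>" "\<delta> \<le> 1"
    and "Ck_bound (n + 2) ((1/2) ^ (n + 1)) UNIV (wave \<epsilon> q a b)"
proof -
  note * = assms[unfolded zone_step_def]
  show "0 < \<epsilon>" using * by (elim conjE)
  show "4 * real q * \<epsilon> \<le> 1" using * by (elim conjE)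
  show "(real n + 1) * v \<le> \<epsilon>" using * by (elim conjE)
  show "\<delta> \<le> 1" using * by (elim conjE)
  have "\<forall>a b. Ck_bound (n + 2) ((1/2) ^ (n + 1)) UNIV (wave \<epsilon> q a b)" using * by (elim conjE)
  then show "Ck_bound (n + 2) ((1/2) ^ (n + 1)) UNIV (wave \<epsilon> q a b)" by blast
qed

lemma zone_step_fast:
  assumes "zone_step n q \<epsilon> v \<delta>" "j \<in> {2 * n, 2 * n + 2}"
    "\<forall>x\<in>U. (\<sigma> has_real_derivative inverse (1 + deriv (wave \<epsilon> q a b) (\<sigma> x)) * inverse (cap j)) (at x)"
  shows "Ck_bound n ((1/2) ^ n) U (\<lambda>x. wave \<epsilon> q a b (\<sigma> x + t) - wave \<epsilon> q a b (\<sigma> x))"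
  by (rule assms(1)[unfolded zone_step_def, THEN conjunct2, THEN conjunct2, THEN conjunct2, THEN conjunct2,
      THEN conjunct2, THEN conjunct2, THEN conjunct2, THEN conjunct2, THEN conjunct1, THEN spec, THEN spec,
      THEN spec, THEN spec, THEN spec, THEN spec, THEN mp, THEN mp, OF assms(2,3)])

lemma zone_step_near:
  assumes "zone_step n q \<epsilon> v \<delta>" "U \<subseteq> zone n" "\<bar>t - r\<bar> \<le> \<delta>"
    "\<forall>x\<in>U. (\<sigma> has_real_derivative inverse (1 + deriv (wave \<epsilon> q a b) (\<sigma> x)) * inverse (zone_field n v x)) (at x)"
  shows "Ck_bound n ((1/2) ^ n) U (\<lambda>x. wave \<epsilon> q a b (\<sigma> x + t) - wave \<epsilon> q a b (\<sigma> x + r))"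
  by (rule assms(1)[unfolded zone_step_def, THEN conjunct2, THEN conjunct2, THEN conjunct2, THEN conjunct2,
      THEN conjunct2, THEN conjunct2, THEN conjunct2, THEN conjunct2, THEN conjunct2, THEN spec, THEN spec,
      THEN spec, THEN spec, THEN spec, THEN spec, THEN mp, THEN mp, THEN mp, OF assms(2-4)])

lemma higher_deriv_cong_open:
  fixes f g :: "real \<Rightarrow> real"
  assumes "open U" "\<And>x. x \<in> U \<Longrightarrow> f x = g x" "x \<in> U"
  shows "(deriv ^^ k) f x = (deriv ^^ k) g x"
  using assms(3)
proof (induction k arbitrary: x)
  case 0 then show ?case using assms by simp
next
  case (Suc k)
  have "eventually (\<lambda>y. (deriv ^^ k) f y = (deriv ^^ k) g y) (nhds x)"
    using eventually_nhds_in_open[OF assms(1) Suc.prems] by (rule eventually_mono) (rule Suc.IH)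
  then show ?case by (simp add: deriv_cong_ev)
qed

text \<open>The exponents $m$, amplitudes $\<epsilon>$, tolerances $\<delta>$ and speeds $c$ are those of \<open>parameters_exist\<close>.\<close>

locale construction =
  fixes m :: "nat \<Rightarrow> nat" and \<epsilon> \<delta> c :: "nat \<Rightarrow> real" and \<sigma>0 \<psi>0 :: "real \<Rightarrow> real"
  assumes adm: "admissible c" and c_even: "\<And>n. c (2 * n) = cap (2 * n)"
    and step: "\<And>n. zone_step n (3 ^ m n) (\<epsilon> n) (c (2 * n + 1)) (\<delta> n)"
    and flat: "flat_field (base_field c) \<sigma>0 \<psi>0"
begin

sublocale flat_field "base_field c" \<sigma>0 \<psi>0 by (rule flat)

text \<open>The time at which the integral curve of the base field enters the stretch of speed $c_j$. Time increases with $x$, so that these times decrease to $-\<infinity>$.\<close>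

definition S :: "nat \<Rightarrow> real" where "S j = \<sigma>0 (1 / 4 ^ j)"
text \<open>The $n$-th wave is switched on from time $\<alpha>_{n+1}$ and is off again at time $\<gamma>_n$. Both times lie in fast stretches, $\<gamma>_n$ slightly earlier than $\<alpha>_n$, so that different waves do not overlap and are separated by pauses of length $4$.\<close>

definition \<alpha> :: "nat \<Rightarrow> real" where "\<alpha> n = S (2 * n) + 10"
definition \<gamma> :: "nat \<Rightarrow> real" where "\<gamma> n = S (2 * n) + 6"
definition h :: "nat \<Rightarrow> real \<Rightarrow> real" where "h n = wave (\<epsilon> n) (3 ^ m n) (\<alpha> (Suc n)) (\<gamma> n)"
definition H :: "real \<Rightarrow> real" where "H s = (\<Sum>n. h n s)"

lemma \<sigma>0_plateau:
  assumes "1 / 4 ^ j \<le> x" "x \<le> 2 / 4 ^ j"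
  shows "\<sigma>0 x = S j + (x - 1 / 4 ^ j) / c j"
proof (cases "x = 1 / 4 ^ j")
  case True then show ?thesis by (simp add: S_def)
next
  case False
  then have lt: "1 / 4 ^ j < x" using assms by simp
  have p: "(0::real) < 1 / 4 ^ j" by simp
  have "(\<sigma>0 has_real_derivative inverse (base_field c z)) (at z)" if "1 / 4 ^ j \<le> z" for z
    using \<sigma>0_DERIV[of z] p that by linarith
  then obtain z where z: "1 / 4 ^ j < z" "z < x" "\<sigma>0 x - \<sigma>0 (1 / 4 ^ j) = (x - 1 / 4 ^ j) * inverse (base_field c z)"
    using MVT2[OF lt, of \<sigma>0 "\<lambda>z. inverse (base_field c z)"] by blast
  have "base_field c z = c j" using z assms by (intro base_field_plateau[OF adm]) auto
  then show ?thesis using z(3) by (simp add: S_def divide_inverse)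
qed

lemma c_gt0: "c j > 0" using adm by (simp add: admissible_def)

lemma plateau_long: "16 * c j \<le> 1 / 4 ^ j"
proof -
  have "c j \<le> 1 / 4 ^ (j\<^sup>2 + 2)" using adm by (simp add: admissible_def cap_def)
  also have "\<dots> \<le> 1 / 4 ^ (j + 2)"
    by (intro divide_left_mono power_increasing) (auto simp: power2_eq_square)
  finally show ?thesis by (simp add: field_simps)
qed

lemma \<psi>0_plateau:
  assumes "S j \<le> s" "s \<le> S j + 16"
  shows "\<psi>0 s = 1 / 4 ^ j + c j * (s - S j)" "1 / 4 ^ j \<le> \<psi>0 s" "\<psi>0 s \<le> 2 / 4 ^ j"
proof -
  define x where "x = 1 / 4 ^ j + c j * (s - S j)"
  have "c j * (s - S j) \<le> c j * 16" using assms c_gt0[of j] by (intro mult_left_mono) auto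
  moreover have "2 / 4 ^ j = 1 / 4 ^ j + (1::real) / 4 ^ j" by simp
  moreover have "c j * (s - S j) \<ge> 0" using assms c_gt0[of j] by simp
  ultimately have x: "1 / 4 ^ j \<le> x" "x \<le> 2 / 4 ^ j"
    using plateau_long[of j] unfolding x_def by linarith+
  have "(0::real) < 1 / 4 ^ j" by simp
  then have "x > 0" using x by linarith
  moreover have "\<sigma>0 x = s" using \<sigma>0_plateau[OF x] c_gt0[of j] by (simp add: x_def)
  ultimately have "\<psi>0 s = x" using \<psi>0_\<sigma>0 by blast
  then show "\<psi>0 s = 1 / 4 ^ j + c j * (s - S j)" "1 / 4 ^ j \<le> \<psi>0 s" "\<psi>0 s \<le> 2 / 4 ^ j"
    using x by (auto simp: x_def)
qed

lemma S_Suc: "S (Suc j) + 16 \<le> S j"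
proof -
  have "\<psi>0 (S (Suc j) + 16) \<le> 2 / 4 ^ Suc j" by (rule \<psi>0_plateau(3)) auto
  also have "\<dots> < 1 / 4 ^ j" by (simp add: field_simps)
  also have "\<dots> = \<psi>0 (S j)" by (simp add: S_def \<psi>0_\<sigma>0)
  finally show ?thesis by (simp add: \<psi>0_less_iff less_imp_le)
qed

lemma S_le: "i \<le> j \<Longrightarrow> S j + 16 * real (j - i) \<le> S i"
proof (induction j)
  case (Suc j)
  show ?case
  proof (cases "i = Suc j")
    case False
    then have "S j + 16 * real (j - i) \<le> S i" "Suc j - i = Suc (j - i)" using Suc by auto
    then show ?thesis using S_Suc[of j] by simp
  qed simp
qed simp

lemma S_antimono: "i \<le> j \<Longrightarrow> S j \<le> S i"
  using S_le[of i j] by (simp add: order_trans[rotated])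

lemma \<alpha>_antimono: "i \<le> j \<Longrightarrow> \<alpha> j \<le> \<alpha> i" and \<gamma>_antimono: "i \<le> j \<Longrightarrow> \<gamma> j \<le> \<gamma> i"
  by (auto simp: \<alpha>_def \<gamma>_def intro!: S_antimono)

lemma h_zero: "s \<le> \<alpha> (Suc n) \<or> \<gamma> n \<le> s \<Longrightarrow> h n s = 0"
  by (auto simp: h_def wave_def smooth_step_simps)

lemma H_local:
  assumes "\<gamma> (Suc n) < s" "s < \<alpha> n"
  shows "H s = h n s"
proof -
  have "h i s = 0" if "i \<noteq> n" for i
  proof (cases "n < i")
    case True then show ?thesis using \<gamma>_antimono[of "Suc n" i] assms by (intro h_zero) auto
  next
    case False then show ?thesis using \<alpha>_antimono[of "Suc i" n] assms that by (intro h_zero) auto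
  qed
  then have "(\<Sum>i. h i s) = (\<Sum>i\<in>{n}. h i s)" by (intro suminf_finite) auto
  then show ?thesis by (simp add: H_def)
qed

lemma H_beyond: "\<gamma> 0 \<le> s \<Longrightarrow> H s = 0"
  using \<gamma>_antimono[of 0] h_zero by (simp add: H_def order_trans[of _ "\<gamma> 0"])

lemma \<gamma>_unbounded: "\<exists>n. \<gamma> n < s"
proof -
  obtain n where n: "(S 0 + 6 - s) / 16 < real n" using reals_Archimedean2 by blast
  have "S (2 * n) + 16 * real (2 * n) \<le> S 0" using S_le[of 0 "2 * n"] by simp
  then have "\<gamma> n < s" using n by (simp add: \<gamma>_def field_simps)
  then show ?thesis ..
qed

text \<open>The pauses between consecutive waves make the zones overlap, even after they have been shrunk by up to one unit of time at each end.\<close>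

lemma zones_cover:
  assumes "s < \<alpha> N - d" "0 \<le> d" "d \<le> 1"
  shows "\<exists>n\<ge>N. \<gamma> (Suc n) + d < s \<and> s < \<alpha> n - d"
proof -
  obtain k where k: "\<gamma> k < s - d" using \<gamma>_unbounded by blast
  have "\<gamma> (Suc (max k N)) \<le> \<gamma> k" by (rule \<gamma>_antimono) simp
  then have ex: "\<exists>n. N \<le> n \<and> \<gamma> (Suc n) + d < s"
    using k by (intro exI[of _ "max k N"]) simp
  \<comment> \<open>If the least such $n$ exceeds $N$, minimality gives $s \le \<gamma>_n + d$, which is below $\<alpha>_n - d$ because $2d \le 2 < 4$.\<close>
  define n where "n = (LEAST n. N \<le> n \<and> \<gamma> (Suc n) + d < s)"
  have n: "N \<le> n" "\<gamma> (Suc n) + d < s" using LeastI_ex[OF ex] by (auto simp: n_def)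
  have "s < \<alpha> n - d"
  proof (cases "n = N")
    case False
    then obtain i where i: "n = Suc i" "N \<le> i" using n by (cases n) auto
    have "\<not> (N \<le> i \<and> \<gamma> (Suc i) + d < s)" 
      using not_less_Least[of i "\<lambda>n. N \<le> n \<and> \<gamma> (Suc n) + d < s"] i(1) unfolding n_def[symmetric] by simp
    then have "s \<le> \<gamma> n + d" using i by auto
    then show ?thesis using assms(2,3) by (simp add: \<alpha>_def \<gamma>_def)
  qed (use assms in simp)
  then show ?thesis using n by blast
qed

lemma h_bound: "Ck_bound (n + 2) ((1/2) ^ (n + 1)) UNIV (h n)"
  unfolding h_def by (rule zone_stepD(5)[OF step])

lemma Cinf_on_h: "Cinf_on (h n) UNIV" unfolding h_def by (rule Cinf_on_wave)

lemma Cinf_on_H: "Cinf_on H UNIV"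
proof -
  have "\<exists>M. summable M \<and> (\<forall>n x. \<bar>(deriv ^^ k) (h n) x\<bar> \<le> M n)" for k
  proof -
    have "\<exists>B. \<forall>x. \<bar>(deriv ^^ k) (h n) x\<bar> \<le> B" for n
    proof -
      have q: "(3::nat) ^ m n \<ge> 1" by simp
      obtain M where "Ck_bound k M UNIV (h n)"
        using wave_bound[OF q, of k] unfolding h_def by blast
      then show ?thesis using Ck_bound_higher_deriv[of UNIV k M "h n" k] by auto
    qed
    then obtain B where B: "\<And>n x. \<bar>(deriv ^^ k) (h n) x\<bar> \<le> B n" by metis
    define M where "M n = (if n < k then B n else (1/2) ^ (n + 1))" for n
    have ev: "eventually (\<lambda>n. M n = (1/2) ^ (n + 1)) sequentially"
      unfolding eventually_sequentially by (intro exI[of _ k]) (simp add: M_def)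
    have "summable M" unfolding summable_cong[OF ev] by (simp add: summable_geometric)
    moreover have "\<bar>(deriv ^^ k) (h n) x\<bar> \<le> M n" for n x
      using B[of n x] Ck_bound_higher_deriv[OF open_UNIV h_bound[of n], of k x] by (simp add: M_def)
    ultimately show ?thesis by blast
  qed
  then have "Cinf_on (\<lambda>s. \<Sum>n. h n s) UNIV" by (intro Cinf_on_series Cinf_on_h)
  then show ?thesis by (simp add: H_def[abs_def])
qed

lemma H_deriv_local:
  assumes "\<gamma> (Suc n) < s" "s < \<alpha> n"
  shows "(deriv ^^ k) H s = (deriv ^^ k) (h n) s"
  by (rule higher_deriv_cong_open[of "{\<gamma> (Suc n)<..<\<alpha> n}"]) (use assms H_local in auto)

lemma H_deriv_small:
  assumes "s < \<alpha> N" "k \<le> 2"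
  shows "\<bar>(deriv ^^ k) H s\<bar> \<le> (1/2) ^ (N + 1)"
proof -
  obtain n where n: "n \<ge> N" "\<gamma> (Suc n) < s" "s < \<alpha> n" using zones_cover[of s N 0] assms by auto
  have "\<bar>(deriv ^^ k) H s\<bar> \<le> (1/2) ^ (n + 1)"
    unfolding H_deriv_local[OF n(2,3)] using assms(2)
    by (intro Ck_bound_higher_deriv[OF open_UNIV h_bound]) auto
  also have "\<dots> \<le> (1/2) ^ (N + 1)" using n(1) by (intro power_decreasing) auto
  finally show ?thesis .
qed

text \<open>For $s \ge \<alpha>_0$ no wave is active.\<close>

lemma H_derivs_le_half:
  assumes "k \<le> 2"
  shows "\<bar>(deriv ^^ k) H s\<bar> \<le> 1/2"
proof (cases "s < \<alpha> 0")
  case True then show ?thesis using H_deriv_small[OF _ assms, of s 0] by simp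
next
  case False
  have "(deriv ^^ k) H s = (deriv ^^ k) (\<lambda>s. 0) s"
    by (rule higher_deriv_cong_open[of "{\<gamma> 0<..}"]) (use False H_beyond in \<open>auto simp: \<alpha>_def \<gamma>_def\<close>)
  also have "(deriv ^^ k) (\<lambda>s. 0) s = (0::real)"
    using Ck_bound_higher_deriv[OF open_UNIV Ck_bound_const[of k 0] order_refl, of s] by simp
  finally show ?thesis by simp
qed

lemma H_deriv2_tendsto: "(deriv (deriv H) \<longlongrightarrow> 0) at_bot"
proof (rule tendstoI)
  fix e :: real assume "e > 0"
  then obtain N where N: "(1/2) ^ N < e" using real_arch_pow_inv[of e "1/2"] by auto
  have "\<bar>deriv (deriv H) s\<bar> < e" if "s < \<alpha> N" for s
  proof -
    have "\<bar>(deriv ^^ 2) H s\<bar> \<le> (1/2) ^ (N + 1)" by (rule H_deriv_small[OF that]) simp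
    moreover have "(1/2::real) ^ (N + 1) \<le> (1/2) ^ N" by (rule power_decreasing) auto
    ultimately show ?thesis using N by (simp add: numeral_2_eq_2)
  qed
  then show "\<forall>\<^sub>F s in at_bot. dist (deriv (deriv H) s) 0 < e"
    unfolding eventually_at_bot_dense by (intro exI[of _ "\<alpha> N"]) simp
qed

lemma clock_exists: "\<exists>\<kappa>. perturbed_flow (base_field c) \<sigma>0 \<psi>0 H \<kappa>"
proof (rule perturbed_flow_exists[OF Cinf_on_H])
  show "\<bar>deriv H s\<bar> \<le> 1 / 2" for s using H_derivs_le_half[of 1 s] by simp
  show "\<bar>H s\<bar> \<le> 1" for s using H_derivs_le_half[of 0 s] by simp
qed

end

section \<open>Smoothness at well approximated times\<close>

locale construction_flow = construction +
  fixes \<kappa> :: "real \<Rightarrow> real"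
  assumes perturbed: "perturbed_flow (base_field c) \<sigma>0 \<psi>0 H \<kappa>"
begin

sublocale perturbed_flow "base_field c" \<sigma>0 \<psi>0 H \<kappa> by (rule perturbed)

text \<open>The points at which, for any time of modulus at most one, the $n$-th wave is the only one that contributes to the phase shift.\<close>

definition zone_clock :: "nat \<Rightarrow> real set" where
  "zone_clock n = {orbit (\<gamma> (Suc n) + 1)<..<orbit (\<alpha> n - 1)}"

lemma zone_clock_pos: "x \<in> zone_clock n \<Longrightarrow> x > 0"
  using orbit_pos[of "\<gamma> (Suc n) + 1"] by (simp add: zone_clock_def)

lemma zone_clock_iff:
  "x > 0 \<Longrightarrow> x \<in> zone_clock n \<longleftrightarrow> \<gamma> (Suc n) + 1 < clock x \<and> clock x < \<alpha> n - 1"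
  by (simp add: zone_clock_def clock_less_iff less_clock_iff)

lemma H_small: "\<bar>H s\<bar> \<le> 1/2" using H_derivs_le_half[of 0 s] by simp

lemma base_position:
  assumes "x > 0"
  shows "S j < clock x - 1 \<Longrightarrow> 1 / 4 ^ j < x" "clock x < S j + 15 \<Longrightarrow> x < 2 / 4 ^ j"
proof -
  have b: "\<bar>\<sigma>0 x - clock x\<bar> \<le> 1/2" using clock_plus_H[of x] H_small[of "clock x"] by linarith
  have x: "\<psi>0 (\<sigma>0 x) = x" using \<psi>0_\<sigma>0 assms by simp
  show "1 / 4 ^ j < x" if "S j < clock x - 1"
    using \<psi>0_strict_mono[of "S j" "\<sigma>0 x"] b that x \<psi>0_plateau(2)[of j "S j"] by linarith
  show "x < 2 / 4 ^ j" if "clock x < S j + 15"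
    using \<psi>0_strict_mono[of "\<sigma>0 x" "S j + 16"] b that x \<psi>0_plateau(3)[of j "S j + 16"] by linarith
qed

lemma zone_clock_subset: "zone_clock n \<subseteq> zone n"
proof
  fix x assume x: "x \<in> zone_clock n"
  have p: "x > 0" by (rule zone_clock_pos[OF x])
  have "\<gamma> (Suc n) + 1 < clock x" "clock x < \<alpha> n - 1" using x zone_clock_iff[OF p] by auto
  then show "x \<in> zone n" using base_position[OF p, of "2 * n + 2"] base_position[OF p, of "2 * n"]
    by (simp add: zone_def \<alpha>_def \<gamma>_def)
qed

lemma zone_clock_DERIV:
  assumes x: "x \<in> zone_clock n"
  shows "(clock has_real_derivative inverse (1 + deriv (h n) (clock x)) * inverse (base_field c x)) (at x)"
proof -
  have p: "x > 0" by (rule zone_clock_pos[OF x])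
  have "deriv H (clock x) = deriv (h n) (clock x)"
    using H_deriv_local[of n "clock x" 1] x zone_clock_iff[OF p] by simp
  then show ?thesis using clock_DERIV[OF p] by simp
qed

lemma phase_shift_local:
  assumes x: "x \<in> zone_clock n" and t: "\<bar>t\<bar> \<le> 1"
  shows "phase_shift t x = h n (clock x + t) - h n (clock x)"
proof -
  have p: "x > 0" by (rule zone_clock_pos[OF x])
  have "\<gamma> (Suc n) + 1 < clock x" "clock x < \<alpha> n - 1" using x zone_clock_iff[OF p] by auto
  then have "H (clock x + t) = h n (clock x + t)" "H (clock x) = h n (clock x)"
    using t by (auto intro!: H_local)
  then show ?thesis using p by (simp add: phase_shift_def)
qed

text \<open>After a time $r$ with $3^{m(n)} r$ an integer the sine repeats itself, and away from the switching times the cut-off factors are the same too.\<close>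

lemma h_periodic:
  assumes r: "real (3 ^ m n) * r = of_int p" "\<bar>r\<bar> \<le> 2"
    and s: "s < \<alpha> (Suc n) - 3 \<or> \<alpha> (Suc n) + 3 < s \<and> s < \<gamma> n - 3 \<or> \<gamma> n + 3 < s"
  shows "h n (s + r) = h n s"
proof -
  have "2 * pi * real (3 ^ m n) * (s + r) = 2 * pi * real (3 ^ m n) * s + (2 * pi) * of_int p"
    unfolding r(1)[symmetric] by (simp add: algebra_simps)
  then have "sin (2 * pi * real (3 ^ m n) * (s + r)) = sin (2 * pi * real (3 ^ m n) * s)"
    by (simp only: sin_add sin_int_2pin cos_int_2pin mult_zero_right mult_1_right add_0_right)
  moreover have "smooth_step (s + r - \<alpha> (Suc n)) * smooth_step (\<gamma> n - (s + r)) =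
      smooth_step (s - \<alpha> (Suc n)) * smooth_step (\<gamma> n - s)"
    using s r(2) by (auto simp: smooth_step_simps)
  ultimately show ?thesis by (simp only: h_def wave_def)
qed

text \<open>Near the switching times the field is on a fast stretch and the amplitude is small enough. Elsewhere the wave repeats itself after the nearby time $r$, so that the phase shift for time $t$ is the difference of two nearly equal translates of the wave.\<close>

lemma phase_shift_small:
  assumes t: "\<bar>t\<bar> \<le> 1" and p: "\<bar>t - of_int p / 3 ^ m n\<bar> \<le> \<delta> n" and x: "x \<in> zone_clock n" and k: "k \<le> n"
  shows "\<bar>(deriv ^^ k) (phase_shift t) x\<bar> \<le> (1/2) ^ n"
proof -
  define r where "r = real_of_int p / 3 ^ m n"
  have \<delta>: "\<delta> n \<le> 1" by (rule zone_stepD(4)[OF step])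
  have r: "real (3 ^ m n) * r = of_int p" "\<bar>r\<bar> \<le> 2" "\<bar>t - r\<bar> \<le> \<delta> n"
    using p t \<delta> by (auto simp: r_def)
  have oz: "open (zone_clock n)" by (simp add: zone_clock_def)
  have x0: "x > 0" by (rule zone_clock_pos[OF x])
  have via: ?thesis if "open U" "x \<in> U" "Ck_bound n ((1/2) ^ n) U J" "\<And>y. y \<in> U \<Longrightarrow> J y = phase_shift t y" for U J
    by (rule Ck_bound_higher_deriv[OF that(1) Ck_bound_cong[OF that(1,4,3)] k that(2)])
  have window: ?thesis if j: "j \<in> {2 * n, 2 * n + 2}" and xj: "1 / 4 ^ j < x" "x < 2 / 4 ^ j" for j
  proof -
    define U where "U = zone_clock n \<inter> {1 / 4 ^ j<..<2 / 4 ^ j}"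
    have cj: "base_field c y = cap j" if "y \<in> U" for y
    proof -
      have "base_field c y = c j" using that by (intro base_field_plateau[OF adm]) (auto simp: U_def)
      moreover have "c j = cap j" using j c_even[of n] c_even[of "Suc n"] by auto
      ultimately show ?thesis by simp
    qed
    have "\<forall>y\<in>U. (clock has_real_derivative inverse (1 + deriv (h n) (clock y)) * inverse (cap j)) (at y)"
      using zone_clock_DERIV[of _ n] unfolding U_def by (metis IntD1 U_def cj)
    then have b: "Ck_bound n ((1/2) ^ n) U (\<lambda>y. h n (clock y + t) - h n (clock y))"
      unfolding h_def by (rule zone_step_fast[OF step j])
    have e: "h n (clock y + t) - h n (clock y) = phase_shift t y" if "y \<in> U" for y
    proof -
      have "y \<in> zone_clock n" using that by (simp add: U_def)
      then show ?thesis by (rule phase_shift_local[OF _ t, symmetric])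
    qed
    have "open U" "x \<in> U" using oz x xj by (auto simp: U_def)
    then show ?thesis using b e by (rule via)
  qed
  have bulk: ?thesis if V: "open V" "x \<in> V"
    "\<And>y. y \<in> V \<Longrightarrow> y > 0 \<Longrightarrow> clock y < \<alpha> (Suc n) - 3 \<or> \<alpha> (Suc n) + 3 < clock y \<and> clock y < \<gamma> n - 3 \<or> \<gamma> n + 3 < clock y" for V
  proof -
    define U where "U = zone_clock n \<inter> V"
    have zf: "base_field c y = zone_field n (c (2 * n + 1)) y" if "y \<in> U" for y
      using that zone_clock_subset[of n] c_even[of n] c_even[of "Suc n"]
      by (intro base_field_zone[OF adm]) (auto simp: U_def)
    have d: "\<forall>y\<in>U. (clock has_real_derivative inverse (1 + deriv (h n) (clock y)) * inverse (zone_field n (c (2 * n + 1)) y)) (at y)"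
    proof
      fix y assume y: "y \<in> U"
      then have "y \<in> zone_clock n" by (simp add: U_def)
      from zone_clock_DERIV[OF this] show "(clock has_real_derivative inverse (1 + deriv (h n) (clock y)) * inverse (zone_field n (c (2 * n + 1)) y)) (at y)"
        by (simp only: zf[OF y])
    qed
    have "U \<subseteq> zone n" using zone_clock_subset by (auto simp: U_def)
    then have b: "Ck_bound n ((1/2) ^ n) U (\<lambda>y. h n (clock y + t) - h n (clock y + r))"
      using r(3) d unfolding h_def by (rule zone_step_near[OF step])
    have e: "h n (clock y + t) - h n (clock y + r) = phase_shift t y" if y: "y \<in> U" for y
    proof -
      have z: "y \<in> zone_clock n" "y \<in> V" using y by (auto simp: U_def)
      have "h n (clock y + r) = h n (clock y)"
        by (rule h_periodic[OF r(1,2) V(3)[OF z(2) zone_clock_pos[OF z(1)]]])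
      then show ?thesis using phase_shift_local[OF z(1) t] by simp
    qed
    have "open U" "x \<in> U" using oz V x by (auto simp: U_def)
    then show ?thesis using b e by (rule via)
  qed
  consider "\<alpha> (Suc n) - 3 \<le> clock x \<and> clock x \<le> \<alpha> (Suc n) + 3" | "\<gamma> n - 3 \<le> clock x \<and> clock x \<le> \<gamma> n + 3"
    | "clock x < \<alpha> (Suc n) - 3" | "\<alpha> (Suc n) + 3 < clock x \<and> clock x < \<gamma> n - 3" | "\<gamma> n + 3 < clock x"
    by linarith
  then show ?thesis
  proof cases
    case 1
    then show ?thesis using base_position[OF x0, of "2 * n + 2"] by (intro window[of "2 * n + 2"]) (auto simp: \<alpha>_def)
  next
    case 2
    then show ?thesis using base_position[OF x0, of "2 * n"] by (intro window[of "2 * n"]) (auto simp: \<gamma>_def)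
  next
    case 3
    show ?thesis by (rule bulk[of "{..<orbit (\<alpha> (Suc n) - 3)}"]) (use 3 x0 clock_less_iff in auto)
  next
    case 4
    show ?thesis
      by (rule bulk[of "{orbit (\<alpha> (Suc n) + 3)<..<orbit (\<gamma> n - 3)}"]) (use 4 x0 clock_less_iff less_clock_iff in auto)
  next
    case 5
    show ?thesis by (rule bulk[of "{orbit (\<gamma> n + 3)<..}"]) (use 5 x0 less_clock_iff in auto)
  qed
qed

lemma flow_smooth_at_well_approximated_time:
  assumes t: "\<bar>t\<bar> \<le> 1" and p: "\<And>n. \<exists>p::int. \<bar>t - of_int p / 3 ^ m n\<bar> \<le> \<delta> n"
  shows "Cinf_on (flow t) UNIV"
proof (rule Cinf_on_flow, rule tendstoI)
  fix k and e :: real assume "e > 0"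
  then obtain N where N: "(1/2) ^ N < e" using real_arch_pow_inv[of e "1/2"] by auto
  define K where "K = max k N"
  have "\<bar>(deriv ^^ k) (phase_shift t) x\<bar> < e" if x: "0 < x" "x < orbit (\<alpha> K - 1)" for x
  proof -
    have "clock x < \<alpha> K - 1" using clock_less_iff x by simp
    then obtain n where n: "n \<ge> K" "\<gamma> (Suc n) + 1 < clock x" "clock x < \<alpha> n - 1"
      using zones_cover[of "clock x" K 1] by auto
    have xz: "x \<in> zone_clock n" using zone_clock_iff[OF x(1)] n by simp
    obtain p :: int where p: "\<bar>t - of_int p / 3 ^ m n\<bar> \<le> \<delta> n" using p by blast
    have "\<bar>(deriv ^^ k) (phase_shift t) x\<bar> \<le> (1/2) ^ n"
      using n(1) by (intro phase_shift_small[OF t p xz]) (simp add: K_def)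
    also have "\<dots> \<le> (1/2) ^ N" using n(1) by (intro power_decreasing) (auto simp: K_def)
    finally show ?thesis using N by simp
  qed
  then show "\<forall>\<^sub>F x in at_right 0. dist ((deriv ^^ k) (phase_shift t) x) 0 < e"
    unfolding eventually_at_right_field using orbit_pos by (intro exI[of _ "orbit (\<alpha> K - 1)"]) simp
qed

text \<open>On the slow stretch the wave is fully switched on and the base field is constant, so that everything is explicit.\<close>

lemma slow_orbit:
  assumes "S (2 * n + 1) + 1 \<le> s" "s \<le> S (2 * n + 1) + 15"
  shows "orbit s = 1 / 4 ^ (2 * n + 1) + c (2 * n + 1) * (s + \<epsilon> n * sin (2 * pi * 3 ^ m n * s) - S (2 * n + 1))"
proof -
  have 1: "S (2 * n + 2) + 16 \<le> S (2 * n + 1)" "S (2 * n + 1) + 16 \<le> S (2 * n)"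
    using S_Suc[of "2 * n + 1"] S_Suc[of "2 * n"] by auto
  have "H s = h n s" using 1 assms by (intro H_local) (auto simp: \<alpha>_def \<gamma>_def)
  also have "\<dots> = \<epsilon> n * sin (2 * pi * 3 ^ m n * s)"
    using 1 assms by (simp add: h_def wave_def smooth_step_simps \<alpha>_def \<gamma>_def)
  finally have H: "H s = \<epsilon> n * sin (2 * pi * 3 ^ m n * s)" .
  have "\<psi>0 (s + H s) = 1 / 4 ^ (2 * n + 1) + c (2 * n + 1) * (s + H s - S (2 * n + 1))"
    using assms H_small[of s] by (intro \<psi>0_plateau(1)) linarith+
  then show ?thesis by (simp only: orbit_def H)
qed

end

section \<open>The map at time one half\<close>

text \<open>If $f(x) - x$ falls by $A$ from $x_0$ to $x_1$ and does not fall from $x_1$ to $x_2$, then its derivative increases by at least $A/(x_1 - x_0)$, so that $f''$ is at least $A/((x_1 - x_0)(x_2 - x_0))$ somewhere. A continuous second derivative is bounded near the origin.\<close>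

lemma not_C2_at_zeroI:
  fixes f :: "real \<Rightarrow> real"
  assumes zigzag: "\<And>n d. d > 0 \<Longrightarrow> \<exists>x0 x1 x2 A. 0 < x0 \<and> x0 < x1 \<and> x1 < x2 \<and> x2 < d \<and>
      f x1 - x1 \<le> f x0 - x0 - A \<and> f x1 - x1 \<le> f x2 - x2 \<and> real n * ((x1 - x0) * (x2 - x0)) < A"
  shows "\<not> Ck_at_zero 2 f"
proof
  assume "Ck_at_zero 2 f"
  then obtain e where e: "e > 0" and C2: "Ck_on (Suc (Suc 0)) f {0..<e}"
    unfolding Ck_at_zero_def numeral_2_eq_2 by blast
  obtain f' where f': "\<And>x. x \<in> {0..<e} \<Longrightarrow> (f has_real_derivative f' x) (at x within {0..<e})"
    and C1: "Ck_on (Suc 0) f' {0..<e}" using Ck_on_SucE[OF C2] by metis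
  obtain f'' where f'': "\<And>x. x \<in> {0..<e} \<Longrightarrow> (f' has_real_derivative f'' x) (at x within {0..<e})"
    and C0: "Ck_on 0 f'' {0..<e}" using Ck_on_SucE[OF C1] by metis
  have at: "at x within {0..<e} = at x" if "0 < x" "x < e" for x
    by (rule at_within_interior) (use that in simp)
  have df: "(f has_real_derivative f' x) (at x)" "(f' has_real_derivative f'' x) (at x)" if "0 < x" "x < e" for x
    using f'[of x] f''[of x] that at[OF that] by simp_all
  have "continuous_on {0..e / 2} f''" using C0 e by (auto intro: continuous_on_subset)
  then have "bounded (f'' ` {0..e / 2})" by (intro compact_imp_bounded compact_continuous_image) auto
  then obtain B where B: "\<forall>z\<in>f'' ` {0..e / 2}. norm z \<le> B" unfolding bounded_iff by blast
  obtain n :: nat where n: "B \<le> real n" using real_arch_simple by blast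
  obtain x0 x1 x2 A where x: "0 < x0" "x0 < x1" "x1 < x2" "x2 < e / 2"
    and A1: "f x1 - x1 \<le> f x0 - x0 - A" and A2: "f x1 - x1 \<le> f x2 - x2"
    and A: "real n * ((x1 - x0) * (x2 - x0)) < A"
    using zigzag[of "e / 2" n] e by auto
  have dG: "((\<lambda>x. f x - x) has_real_derivative f' x - 1) (at x)" if "0 < x" "x < e" for x
    using df(1)[OF that] by (intro DERIV_diff DERIV_ident)
  obtain z1 where z1: "x0 < z1" "z1 < x1" "(f x1 - x1) - (f x0 - x0) = (x1 - x0) * (f' z1 - 1)"
    using MVT2[OF x(2), of "\<lambda>x. f x - x" "\<lambda>x. f' x - 1"] dG x by fastforce
  obtain z2 where z2: "x1 < z2" "z2 < x2" "(f x2 - x2) - (f x1 - x1) = (x2 - x1) * (f' z2 - 1)"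
    using MVT2[OF x(3), of "\<lambda>x. f x - x" "\<lambda>x. f' x - 1"] dG x by fastforce
  have z12: "z1 < z2" using z1 z2 by simp
  obtain z where z: "z1 < z" "z < z2" "f' z2 - f' z1 = (z2 - z1) * f'' z"
    using MVT2[OF z12, of f' f''] df(2) x z1 z2 by fastforce
  have "0 \<le> (x2 - x1) * (f' z2 - 1)" using A2 z2(3) by linarith
  then have "0 \<le> f' z2 - 1" using x(3) by (simp add: zero_le_mult_iff)
  moreover have "(x1 - x0) * (f' z1 - 1) \<le> - A" using A1 z1(3) by linarith
  ultimately have 1: "A \<le> (x1 - x0) * (f' z2 - f' z1)"
    using mult_nonneg_nonneg[of "x1 - x0" "f' z2 - 1"] x(2) by (simp add: algebra_simps)
  have "z \<in> {0..e / 2}" using z z1 z2 x by simp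
  then have "norm (f'' z) \<le> B" using B by blast
  then have "f'' z \<le> real n" using n by simp
  then have "(z2 - z1) * f'' z \<le> (z2 - z1) * real n" using z12 by (intro mult_left_mono) auto
  also have "\<dots> \<le> (x2 - x0) * real n" using z1 z2 by (intro mult_right_mono) auto
  finally have "(z2 - z1) * f'' z \<le> (x2 - x0) * real n" .
  then have "(x1 - x0) * (f' z2 - f' z1) \<le> (x1 - x0) * ((x2 - x0) * real n)"
    using x(2) z(3) by (intro mult_left_mono) auto
  then show False using 1 A by (simp add: mult_ac)
qed

context construction_flow
begin

text \<open>The frequency is odd, so that half a unit of time reverses the sign of the wave. On the slow stretch the displacement of the point with time coordinate $s$ is therefore $v(1/2 - 2\<epsilon>\sin(2\pi q s))$. It falls by $2\<epsilon>v$ within a quarter of a period, a distance of at most $v$, which makes the second derivative at least of order $\<epsilon>/v \ge n + 1$.\<close>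

lemma half_time_not_C2: "\<not> Ck_at_zero 2 (flow (1/2))"
proof (rule not_C2_at_zeroI)
  fix n0 :: nat and d :: real assume d: "d > 0"
  obtain N where N: "(1/2) ^ N < d" using real_arch_pow_inv[OF d, of "1/2"] by auto
  define n where "n = max n0 N"
  define q where "q = real (3 ^ m n)"
  define v where "v = c (2 * n + 1)"
  define e where "e = \<epsilon> n"
  define j where "j = 2 * n + 1"
  have q1: "q \<ge> 1" by (simp add: q_def)
  have e0: "e > 0" and eq: "4 * q * e \<le> 1" and ev: "(real n + 1) * v \<le> e"
    unfolding e_def q_def v_def by (rule zone_stepD[OF step])+
  have v0: "v > 0" by (simp add: v_def c_gt0)
  \<comment> \<open>A time at which the wave starts a new period, shortly after the beginning of the slow stretch.\<close>
  define s0 where "s0 = of_int \<lceil>q * (S j + 1)\<rceil> / q"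
  have s0: "S j + 1 \<le> s0" "s0 \<le> S j + 2"
  proof -
    show "S j + 1 \<le> s0" unfolding s0_def using q1 by (simp add: pos_le_divide_eq mult.commute)
    have "of_int \<lceil>q * (S j + 1)\<rceil> \<le> q * (S j + 1) + 1" by linarith
    also have "\<dots> \<le> q * (S j + 2)" using q1 by (simp add: algebra_simps)
    finally show "s0 \<le> S j + 2" unfolding s0_def using q1 by (simp add: pos_divide_le_eq mult.commute)
  qed
  have orb: "orbit s = 1 / 4 ^ j + v * (s + e * sin (2 * pi * q * s) - S j)"
    if "S j + 1 \<le> s" "s \<le> S j + 15" for s
    using slow_orbit[of n s] that by (simp add: v_def e_def q_def j_def)
  have half: "sin (2 * pi * q * (s + 1/2)) = - sin (2 * pi * q * s)" for s
  proof -
    have "odd (3 ^ m n :: nat)" by simp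
    then obtain k :: nat where "3 ^ m n = 2 * k + 1" by (rule oddE)
    then have "q = 2 * real k + 1" unfolding q_def by (metis of_nat_1 of_nat_add of_nat_mult of_nat_numeral)
    then have "2 * pi * q * (s + 1/2) = (2 * pi * q * s + pi) + (2 * pi) * of_int (int k)"
      by (simp add: algebra_simps)
    then show ?thesis
      by (simp only: sin_add[of "2 * pi * q * s + pi"] sin_int_2pin cos_int_2pin mult_zero_right mult_1_right add_0_right sin_periodic_pi)
  qed
  have disp: "flow (1/2) (orbit s) - orbit s = v * (1/2 - 2 * e * sin (2 * pi * q * s))"
    if s: "S j + 1 \<le> s" "s \<le> S j + 14" for s
  proof -
    have "flow (1/2) (orbit s) = orbit (s + 1/2)" by (simp add: flow_def orbit_pos clock_orbit)
    also have "\<dots> = 1 / 4 ^ j + v * ((s + 1/2) + e * sin (2 * pi * q * (s + 1/2)) - S j)"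
      using s by (intro orb) auto
    also have "\<dots> = 1 / 4 ^ j + v * ((s + 1/2) - e * sin (2 * pi * q * s) - S j)"
      unfolding half by simp
    finally have F: "flow (1/2) (orbit s) = 1 / 4 ^ j + v * ((s + 1/2) - e * sin (2 * pi * q * s) - S j)" .
    have O: "orbit s = 1 / 4 ^ j + v * (s + e * sin (2 * pi * q * s) - S j)" using s by (intro orb) auto
    show ?thesis unfolding F unfolding O by (simp add: algebra_simps)
  qed
  have sin_s: "sin (2 * pi * q * (s0 + \<tau> / q)) = sin (2 * pi * \<tau>)" for \<tau>
  proof -
    have "2 * pi * q * (s0 + \<tau> / q) = 2 * pi * \<tau> + (2 * pi) * of_int \<lceil>q * (S j + 1)\<rceil>"
      using q1 by (simp add: s0_def algebra_simps)
    then show ?thesis by (simp only: sin_add sin_int_2pin cos_int_2pin mult_zero_right mult_1_right add_0_right)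
  qed
  define s1 where "s1 = s0 + (1/4) / q"
  define s2 where "s2 = s0 + (3/4) / q"
  have iq: "0 < 1 / q" "1 / q \<le> 1" using q1 by auto
  have s12: "s0 < s1" "s1 < s2" "s2 \<le> s0 + 1" using q1 iq by (auto simp: s1_def s2_def field_simps)
  have v_0: "sin (2 * pi * q * s0) = 0" using sin_s[of 0] by simp
  have v_1: "sin (2 * pi * q * s1) = 1" using sin_s[of "1/4"] by (simp add: s1_def)
  have v_2: "sin (2 * pi * q * s2) = - 1"
  proof -
    have "2 * pi * (3/4) = pi / 2 + pi" by simp
    then show ?thesis using sin_s[of "3/4"] unfolding s2_def by (simp only: sin_periodic_pi sin_pi_half)
  qed
  have rng: "S j + 1 \<le> s1" "S j + 1 \<le> s2" "s0 \<le> S j + 14" "s1 \<le> S j + 14" "s2 \<le> S j + 14"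
    using s0 s12 by auto
  have x01: "orbit s1 - orbit s0 = v * (1 / (4 * q) + e)"
    using orb[of s0] orb[of s1] s0 rng v_0 v_1 by (simp add: s1_def algebra_simps)
  have x02: "orbit s2 - orbit s0 = v * (3 / (4 * q) - e)"
    using orb[of s0] orb[of s2] s0 rng v_0 v_2 by (simp add: s2_def algebra_simps)
  have e1: "e \<le> 1 / (4 * q)" using eq q1 by (simp add: field_simps)
  have q4: "1 / (4 * q) \<le> 1 / 4" "3 / (4 * q) \<le> 3 / 4" using q1 by (auto simp: field_simps)
  have l01: "orbit s1 - orbit s0 \<le> v" 
    unfolding x01 using v0 e1 q4 mult_left_mono[of "1 / (4 * q) + e" 1 v] by linarith
  have l02: "orbit s2 - orbit s0 \<le> v"
    unfolding x02 using v0 e0 q4 mult_left_mono[of "3 / (4 * q) - e" 1 v] by linarith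
  have o: "orbit s0 < orbit s1" "orbit s1 < orbit s2" using s12 by (auto simp: orbit_less_iff)
  have small: "orbit s2 < d"
  proof -
    have "clock (orbit s2) < S j + 15" using rng by (simp add: clock_orbit)
    then have "orbit s2 < 2 / 4 ^ j" by (rule base_position(2)[OF orbit_pos])
    also have "\<dots> \<le> (1/2) ^ n"
    proof -
      have "(4::real) ^ j = 4 * (2 ^ n * 2 ^ n * (2 ^ n * 2 ^ n))"
        by (simp add: j_def power_add power_mult power_mult_distrib[symmetric])
      moreover have "(1::real) \<le> 2 ^ n" by simp
      then have "(1::real) * 1 \<le> 2 ^ n * (2 ^ n * 2 ^ n)" by (intro mult_mono) (auto simp: mult_ge1_I)
      ultimately show ?thesis by (simp add: power_one_over field_simps)
    qed
    also have "\<dots> \<le> (1/2) ^ N" by (intro power_decreasing) (auto simp: n_def)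
    finally show ?thesis using N by simp
  qed
  have bound: "real n0 * ((orbit s1 - orbit s0) * (orbit s2 - orbit s0)) < 2 * e * v"
  proof -
    have vv: "(orbit s1 - orbit s0) * (orbit s2 - orbit s0) \<le> v * v"
      using l01 l02 o v0 by (intro mult_mono) auto
    have "real n0 * ((orbit s1 - orbit s0) * (orbit s2 - orbit s0)) \<le> (real n + 1) * (v * v)"
    proof (rule mult_mono[OF _ vv])
      show "0 \<le> (orbit s1 - orbit s0) * (orbit s2 - orbit s0)"
        using o by (intro mult_nonneg_nonneg) auto
    qed (auto simp: n_def)
    also have "\<dots> = ((real n + 1) * v) * v" by simp
    also have "\<dots> \<le> e * v" using ev v0 by (intro mult_right_mono) auto
    also have "\<dots> < 2 * e * v" using e0 v0 by simp
    finally show ?thesis .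
  qed
  have D: "flow (1/2) (orbit s0) - orbit s0 = v * (1/2)"
    "flow (1/2) (orbit s1) - orbit s1 = v * (1/2 - 2 * e)"
    "flow (1/2) (orbit s2) - orbit s2 = v * (1/2 + 2 * e)"
    using disp[of s0] disp[of s1] disp[of s2] s0 rng v_0 v_1 v_2 by simp_all
  show "\<exists>x0 x1 x2 A. 0 < x0 \<and> x0 < x1 \<and> x1 < x2 \<and> x2 < d \<and>
      flow (1/2) x1 - x1 \<le> flow (1/2) x0 - x0 - A \<and> flow (1/2) x1 - x1 \<le> flow (1/2) x2 - x2 \<and>
      real n0 * ((x1 - x0) * (x2 - x0)) < A"
  proof (intro exI conjI)
    show "0 < orbit s0" by (rule orbit_pos)
    show "orbit s0 < orbit s1" "orbit s1 < orbit s2" by (rule o)+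
    show "orbit s2 < d" by (rule small)
    show "flow (1/2) (orbit s1) - orbit s1 \<le> flow (1/2) (orbit s0) - orbit s0 - 2 * e * v"
      unfolding D by (simp add: algebra_simps)
    show "flow (1/2) (orbit s1) - orbit s1 \<le> flow (1/2) (orbit s2) - orbit s2"
      unfolding D using v0 e0 by simp
    show "real n0 * ((orbit s1 - orbit s0) * (orbit s2 - orbit s0)) < 2 * e * v" by (rule bound)
  qed
qed

end

section \<open>A Cantor set of Liouville times\<close>

text \<open>The exponents $m$ grow so quickly that numbers whose only nonzero ternary digits sit at the places $m(n)$ are Liouville numbers.\<close>

locale lacunary =
  fixes m :: "nat \<Rightarrow> nat"
  assumes m0: "m 0 \<ge> 1" and mS: "\<And>n. m (Suc n) > m n + n"
begin

text \<open>Digit zero is avoided: then the tails of the expansions are positive, which is used for irrationality.\<close>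

definition digits :: "(nat \<Rightarrow> real) set" where "digits = PiE UNIV (\<lambda>_. {1, 2})"
definition val :: "(nat \<Rightarrow> real) \<Rightarrow> real" where "val b = (\<Sum>n. b n / 3 ^ m n)"

lemma digits_iff: "b \<in> digits \<longleftrightarrow> (\<forall>n. b n = 1 \<or> b n = 2)" by (auto simp: digits_def PiE_iff)

lemma digitsD: "b \<in> digits \<Longrightarrow> b n = 1 \<or> b n = 2" by (simp add: digits_iff)

lemma m_add: "m k + i \<le> m (k + i)"
proof (induction i)
  case (Suc i) then show ?case using mS[of "k + i"] by simp
qed simp

lemma m_mono: "i \<le> k \<Longrightarrow> m i \<le> m k"
  using m_add[of i "k - i"] by simp

lemma digit_le: "b \<in> digits \<Longrightarrow> b (k + i) / 3 ^ m (k + i) \<le> 2 / 3 ^ m k * (1/3) ^ i"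
proof -
  assume b: "b \<in> digits"
  have "(3::real) ^ (m k + i) \<le> 3 ^ m (k + i)" using m_add by (intro power_increasing) auto
  then have "b (k + i) / 3 ^ m (k + i) \<le> 2 / 3 ^ (m k + i)"
    using digitsD[OF b, of "k + i"] by (intro frac_le) auto
  then show ?thesis by (simp add: power_add power_one_over)
qed

lemma digit_pos: "b \<in> digits \<Longrightarrow> 0 < b n / 3 ^ m n"
  using digitsD[of b n] by auto

lemma geometric: "(\<lambda>i. 2 / 3 ^ m k * (1/3::real) ^ i) sums (3 / 3 ^ m k)"
  using sums_mult[OF geometric_sums[of "1/3::real"], of "2 / 3 ^ m k"] by simp

lemma summable_digits: "b \<in> digits \<Longrightarrow> summable (\<lambda>i. b (i + k) / 3 ^ m (i + k))"
proof (rule summable_comparison_test'[OF sums_summable[OF geometric[of k]]])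
  fix i assume b: "b \<in> digits"
  show "norm (b (i + k) / 3 ^ m (i + k)) \<le> 2 / 3 ^ m k * (1/3) ^ i"
    using digit_le[OF b, of k i] digit_pos[OF b, of "i + k"] by (simp add: add.commute)
qed

lemma tail_bounds:
  assumes b: "b \<in> digits"
  shows "0 < (\<Sum>i. b (i + k) / 3 ^ m (i + k))" "(\<Sum>i. b (i + k) / 3 ^ m (i + k)) \<le> 3 / 3 ^ m k"
proof -
  show "0 < (\<Sum>i. b (i + k) / 3 ^ m (i + k))"
    by (rule suminf_pos[OF summable_digits[OF b] digit_pos[OF b]])
  have "(\<Sum>i. b (i + k) / 3 ^ m (i + k)) \<le> (\<Sum>i. 2 / 3 ^ m k * (1/3) ^ i)"
    using digit_le[OF b, of k]
    by (intro suminf_le summable_digits[OF b] sums_summable[OF geometric]) (simp add: add.commute)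
  then show "(\<Sum>i. b (i + k) / 3 ^ m (i + k)) \<le> 3 / 3 ^ m k" using sums_unique[OF geometric[of k]] by simp
qed

lemma val_split:
  assumes b: "b \<in> digits"
  shows "\<exists>p::int. val b = of_int p / 3 ^ m k + (\<Sum>i. b (i + Suc k) / 3 ^ m (i + Suc k))"
proof -
  have "\<exists>p::int. b i * 3 ^ (m k - m i) = of_int p" for i
    using digitsD[OF b, of i] by (metis of_int_1 of_int_mult of_int_numeral of_int_power)
  then obtain p :: "nat \<Rightarrow> int" where p: "\<And>i. b i * 3 ^ (m k - m i) = of_int (p i)" by metis
  have "b i / 3 ^ m i = of_int (p i) / 3 ^ m k" if "i < Suc k" for i
  proof -
    have "m k = m i + (m k - m i)" using m_mono[of i k] that by simp
    then have "(3::real) ^ m k = 3 ^ m i * 3 ^ (m k - m i)" by (metis power_add)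
    then show ?thesis by (simp add: p[symmetric])
  qed
  then have "(\<Sum>i<Suc k. b i / 3 ^ m i) = (\<Sum>i<Suc k. of_int (p i) / 3 ^ m k)"
    by (intro sum.cong) auto
  also have "\<dots> = of_int (\<Sum>i<Suc k. p i) / 3 ^ m k" by (simp only: sum_divide_distrib of_int_sum)
  finally have "(\<Sum>i<Suc k. b i / 3 ^ m i) = of_int (\<Sum>i<Suc k. p i) / 3 ^ m k" .
  then show ?thesis
    using suminf_split_initial_segment[OF summable_digits[OF b, of 0, simplified], of "Suc k"]
    unfolding val_def by (intro exI[of _ "\<Sum>i<Suc k. p i"]) simp
qed

lemma val_range:
  assumes b: "b \<in> digits" shows "0 < val b" "val b \<le> 1"
proof -
  show "0 < val b" using tail_bounds(1)[OF b, of 0] by (simp add: val_def)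
  have "val b \<le> 3 / 3 ^ m 0" using tail_bounds(2)[OF b, of 0] by (simp add: val_def)
  also have "\<dots> \<le> 3 / 3 ^ 1" using m0 by (intro divide_left_mono power_increasing) auto
  finally show "val b \<le> 1" by simp
qed

text \<open>If the number were $a/d$, then $d 3^{m(k)}$ times the tail after the place $k$ would be an integer; but it is positive and, for large $k$, smaller than one.\<close>

lemma val_irrational:
  assumes b: "b \<in> digits" shows "val b \<notin> \<rat>"
proof
  assume "val b \<in> \<rat>"
  then obtain a d :: int where d: "d > 0" "val b = of_int a / of_int d"
    using Rats_cases' by metis
  obtain k where k: "real_of_int d < 3 ^ k" using real_arch_pow[of 3 "real_of_int d"] by auto
  obtain p :: int where p: "val b = of_int p / 3 ^ m k + (\<Sum>i. b (i + Suc k) / 3 ^ m (i + Suc k))"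
    using val_split[OF b] by blast
  define T where "T = (\<Sum>i. b (i + Suc k) / 3 ^ m (i + Suc k))"
  have T: "0 < T" "T \<le> 3 / 3 ^ m (Suc k)" using tail_bounds[OF b, of "Suc k"] by (auto simp: T_def)
  define z where "z = a * 3 ^ m k - d * p"
  have "of_int z = real_of_int d * 3 ^ m k * T"
  proof -
    have "T = of_int a / of_int d - of_int p / 3 ^ m k" using p d(2) by (simp add: T_def)
    then show ?thesis using d(1) by (simp add: z_def field_simps)
  qed
  moreover have "0 < real_of_int d * 3 ^ m k * T" using d T by simp
  moreover have "real_of_int d * 3 ^ m k * T < 1"
  proof -
    have "(3::real) ^ (m k + k + 1) \<le> 3 ^ m (Suc k)" using mS[of k] by (intro power_increasing) auto
    then have "3 / 3 ^ m (Suc k) \<le> (3::real) / 3 ^ (m k + k + 1)" by (intro divide_left_mono) auto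
    then have "T \<le> 1 / (3 ^ m k * 3 ^ k)" using T by (simp add: power_add)
    then have "real_of_int d * 3 ^ m k * T \<le> real_of_int d * 3 ^ m k * (1 / (3 ^ m k * 3 ^ k))"
      using d by (intro mult_left_mono) auto
    also have "\<dots> = real_of_int d / 3 ^ k" by simp
    also have "\<dots> < 1" using k by simp
    finally show ?thesis .
  qed
  ultimately have "0 < z" "z < 1" by (metis of_int_0_less_iff, metis of_int_less_1_iff)
  then show False by simp
qed

lemma val_approx:
  assumes b: "b \<in> digits" shows "\<exists>p::int. \<bar>val b - of_int p / 3 ^ m n\<bar> \<le> 3 / 3 ^ m (Suc n)"
proof -
  obtain p :: int where "val b = of_int p / 3 ^ m n + (\<Sum>i. b (i + Suc n) / 3 ^ m (i + Suc n))"
    using val_split[OF b] by blast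
  then show ?thesis using tail_bounds[OF b, of "Suc n"] by (intro exI[of _ p]) simp
qed

text \<open>The digit sequences form a product of finite sets, which is compact, and the value depends continuously on the sequence since the series converges uniformly.\<close>

lemma compact_vals: "compact (val ` digits)"
proof (rule compact_continuous_image)
  have "compactin (product_topology (\<lambda>_::nat. euclidean :: real topology) UNIV) (PiE UNIV (\<lambda>_. {1, 2}))"
    by (subst compactin_PiE) simp
  then show "compact digits" by (simp add: digits_def euclidean_product_topology)
  have ul: "uniform_limit digits (\<lambda>n b. \<Sum>i<n. b i / 3 ^ m i) val sequentially"
    unfolding val_def[abs_def]
  proof (rule Weierstrass_m_test[OF _ sums_summable[OF geometric[of 0]]])
    show "norm (b n / 3 ^ m n) \<le> 2 / 3 ^ m 0 * (1/3) ^ n" if "b \<in> digits" for n b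
      using digit_le[OF that, of 0 n] digit_pos[OF that, of n] by simp
  qed
  have ci: "continuous_on digits (\<lambda>b. b i / 3 ^ m i)" for i :: nat
  proof (rule continuous_on_divide[OF _ continuous_on_const])
    show "continuous_on digits (\<lambda>b. b i)"
      by (rule continuous_on_subset[OF continuous_on_product_coordinates]) simp
  qed simp
  have cs: "\<forall>\<^sub>F n in sequentially. continuous_on digits (\<lambda>b. \<Sum>i<n. b i / 3 ^ m i)"
    by (rule always_eventually, rule allI, rule continuous_on_sum, rule ci)
  show "continuous_on digits val"
    by (rule uniform_limit_theorem[OF cs ul]) simp
qed

lemma val_flip:
  assumes b: "b \<in> digits"
  defines "b' \<equiv> \<lambda>n. b(n := 3 - b n)"
  shows "b' n \<in> digits" "\<bar>val (b' n) - val b\<bar> = 1 / 3 ^ m n"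
proof -
  show d: "b' n \<in> digits" using digitsD[OF b] digitsD[OF b, of n] by (auto simp: digits_iff b'_def)
  have "val (b' n) - val b = (\<Sum>i. b' n i / 3 ^ m i - b i / 3 ^ m i)"
    unfolding val_def using summable_digits[OF b, of 0] summable_digits[OF d, of 0]
    by (intro suminf_diff) auto
  also have "\<dots> = (\<Sum>i\<in>{n}. b' n i / 3 ^ m i - b i / 3 ^ m i)"
    by (rule suminf_finite) (auto simp: b'_def)
  also have "\<dots> = (3 - 2 * b n) / 3 ^ m n" by (simp add: b'_def diff_divide_distrib)
  finally show "\<bar>val (b' n) - val b\<bar> = 1 / 3 ^ m n" using digitsD[OF b, of n] by auto
qed

lemma connected_irrational_singleton:
  fixes C :: "real set"
  assumes "connected C" "x \<in> C" "y \<in> C" "C \<subseteq> - \<rat>"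
  shows "x = y"
proof (rule ccontr)
  assume "x \<noteq> y"
  then have lt: "min x y < max x y" by auto
  then obtain r where r: "r \<in> \<rat>" "min x y < r" "r < max x y" using Rats_dense_in_real by metis
  have "r \<in> C" using connectedD_interval[OF assms(1), of "min x y" "max x y" r] assms(2,3) r
    by (auto simp: min_def max_def split: if_splits)
  then show False using r assms(4) by auto
qed

text \<open>Changing a single far digit produces other points arbitrarily close to a given one. A connected set with two points would contain a rational number.\<close>

lemma cantor_set_vals: "cantor_set (val ` digits)" and vals_irrational: "val ` digits \<subseteq> - \<rat>"
proof -
  show irr: "val ` digits \<subseteq> - \<rat>" using val_irrational by auto
  have "(\<lambda>_. 1) \<in> digits" by (auto simp: digits_def)
  then have ne: "val ` digits \<noteq> {}" by auto
  have lim: "x islimpt val ` digits" if x: "x \<in> val ` digits" for x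
    unfolding islimpt_approachable
  proof (intro allI impI)
    fix e :: real assume "e > 0"
    obtain b where b: "b \<in> digits" "x = val b" using x by blast
    obtain n where n: "(1/3) ^ n < e" using real_arch_pow_inv[OF \<open>e > 0\<close>, of "1/3"] by auto
    have "(1/3::real) ^ m n \<le> (1/3) ^ n" using m_add[of 0 n] by (intro power_decreasing) auto
    then have "1 / 3 ^ m n < e" using n by (simp add: power_one_over)
    then show "\<exists>y\<in>val ` digits. y \<noteq> x \<and> dist y x < e"
      using val_flip[OF b(1), of n] b(2) by (intro bexI[of _ "val (b(n := 3 - b n))"]) (auto simp: dist_real_def)
  qed
  have conn: "connected_component_set (val ` digits) x = {x}" if x: "x \<in> val ` digits" for x
  proof -
    have "y = x" if "y \<in> connected_component_set (val ` digits) x" for y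
      using connected_irrational_singleton[OF connected_connected_component, of y "val ` digits" x x]
        that x irr connected_component_subset[of "val ` digits" x] connected_component_refl[OF x] by blast
    then show ?thesis using connected_component_refl[OF x] by auto
  qed
  show "cantor_set (val ` digits)" unfolding cantor_set_def using ne compact_vals lim conn by blast
qed

end

section \<open>The times for which the flow is smooth\<close>

theorem proposition1:
  shows "\<exists>(K :: real set) (\<xi> :: real \<Rightarrow> real) (f :: real \<Rightarrow> real \<Rightarrow> real).
    cantor_set K \<and> K \<subseteq> - \<rat> \<and>
    Ck_on 1 \<xi> {0..} \<and> complete_vector_field \<xi> \<and>
    (\<forall>x\<in>{0..}. \<xi> x = 0 \<longleftrightarrow> x = 0) \<and>
    is_flow \<xi> f \<and>
    \<not> Ck_at_zero 2 (f (1/2)) \<and>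
    (\<forall>t \<in> group_closure (insert 1 K). Cinf_on (f t) {0..})"
proof -
  obtain m :: "nat \<Rightarrow> nat" and \<epsilon> \<delta> c :: "nat \<Rightarrow> real" where
    par: "m 0 \<ge> 1" "\<And>n. m (Suc n) > m n + n" "\<And>n. 3 / 3 ^ m (Suc n) \<le> \<delta> n" "admissible c"
      "\<And>n. c (2 * n) = cap (2 * n)" "\<And>n. zone_step n (3 ^ m n) (\<epsilon> n) (c (2 * n + 1)) (\<delta> n)"
    by (rule parameters_exist) (rule that)
  obtain \<sigma>0 \<psi>0 where flat: "flat_field (base_field c) \<sigma>0 \<psi>0"
    using flat_field_exists[OF Cinf_on_base_field[OF par(4)] base_field_nonpos[OF par(4)]
        base_field_pos[OF par(4)] base_field_bounded[OF par(4)]] by blast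
  interpret con: construction m \<epsilon> \<delta> c \<sigma>0 \<psi>0
    using par(4-6) flat by (rule construction.intro)
  obtain \<kappa> where "perturbed_flow (base_field c) \<sigma>0 \<psi>0 con.H \<kappa>" using con.clock_exists by blast
  then interpret fl: construction_flow m \<epsilon> \<delta> c \<sigma>0 \<psi>0 \<kappa>
    by (intro construction_flow.intro construction_flow_axioms.intro con.construction_axioms)
  interpret lac: lacunary m using par(1,2) by (rule lacunary.intro)
  let ?K = "lac.val ` lac.digits"
  \<comment> \<open>Asking for both signs makes this set closed under subtraction.\<close>
  define T where "T = {t. Cinf_on (fl.flow t) {0..} \<and> Cinf_on (fl.flow (- t)) {0..}}"
  have T: "t \<in> T" if t: "\<bar>t\<bar> \<le> 1" "\<And>n. \<exists>p::int. \<bar>t - of_int p / 3 ^ m n\<bar> \<le> \<delta> n" for t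
  proof -
    have sub: "Cinf_on g {0..}" if "Cinf_on g UNIV" for g
      using that Ck_on_subset[of _ g UNIV "{0..}"] by (simp add: Cinf_on_def)
    have neg: "\<exists>p::int. \<bar>- t - of_int p / 3 ^ m n\<bar> \<le> \<delta> n" for n
    proof -
      obtain p :: int where p: "\<bar>t - of_int p / 3 ^ m n\<bar> \<le> \<delta> n" using t(2) by blast
      have "- t - of_int (- p) / 3 ^ m n = - (t - of_int p / 3 ^ m n)" by simp
      then show ?thesis using p by (metis abs_minus_cancel)
    qed
    have "Cinf_on (fl.flow t) UNIV" by (rule fl.flow_smooth_at_well_approximated_time[OF t])
    moreover have "Cinf_on (fl.flow (- t)) UNIV"
      by (rule fl.flow_smooth_at_well_approximated_time[OF _ neg]) (use t in simp)
    ultimately show ?thesis using sub by (simp add: T_def)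
  qed
  have one: "1 \<in> T"
  proof (rule T)
    fix n
    have "0 < \<delta> n" using par(3)[of n] by (rule less_le_trans[rotated]) simp
    then show "\<exists>p::int. \<bar>1 - of_int p / 3 ^ m n\<bar> \<le> \<delta> n" by (intro exI[of _ "3 ^ m n"]) simp
  qed simp
  have vals: "lac.val b \<in> T" if b: "b \<in> lac.digits" for b
  proof (rule T)
    show "\<bar>lac.val b\<bar> \<le> 1" using lac.val_range[OF b] by simp
    show "\<exists>p::int. \<bar>lac.val b - of_int p / 3 ^ m n\<bar> \<le> \<delta> n" for n
      using lac.val_approx[OF b, of n] par(3)[of n] by (meson order_trans)
  qed
  have comp: "Cinf_on (fl.flow (s + t)) {0..}" if "Cinf_on (fl.flow s) {0..}" "Cinf_on (fl.flow t) {0..}" for s t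
  proof -
    have "Cinf_on (\<lambda>x. fl.flow s (fl.flow t x)) {0..}"
      by (rule Cinf_on_comp[OF that]) (use fl.flow_nonneg in auto)
    moreover have "(\<lambda>x. fl.flow s (fl.flow t x)) = fl.flow (s + t)" using fl.flow_add by auto
    ultimately show ?thesis by simp
  qed
  have T_diff: "s - t \<in> T" if "s \<in> T" "t \<in> T" for s t
    using that comp[of s "- t"] comp[of t "- s"] by (simp add: T_def)
  have gen: "t \<in> T" if "t \<in> group_closure (insert 1 ?K)" for t
    using that
  proof induction
    case (base s)
    then show ?case using one vals T_diff[OF one one] by auto
  next
    case (diff s t)
    then show ?case using T_diff by blast
  qed
  show ?thesis
  proof (intro exI conjI)
    show "cantor_set ?K" by (rule lac.cantor_set_vals)
    show "?K \<subseteq> - \<rat>" by (rule lac.vals_irrational)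
    show "Ck_on 1 fl.field {0..}" by (rule fl.field_C1[OF con.H_deriv2_tendsto])
    show "complete_vector_field fl.field" by (rule fl.complete_field)
    show "\<forall>x\<in>{0..}. fl.field x = 0 \<longleftrightarrow> x = 0" using fl.field_eq_0_iff by simp
    show "is_flow fl.field fl.flow" by (rule fl.is_flow_flow)
    show "\<not> Ck_at_zero 2 (fl.flow (1/2))" by (rule fl.half_time_not_C2)
    show "\<forall>t\<in>group_closure (insert 1 ?K). Cinf_on (fl.flow t) {0..}" using gen by (simp add: T_def)
  qed
qed

end
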